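(* Let $$G:\mathbb R^{N-1}\times[0,+\infty)\times[0,+\infty)\times\Omega'\to[0,+\infty),\qquad G=G(z',z_N,v,x'),$$ be continuous in all its arguments, convex in $z=(z',z_N)$, and nondecreasing in $z_N$. Let $u\in L^N$. Then $u^*\in L^N$ and $$\int_\Omega G\bigl(\nabla'u,\ f|u_y|,\ u,\ x'\bigr)\,dx\ \ge\ \int_\Omega G\bigl(\nabla'u^*,\ f|u^*_y|,\ u^*,\ x'\bigr)\,dx .$$
   Context: Points of $\mathbb R^N$ ($N\ge2$) are written $x=(x',y)$ with $x'=(x_1,\dots,x_{N-1})$, $y=x_N$. Let $\alpha\in(0,+\infty]$, $I=(0,\alpha)$, let $\Omega'\subset\mathbb R^{N-1}$ be a bounded domain with Lipschitz boundary, and $\Omega=\Omega'\times I$. Closures are taken in Euclidean space (so $\overline I=[0,+\infty)$ if $\alpha=+\infty$). For a weakly differentiable $u$, $\nabla u=(\nabla'u,u_y)$ with $\nabla'u=(u_{x_1},\dots,u_{x_{N-1}})$. The function $f$ satisfies: $f\in C(\overline\Omega)$ and $f(x)>0$ for all $x\in\Omega$; $f(x',y_2-y_1)\le f(x',y_1)+f(x',y_2)$ whenever $x'\in\overline{\Omega'}$ and $y_1,y_2\in\overline I$ with $y_1\le y_2$; and, if $\alpha<+\infty$, also $f(x',y)=f(x',\alpha-y)$ for all $(x',y)\in\overline\Omega$. Let $S^N$ be the class of Lebesgue measurable functions $u:\overline\Omega\to[0,+\infty)$ with $|\{y\in I:u(x',y)>c\}|<+\infty$ for all $x'\in\Omega'$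 and all $c>0$, and let $L^N$ be the set of $u\in S^N$ that are Lipschitz continuous and have compact support in $\overline\Omega$. For a measurable set $M\subset I$ of finite measure put $M^*:=(0,|M|)$. For $u\in S^N$ the decreasing rearrangement of $u$ in direction $y$ is $$u^*(x',y):=\sup\{c>0:\ y\in\{u(x',\cdot)>c\}^*\},\quad (x',y)\in\Omega,$$ with $\sup\emptyset=0$; for continuous $u$, $u^*$ denotes its continuous representative (extended continuously to $\overline\Omega$). *)

theory Defs
  imports "HOL-Analysis.Analysis"
begin

text \<open>Points \<open>x = (x', y)\<close> of Euclidean space are pairs in \<open>'a \<times> real\<close>. Functions on \<open>closure \<Omega>\<close> are
  total functions whose values off \<open>closure \<Omega>\<close> are irrelevant.\<close>

text \<open>Near each boundary point, and in suitable orthogonal coordinates with vertical direction \<open>e\<close>,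
  the set is the strict epigraph of a Lipschitz function on the hyperplane orthogonal to \<open>e\<close>.
  On the real line the hyperplane is \<open>{0}\<close>, and the set is locally a half-line.\<close>

definition lipschitz_boundary :: "'a::euclidean_space set \<Rightarrow> bool" where
  "lipschitz_boundary D \<longleftrightarrow>
    (\<forall>p\<in>frontier D. \<exists>e U g L. norm e = 1 \<and> open U \<and> p \<in> U \<and>
       L-lipschitz_on {v. v \<bullet> e = 0} g \<and>
       D \<inter> U = {x \<in> U. g (x - (x \<bullet> e) *\<^sub>R e) < x \<bullet> e})"

definition ivl :: "ereal \<Rightarrow> real set" where
  "ivl \<alpha> = {y. 0 < y \<and> ereal y < \<alpha>}"

definition cyl :: "ereal \<Rightarrow> 'a set \<Rightarrow> ('a \<times> real) set" where
  "cyl \<alpha> \<Omega>' = \<Omega>' \<times> ivl \<alpha>"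

text \<open>Membership in \<open>lmeasurable\<close> is Lebesgue measurability together with finite measure. It is
  required for every \<open>x'\<close>, since a Lebesgue measurable function may have nonmeasurable sections.\<close>

definition S_class :: "ereal \<Rightarrow> 'a::euclidean_space set \<Rightarrow> ('a \<times> real \<Rightarrow> real) set" where
  "S_class \<alpha> \<Omega>' =
    {u. u \<in> borel_measurable (lebesgue_on (closure (cyl \<alpha> \<Omega>'))) \<and>
        (\<forall>x \<in> closure (cyl \<alpha> \<Omega>'). 0 \<le> u x) \<and>
        (\<forall>x'\<in>\<Omega>'. \<forall>c>0. {y \<in> ivl \<alpha>. c < u (x', y)} \<in> lmeasurable)}"

definition L_class :: "ereal \<Rightarrow> 'a::euclidean_space set \<Rightarrow> ('a \<times> real \<Rightarrow> real) set" where
  "L_class \<alpha> \<Omega>' =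
    {u \<in> S_class \<alpha> \<Omega>'. (\<exists>L. L-lipschitz_on (closure (cyl \<alpha> \<Omega>')) u) \<and>
        compact (closure {x \<in> closure (cyl \<alpha> \<Omega>'). u x \<noteq> 0})}"

definition set_star :: "real set \<Rightarrow> real set" where
  "set_star M = {0<..<measure lebesgue M}"

definition rearr_pt :: "ereal \<Rightarrow> ('a \<times> real \<Rightarrow> real) \<Rightarrow> 'a \<times> real \<Rightarrow> real" where
  "rearr_pt \<alpha> u = (\<lambda>(x', y).
     let C = {c. 0 < c \<and> y \<in> set_star {t \<in> ivl \<alpha>. c < u (x', t)}}
     in if C = {} then 0 else Sup C)"

text \<open>The rearrangement on \<open>closure \<Omega>\<close>: the pointwise formula on \<open>\<Omega>\<close>, extended by its limits from
  inside \<open>\<Omega>\<close>. A function that is continuous on \<open>closure \<Omega>\<close> and agrees with the formula on \<open>\<Omega>\<close>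
  can only be this one, so if the function defined here is continuous on \<open>closure \<Omega>\<close>, it is the
  continuous representative.\<close>

definition rearr ::
    "ereal \<Rightarrow> 'a::euclidean_space set \<Rightarrow> ('a \<times> real \<Rightarrow> real) \<Rightarrow> 'a \<times> real \<Rightarrow> real" where
  "rearr \<alpha> \<Omega>' u x =
    (if x \<in> cyl \<alpha> \<Omega>' then rearr_pt \<alpha> u x else Lim (at x within cyl \<alpha> \<Omega>') (rearr_pt \<alpha> u))"

text \<open>\<open>test_fun D \<phi> d\<phi>\<close>: \<open>\<phi>\<close> is continuously differentiable with compact support in \<open>D\<close>, and \<open>d\<phi>\<close>
  is its gradient.\<close>

definition test_fun ::
    "'b::euclidean_space set \<Rightarrow> ('b \<Rightarrow> real) \<Rightarrow> ('b \<Rightarrow> 'b) \<Rightarrow> bool" where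
  "test_fun D \<phi> d\<phi> \<longleftrightarrow>
    (\<forall>x. GDERIV \<phi> x :> d\<phi> x) \<and> continuous_on UNIV d\<phi> \<and>
    compact (closure {x. \<phi> x \<noteq> 0}) \<and> closure {x. \<phi> x \<noteq> 0} \<subseteq> D"

definition locally_integrable_on ::
    "('b::euclidean_space \<Rightarrow> 'c::euclidean_space) \<Rightarrow> 'b set \<Rightarrow> bool" where
  "locally_integrable_on g D \<longleftrightarrow>
    (\<forall>K. compact K \<and> K \<subseteq> D \<longrightarrow> set_integrable lebesgue K g)"

text \<open>Integration by parts against test functions, all partial derivatives at once as a
  vector-valued integral.\<close>

definition has_weak_gradient ::
    "('b::euclidean_space \<Rightarrow> real) \<Rightarrow> ('b \<Rightarrow> 'b) \<Rightarrow> 'b set \<Rightarrow> bool" where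
  "has_weak_gradient u g D \<longleftrightarrow>
    locally_integrable_on u D \<and> locally_integrable_on g D \<and>
    (\<forall>\<phi> d\<phi>. test_fun D \<phi> d\<phi> \<longrightarrow>
      (LINT x:D|lebesgue. u x *\<^sub>R d\<phi> x) = - (LINT x:D|lebesgue. \<phi> x *\<^sub>R g x))"

text \<open>Weak gradients on an open set are unique up to null sets, so the choice of a version does not
  affect integrals.\<close>

definition weak_grad :: "'b::euclidean_space set \<Rightarrow> ('b \<Rightarrow> real) \<Rightarrow> 'b \<Rightarrow> 'b" where
  "weak_grad D u = (SOME g. has_weak_gradient u g D)"

text \<open>The integral of \<open>G (\<nabla>'u, f |u\<^sub>y|, u, x')\<close> over \<open>\<Omega>\<close>. The integrand is nonnegative and the
  value may be infinite.\<close>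

definition energy ::
    "ereal \<Rightarrow> 'a::euclidean_space set \<Rightarrow> ('a \<times> real \<Rightarrow> real) \<Rightarrow>
     ('a \<Rightarrow> real \<Rightarrow> real \<Rightarrow> 'a \<Rightarrow> real) \<Rightarrow> ('a \<times> real \<Rightarrow> real) \<Rightarrow> ennreal" where
  "energy \<alpha> \<Omega>' f G u =
    (\<integral>\<^sup>+x. ennreal (G (fst (weak_grad (cyl \<alpha> \<Omega>') u x))
                      (f x * \<bar>snd (weak_grad (cyl \<alpha> \<Omega>') u x)\<bar>)
                      (u x) (fst x)) \<partial>lebesgue_on (cyl \<alpha> \<Omega>'))"

end

theory Submission
  imports Defs
begin

text \<open>Write \<open>u\<^sup>*\<close> for the rearrangement, \<open>z' = \<nabla>'u\<close> and \<open>z\<^sub>N = f \<bar>u\<^sub>y\<bar>\<close>. Rearranging in direction \<open>y\<close> acts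
  on each vertical line separately, so by Tonelli it suffices to prove the inequality on almost every
  line \<open>x' = const\<close>. There, three facts about \<open>u(x', \<cdot>)\<close> and \<open>u\<^sup>*(x', \<cdot>)\<close> are combined.

  Horizontal derivatives have equal integrals over the parts of the line where \<open>u\<close> and \<open>u\<^sup>*\<close> take values
  in a given Borel set \<open>E\<close> of positive levels. Indeed \<open>u(x', \<cdot>)\<close> and \<open>u\<^sup>*(x', \<cdot>)\<close> are equimeasurable for
  every \<open>x'\<close>, hence have the same truncated moments; differentiating these in \<open>x'\<close> gives the claim
  (\<open>horizontal_derivative_transport\<close>).

  Vertically, the integral of \<open>f \<bar>u\<^sup>*\<^sub>y\<bar>\<close> over \<open>{u\<^sup>* \<in> E}\<close> is at most that of \<open>f \<bar>u\<^sub>y\<bar>\<close> over \<open>{u \<in> E}\<close>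
  (\<open>weighted_coarea_rearrangement\<close>). By the coarea formula this compares, level by level, the number
  \<open>f(\<bar>{u > c}\<bar>)\<close> with the sum of \<open>f\<close> over the points where \<open>u = c\<close>, and the conditions on \<open>f\<close> are made
  for exactly this comparison (\<open>weight_level_combinatorial\<close>).

  Finally \<open>u\<^sup>*\<close> is monotone in \<open>y\<close>, so outside a null set its derivatives depend on the level only:
  a level attained twice is attained on a plateau, where \<open>u\<^sup>*\<^sub>y = 0\<close> and \<open>\<nabla>'u\<^sup>*\<close> is constant
  (\<open>monotone_plateau_derivatives\<close>). Thus \<open>(\<nabla>'u\<^sup>*, f \<bar>u\<^sup>*\<^sub>y\<bar>)\<close> is, level by level, an average of
  \<open>(\<nabla>'u, f \<bar>u\<^sub>y\<bar>)\<close> up to a decrease of the last component, and Jensen's inequality for the convex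
  function \<open>G\<close>, nondecreasing in that component, gives the inequality over the positive levels
  (\<open>fibrewise_jensen\<close>). At level \<open>0\<close> all derivatives vanish and both sides agree
  (\<open>slice_inequality\<close>).

  Two things make this meaningful. The rearrangement does not increase uniform distances and does not
  increase Lipschitz constants in \<open>y\<close>, so \<open>u\<^sup>*\<close> is again Lipschitz (\<open>rearr_L_class\<close>). And the weak
  gradient of a Lipschitz function is given almost everywhere by its partial derivatives
  (\<open>weak_grad_lipschitz_AE\<close>), which is what allows an argument on single lines.\<close>

section \<open>Lipschitz functions of one variable are differentiable almost everywhere\<close>

text \<open>Lebesgue's differentiation theorem, in the form for boxes with lower corner \<open>x\<close>, controls the right
  difference quotients of \<open>F\<close>; applied to the reflected function it controls the left ones.\<close>

lemma density_interval_real: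
  fixes g F :: "real \<Rightarrow> real"
  assumes "\<And>a b::real. a \<le> b \<Longrightarrow> (g has_integral (F b - F a)) {a..b}"
  obtains N where "negligible N" "\<And>x. x \<notin> N \<Longrightarrow> (F has_real_derivative g x) (at x)"
proof -
  have gi: "g integrable_on cbox a b" for a b
    using assms[of a b] by (cases "a \<le> b") (auto simp: has_integral_integrable)
  have gi': "(\<lambda>x. g (-x)) integrable_on cbox a b" for a b
    using gi[of "-b" "-a"] integrable_reflect[where f=g and a="-b" and b="-a"] by simp
  obtain N1 where N1: "negligible N1"
    "\<And>x e. x \<notin> N1 \<Longrightarrow> 0 < e \<Longrightarrow> \<exists>d>0. \<forall>h. 0 < h \<and> h < d \<longrightarrow>
       norm (integral (cbox x (x + h *\<^sub>R One)) g /\<^sub>R h ^ DIM(real) - g x) < e"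
    using integrable_ccontinuous_explicit[OF gi] by blast
  obtain N2 where N2: "negligible N2"
    "\<And>x e. x \<notin> N2 \<Longrightarrow> 0 < e \<Longrightarrow> \<exists>d>0. \<forall>h. 0 < h \<and> h < d \<longrightarrow>
       norm (integral (cbox x (x + h *\<^sub>R One)) (\<lambda>x. g (-x)) /\<^sub>R h ^ DIM(real) - g (-x)) < e"
    using integrable_ccontinuous_explicit[OF gi'] by blast
  have der: "(F has_real_derivative g x) (at x)" if x: "x \<notin> N1" "- x \<notin> N2" for x
  proof -
    have "((\<lambda>y. (F y - F x) / (y - x)) \<longlongrightarrow> g x) (at x)"
    proof (rule tendstoI)
      fix e :: real assume e: "e > 0"
      obtain d1 where d1: "d1 > 0" "\<And>h. 0 < h \<Longrightarrow> h < d1 \<Longrightarrow> \<bar>integral {x..x+h} g / h - g x\<bar> < e"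
        using N1(2)[OF x(1) e] by (auto simp: box_real divide_inverse mult.commute)
      obtain d2 where d2: "d2 > 0" "\<And>h. 0 < h \<Longrightarrow> h < d2 \<Longrightarrow> \<bar>integral {-x..-x+h} (\<lambda>x. g (-x)) / h - g x\<bar> < e"
        using N2(2)[OF x(2) e] by (auto simp: box_real divide_inverse mult.commute)
      have "dist ((F y - F x) / (y - x)) (g x) < e" if y: "y \<noteq> x" "dist y x < min d1 d2" for y
      proof (cases "y > x")
        case True
        have "integral {x..x+(y-x)} g = F y - F x"
          using assms[of x y] True by (simp add: integral_unique)
        then show ?thesis using d1(2)[of "y-x"] y True by (simp add: dist_real_def)
      next
        case False
        have "integral {-x..-x+(x-y)} (\<lambda>x. g (-x)) = integral {y..x} g"
          using integral_reflect_real[of x y g] by simp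
        also have "\<dots> = F x - F y"
          using assms[of y x] False by (simp add: integral_unique)
        finally have "\<bar>(F x - F y) / (x - y) - g x\<bar> < e" using d2(2)[of "x-y"] y False by (simp add: dist_real_def)
        moreover have "(F x - F y) / (x - y) = (F y - F x) / (y - x)"
          using minus_divide_divide[of "F x - F y" "x - y"] by simp
        ultimately show ?thesis by (simp add: dist_real_def)
      qed
      then show "\<forall>\<^sub>F y in at x. dist ((F y - F x) / (y - x)) (g x) < e"
        unfolding eventually_at using d1(1) d2(1) by (intro exI[of _ "min d1 d2"]) auto
    qed
    then show ?thesis by (simp add: has_field_derivative_iff)
  qed
  show ?thesis
  proof (rule that[of "N1 \<union> uminus ` N2"])
    show "negligible (N1 \<union> uminus ` N2)"
      using N1(1) negligible_differentiable_image_negligible[OF _ N2(1), of uminus]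
      by (auto simp: negligible_Un differentiable_on_def)
  next
    fix x assume "x \<notin> N1 \<union> uminus ` N2"
    then have "x \<notin> N1" "- x \<notin> N2" using image_eqI[of x uminus "- x" N2] by auto
    then show "(F has_real_derivative g x) (at x)" by (rule der)
  qed
qed

text \<open>Adding \<open>(L + 1) * x\<close> turns \<open>f\<close> into a function \<open>F\<close> that expands distances, hence a
  homeomorphism of the line. The image of Lebesgue measure under the inverse of \<open>F\<close> gives
  \<open>{a..b}\<close> the mass \<open>F b - F a\<close>, and it is absolutely continuous because \<open>F\<close>, being Lipschitz,
  maps null sets to null sets. So it has a Radon-Nikodym density, which is the derivative of \<open>F\<close>
  almost everywhere.\<close>

lemma lipschitz_real_differentiable_AE:
  fixes f :: "real \<Rightarrow> real"
  assumes lip: "L-lipschitz_on UNIV f"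
  obtains N where "negligible N" "\<And>x. x \<notin> N \<Longrightarrow> f differentiable at x"
proof -
  define F where "F = (\<lambda>x. f x + (L + 1) * x)"
  have L0: "L \<ge> 0" using lip lipschitz_on_nonneg by blast
  have dist_f: "\<bar>f x - f y\<bar> \<le> L * \<bar>x - y\<bar>" for x y
    using lipschitz_onD[OF lip, of x y] by (simp add: dist_real_def)
  have Fup: "y - x \<le> F y - F x" if "x \<le> y" for x y
  proof -
    have "f x - f y \<le> L * (y - x)" using dist_f[of x y] that by simp
    then show ?thesis by (simp add: F_def algebra_simps)
  qed
  have contf: "continuous_on UNIV f" using lip lipschitz_on_continuous_on by blast
  have contF: "continuous_on UNIV F" unfolding F_def by (intro continuous_intros contf)
  have injF: "inj F"
  proof (rule injI)
    fix x y assume "F x = F y" then show "x = y" using Fup[of x y] Fup[of y x] by linarith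
  qed
  have surjF: "\<exists>x. F x = y" for y
  proof -
    define r where "r = \<bar>y - F 0\<bar>"
    have "F (-r) \<le> y" "y \<le> F r" using Fup[of "-r" 0] Fup[of 0 r] unfolding r_def by auto
    moreover have "- r \<le> r" "continuous_on {- r..r} F"
      using continuous_on_subset[OF contF] unfolding r_def by auto
    ultimately show ?thesis using IVT'[of F "-r" y r] by blast
  qed
  define H where "H = inv F"
  have FH: "F (H y) = y" for y unfolding H_def using surjF[of y] by (metis f_inv_into_f rangeI)
  have HF: "H (F x) = x" for x unfolding H_def using injF by simp
  have Hle: "H x \<le> H y" if "x \<le> y" for x y
    using Fup[of "H y" "H x"] that FH[of x] FH[of y] by linarith
  have Hmeas[measurable]: "H \<in> borel_measurable borel"
    by (intro borel_measurable_mono monoI Hle)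
  define M where "M = distr lborel borel H"
  have vim: "H -` E = F ` E" for E
    using HF FH by (auto intro: rev_image_eqI)
  have eM: "emeasure M E = emeasure lborel (F ` E)" if "E \<in> sets borel" for E
    unfolding M_def using that by (simp add: emeasure_distr vim)
  have FE: "F ` E \<in> sets borel" if "E \<in> sets borel" for E
    using measurable_sets[OF Hmeas that] by (simp add: vim)
  have ac: "absolutely_continuous lborel M"
    unfolding absolutely_continuous_def
  proof
    fix E :: "real set" assume E: "E \<in> null_sets lborel"
    have "negligible (F ` E)"
    proof (rule negligible_locally_Lipschitz_image)
      show "negligible E" using E negligible_iff_null_sets null_sets_completionI by blast
      fix x assume "x \<in> E"
      have "norm (F y - F x) \<le> (2 * L + 1) * norm (y - x)" for y
      proof -
        have "norm (F y - F x) \<le> \<bar>f y - f x\<bar> + \<bar>(L + 1) * (y - x)\<bar>" unfolding F_def by (simp add: algebra_simps)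
        also have "\<dots> \<le> L * \<bar>y - x\<bar> + (L + 1) * \<bar>y - x\<bar>"
          using dist_f[of y x] L0 by (simp add: abs_mult)
        finally show ?thesis by (simp add: algebra_simps)
      qed
      then show "\<exists>T B. open T \<and> x \<in> T \<and> (\<forall>y\<in>E \<inter> T. norm (F y - F x) \<le> B * norm (y - x))"
        by (intro exI[of _ UNIV] exI[of _ "2 * L + 1"]) auto
    qed simp
    then have "emeasure lebesgue (F ` E) = 0" by (simp add: negligible_iff_null_sets null_setsD1)
    then have "emeasure lborel (F ` E) = 0"
      using null_sets_completion_iff[of "F ` E" lborel] FE[of E] null_setsD2[OF E]
      by (simp add: null_sets_def)
    then show "E \<in> null_sets M" using E eM by (auto simp: null_sets_def M_def)
  qed
  have d: "density lborel (RN_deriv lborel M) = M"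
    using ac by (intro sigma_finite_measure.density_RN_deriv[OF sigma_finite_lborel]) (auto simp: M_def)
  define g where "g = (\<lambda>x. enn2real (RN_deriv lborel M x))"
  have RNm[measurable]: "RN_deriv lborel M \<in> borel_measurable borel"
    using borel_measurable_RN_deriv[of lborel M] by simp
  have hi: "(g has_integral (F b - F a)) {a..b}" if "a \<le> b" for a b
  proof -
    have "F ` {a..b} = {F a..F b}"
    proof (intro equalityI subsetI)
      fix x assume x: "x \<in> {F a..F b}"
      then have "a \<le> H x" "H x \<le> b" using Hle[of "F a" x] Hle[of x "F b"] by (auto simp: HF)
      then show "x \<in> F ` {a..b}" by (intro image_eqI[of _ _ "H x"]) (auto simp: FH)
    next
      fix y assume "y \<in> F ` {a..b}"
      then obtain x where x: "y = F x" "a \<le> x" "x \<le> b" by auto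
      then show "y \<in> {F a..F b}" using Fup[of a x] Fup[of x b] by simp
    qed
    then have "emeasure M {a..b} = ennreal (F b - F a)"
      using eM[of "{a..b}"] Fup[OF that] that by simp
    also have "emeasure M {a..b} = (\<integral>\<^sup>+x. RN_deriv lborel M x * indicator {a..b} x \<partial>lborel)"
      by (subst d[symmetric]) (simp add: emeasure_density)
    finally have I: "(\<integral>\<^sup>+x. RN_deriv lborel M x * indicator {a..b} x \<partial>lborel) = ennreal (F b - F a)" by simp
    have "AE x in lborel. RN_deriv lborel M x * indicator {a..b} x \<noteq> \<infinity>"
      by (rule nn_integral_PInf_AE) (use I in simp_all)
    then have "AE x in lborel. ennreal (g x * indicator {a..b} x) = RN_deriv lborel M x * indicator {a..b} x"
    proof (rule eventually_mono)
      fix x assume elim: "RN_deriv lborel M x * indicator {a..b} x \<noteq> \<infinity>"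
      show "ennreal (g x * indicator {a..b} x) = RN_deriv lborel M x * indicator {a..b} x"
      proof (cases "x \<in> {a..b}")
        case True
        then have "RN_deriv lborel M x \<noteq> \<infinity>" using elim by simp
        then show ?thesis using True by (simp add: g_def less_top[symmetric])
      qed simp
    qed
    then have "(\<integral>\<^sup>+x. ennreal (g x * indicator {a..b} x) \<partial>lborel) = ennreal (F b - F a)"
      by (rule nn_integral_cong_AE[THEN trans, OF _ I])
    then have "((\<lambda>x. g x * indicator {a..b} x) has_integral (F b - F a)) UNIV"
      using Fup[OF that] that by (intro nn_integral_has_integral) (simp_all add: g_def)
    moreover have "(\<lambda>x. g x * indicator {a..b} x) = (\<lambda>x. if x \<in> {a..b} then g x else 0)" by auto
    ultimately show ?thesis by (simp only: has_integral_restrict_UNIV)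
  qed
  obtain N where N: "negligible N" "\<And>x. x \<notin> N \<Longrightarrow> (F has_real_derivative g x) (at x)"
    using density_interval_real[OF hi] by blast
  show ?thesis
  proof (rule that[OF N(1)])
    fix x assume "x \<notin> N"
    then have "((\<lambda>x. F x - (L + 1) * x) has_real_derivative (g x - (L + 1))) (at x)"
      by (auto intro!: derivative_eq_intros N(2))
    then show "f differentiable at x"
      unfolding F_def by (auto simp: real_differentiable_def)
  qed
qed

section \<open>Directional derivatives of Lipschitz functions\<close>

definition ddiff :: "('b::euclidean_space \<Rightarrow> real) \<Rightarrow> 'b \<Rightarrow> 'b \<Rightarrow> bool" where
  "ddiff h e x \<longleftrightarrow> (\<lambda>t. h (x + t *\<^sub>R e)) differentiable at 0"

text \<open>The value \<open>0\<close> at points without a directional derivative keeps the bound by the Lipschitz constant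
  and Borel measurability valid on the whole space.\<close>

definition pd :: "('b::euclidean_space \<Rightarrow> real) \<Rightarrow> 'b \<Rightarrow> 'b \<Rightarrow> real" where
  "pd h e x = (if ddiff h e x then deriv (\<lambda>t. h (x + t *\<^sub>R e)) 0 else 0)"

definition dq :: "('b::euclidean_space \<Rightarrow> real) \<Rightarrow> 'b \<Rightarrow> real \<Rightarrow> 'b \<Rightarrow> real" where
  "dq h e t x = (h (x + t *\<^sub>R e) - h x) / t"

lemma pd_has_derivative:
  "ddiff h e x \<Longrightarrow> ((\<lambda>t. h (x + t *\<^sub>R e)) has_real_derivative pd h e x) (at 0)"
  by (auto simp: pd_def ddiff_def real_differentiable_def DERIV_imp_deriv)

lemma pd_tendsto:
  "ddiff h e x \<Longrightarrow> ((\<lambda>t. dq h e t x) \<longlongrightarrow> pd h e x) (at 0)"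
  using pd_has_derivative[of h e x] by (simp add: dq_def has_field_derivative_iff)

lemma dq_bound:
  assumes "L-lipschitz_on UNIV h"
  shows "\<bar>dq h e t x\<bar> \<le> L * norm e"
proof (cases "t = 0")
  case False
  have "\<bar>h (x + t *\<^sub>R e) - h x\<bar> \<le> L * (\<bar>t\<bar> * norm e)"
    using lipschitz_onD[OF assms, of "x + t *\<^sub>R e" x] by (simp add: dist_norm)
  then show ?thesis using False by (simp add: dq_def divide_simps mult_ac)
next
  case True
  then show ?thesis using lipschitz_on_nonneg[OF assms] by (simp add: dq_def)
qed

lemma pd_bound:
  assumes "L-lipschitz_on UNIV h"
  shows "\<bar>pd h e x\<bar> \<le> L * norm e"
proof (cases "ddiff h e x")
  case True
  have "((\<lambda>t. \<bar>dq h e t x\<bar>) \<longlongrightarrow> \<bar>pd h e x\<bar>) (at 0)" by (intro tendsto_rabs pd_tendsto True)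
  then show ?thesis by (rule tendsto_upperbound) (simp_all add: dq_bound[OF assms])
next
  case False
  then show ?thesis using lipschitz_on_nonneg[OF assms] by (simp add: pd_def)
qed

lemma open_contains_short_segments:
  fixes x :: "'b::euclidean_space"
  assumes "open D" "x \<in> D"
  obtains d where "d > 0" "\<And>a. \<bar>a\<bar> < d \<Longrightarrow> x + a *\<^sub>R e \<in> D"
proof -
  obtain r where r: "r > 0" "ball x r \<subseteq> D" using assms openE by blast
  have n: "0 < norm e + 1" using norm_ge_zero[of e] by linarith
  show ?thesis
  proof (rule that[of "r / (norm e + 1)"])
    show "0 < r / (norm e + 1)" using r n by simp
    fix a assume a: "\<bar>a\<bar> < r / (norm e + 1)"
    have "\<bar>a\<bar> * norm e \<le> \<bar>a\<bar> * (norm e + 1)" by (intro mult_left_mono) auto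
    also have "\<dots> < r" using a n by (simp add: field_simps)
    finally have "x + a *\<^sub>R e \<in> ball x r" by (simp add: dist_norm)
    then show "x + a *\<^sub>R e \<in> D" using r(2) by blast
  qed
qed

text \<open>The Cauchy criterion for difference quotients; by continuity rational increments suffice. With only
  countably many conditions the set of points of differentiability is Borel.\<close>

lemma ddiff_iff_rational:
  fixes h :: "'b::euclidean_space \<Rightarrow> real"
  assumes cont: "continuous_on UNIV h"
  shows "ddiff h e x \<longleftrightarrow> (\<forall>k::nat. \<exists>n::nat. \<forall>r\<in>\<rat>. \<forall>s\<in>\<rat>. 0 < \<bar>r\<bar> \<and> \<bar>r\<bar> < 1 / Suc n \<and> 0 < \<bar>s\<bar> \<and> \<bar>s\<bar> < 1 / Suc n
      \<longrightarrow> \<bar>dq h e r x - dq h e s x\<bar> \<le> 1 / Suc k)" (is "_ \<longleftrightarrow> ?R")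
proof
  assume d: "ddiff h e x"
  show ?R
  proof
    fix k :: nat
    have "\<forall>\<^sub>F t in at 0. dist (dq h e t x) (pd h e x) < 1 / (2 * Suc k)"
      using pd_tendsto[OF d] by (rule tendstoD) simp
    then obtain \<delta> where \<delta>: "\<delta> > 0" "\<And>t. t \<noteq> 0 \<Longrightarrow> \<bar>t\<bar> < \<delta> \<Longrightarrow> \<bar>dq h e t x - pd h e x\<bar> < 1 / (2 * Suc k)"
      by (auto simp: eventually_at dist_real_def)
    obtain n :: nat where n: "1 / Suc n < \<delta>" using \<delta>(1) nat_approx_posE by blast
    have "\<bar>dq h e r x - dq h e s x\<bar> \<le> 1 / Suc k" if "0 < \<bar>r\<bar> \<and> \<bar>r\<bar> < 1 / Suc n \<and> 0 < \<bar>s\<bar> \<and> \<bar>s\<bar> < 1 / Suc n" for r s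
    proof -
      have "\<bar>dq h e r x - pd h e x\<bar> < 1 / (2 * Suc k)" "\<bar>dq h e s x - pd h e x\<bar> < 1 / (2 * Suc k)"
        using that n by (intro \<delta>(2); linarith)+
      then have "\<bar>dq h e r x - dq h e s x\<bar> \<le> 1 / real (2 * Suc k) + 1 / real (2 * Suc k)" by linarith
      also have "\<dots> = 1 / Suc k" by (simp add: field_simps)
      finally show ?thesis .
    qed
    then show "\<exists>n::nat. \<forall>r\<in>\<rat>. \<forall>s\<in>\<rat>. 0 < \<bar>r\<bar> \<and> \<bar>r\<bar> < 1 / Suc n \<and> 0 < \<bar>s\<bar> \<and> \<bar>s\<bar> < 1 / Suc n
      \<longrightarrow> \<bar>dq h e r x - dq h e s x\<bar> \<le> 1 / Suc k" by blast
  qed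
next
  assume R: ?R
  have contq: "isCont (\<lambda>t. dq h e t x) r" if "r \<noteq> 0" for r
  proof -
    have "continuous_on UNIV (\<lambda>t. h (x + t *\<^sub>R e))"
      by (rule continuous_on_compose2[OF cont]) (auto intro!: continuous_intros)
    then have "isCont (\<lambda>t. h (x + t *\<^sub>R e)) r" by (simp add: continuous_on_eq_continuous_at)
    then show ?thesis unfolding dq_def using that by (intro continuous_intros) auto
  qed
  have R': "\<exists>\<delta>>0. \<forall>r s. 0 < \<bar>r\<bar> \<and> \<bar>r\<bar> < \<delta> \<and> 0 < \<bar>s\<bar> \<and> \<bar>s\<bar> < \<delta> \<longrightarrow> \<bar>dq h e r x - dq h e s x\<bar> \<le> 1 / Suc k" for k :: nat
  proof -
    obtain n :: nat where n: "\<And>r s. r \<in> \<rat> \<Longrightarrow> s \<in> \<rat> \<Longrightarrow> 0 < \<bar>r\<bar> \<and> \<bar>r\<bar> < 1 / Suc n \<and> 0 < \<bar>s\<bar> \<and> \<bar>s\<bar> < 1 / Suc n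
      \<Longrightarrow> \<bar>dq h e r x - dq h e s x\<bar> \<le> 1 / Suc k" using R by blast
    define \<delta> where "\<delta> = 1 / real (Suc n)"
    define W where "W = {r. 0 < \<bar>r\<bar> \<and> \<bar>r\<bar> < \<delta>}"
    have Wo: "open W"
      unfolding W_def by (intro open_Collect_conj open_Collect_less continuous_intros)
    have approx: "\<exists>\<rho>. (\<forall>i. \<rho> i \<in> \<rat> \<inter> W) \<and> \<rho> \<longlonglongrightarrow> r" if "r \<in> W" for r
    proof -
      have "\<exists>y\<in>\<rat> \<inter> W. dist y r < \<epsilon>" if "\<epsilon> > 0" for \<epsilon>
      proof -
        obtain d where d: "d > 0" "ball r d \<subseteq> W" using Wo \<open>r \<in> W\<close> openE by blast
        obtain q where q: "q \<in> \<rat>" "r < q" "q < r + min d \<epsilon>"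
          using Rats_dense_in_real[of r "r + min d \<epsilon>"] d(1) \<open>\<epsilon> > 0\<close> by auto
        then have "q \<in> ball r d" "dist q r < \<epsilon>" by (auto simp: dist_real_def)
        then show ?thesis using d(2) q(1) by blast
      qed
      then have "r \<in> closure (\<rat> \<inter> W)" by (simp add: closure_approachable)
      then show ?thesis unfolding closure_sequential by auto
    qed
    have "\<bar>dq h e r x - dq h e s x\<bar> \<le> 1 / Suc k" if "r \<in> W" "s \<in> W" for r s
    proof -
      obtain \<rho> \<sigma> where \<rho>: "\<And>i. \<rho> i \<in> \<rat> \<inter> W" "\<rho> \<longlonglongrightarrow> r" and \<sigma>: "\<And>i. \<sigma> i \<in> \<rat> \<inter> W" "\<sigma> \<longlonglongrightarrow> s"
        using approx[OF \<open>r \<in> W\<close>] approx[OF \<open>s \<in> W\<close>] by blast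
      have "(\<lambda>i. dq h e (\<rho> i) x) \<longlonglongrightarrow> dq h e r x" "(\<lambda>i. dq h e (\<sigma> i) x) \<longlonglongrightarrow> dq h e s x"
        using isCont_tendsto_compose[OF contq \<rho>(2)] isCont_tendsto_compose[OF contq \<sigma>(2)] that
        by (simp_all add: W_def)
      then have "(\<lambda>i. \<bar>dq h e (\<rho> i) x - dq h e (\<sigma> i) x\<bar>) \<longlonglongrightarrow> \<bar>dq h e r x - dq h e s x\<bar>"
        by (intro tendsto_intros)
      moreover have "\<bar>dq h e (\<rho> i) x - dq h e (\<sigma> i) x\<bar> \<le> 1 / Suc k" for i
        using \<rho>(1)[of i] \<sigma>(1)[of i] by (intro n) (simp_all add: W_def \<delta>_def)
      ultimately show ?thesis using LIMSEQ_le_const2 by blast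
    qed
    moreover have "\<delta> > 0" by (simp add: \<delta>_def)
    ultimately show ?thesis unfolding W_def by (intro exI[of _ \<delta>]) blast
  qed
  define l where "l = (\<lambda>n. dq h e (1 / Suc n) x)"
  have "Cauchy l"
  proof (rule CauchyI)
    fix \<epsilon> :: real assume "\<epsilon> > 0"
    then obtain k :: nat where k: "1 / Suc k < \<epsilon>" using nat_approx_posE by blast
    obtain \<delta> where \<delta>: "\<delta> > 0" "\<And>r s. 0 < \<bar>r\<bar> \<and> \<bar>r\<bar> < \<delta> \<and> 0 < \<bar>s\<bar> \<and> \<bar>s\<bar> < \<delta> \<Longrightarrow> \<bar>dq h e r x - dq h e s x\<bar> \<le> 1 / Suc k"
      using R' by meson
    obtain N :: nat where N: "1 / Suc N < \<delta>" using \<delta>(1) nat_approx_posE by blast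
    have small: "1 / real (Suc m) < \<delta>" if "m \<ge> N" for m
    proof -
      have "1 / real (Suc m) \<le> 1 / real (Suc N)" using that by (intro divide_left_mono) auto
      then show ?thesis using N by linarith
    qed
    have "norm (l m - l n) < \<epsilon>" if "m \<ge> N" "n \<ge> N" for m n
      using \<delta>(2)[of "1 / Suc m" "1 / Suc n"] small[OF that(1)] small[OF that(2)] k by (simp add: l_def)
    then show "\<exists>M. \<forall>m\<ge>M. \<forall>n\<ge>M. norm (l m - l n) < \<epsilon>" by blast
  qed
  then obtain D where D: "l \<longlonglongrightarrow> D" using real_Cauchy_convergent convergent_def by blast
  have "((\<lambda>t. dq h e t x) \<longlongrightarrow> D) (at 0)"
  proof (rule tendstoI)
    fix \<epsilon> :: real assume "\<epsilon> > 0"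
    then obtain k :: nat where k: "1 / Suc k < \<epsilon>" using nat_approx_posE by blast
    obtain \<delta> where \<delta>: "\<delta> > 0" "\<And>r s. 0 < \<bar>r\<bar> \<and> \<bar>r\<bar> < \<delta> \<and> 0 < \<bar>s\<bar> \<and> \<bar>s\<bar> < \<delta> \<Longrightarrow> \<bar>dq h e r x - dq h e s x\<bar> \<le> 1 / Suc k"
      using R' by meson
    have "\<bar>dq h e r x - D\<bar> \<le> 1 / Suc k" if r: "0 < \<bar>r\<bar>" "\<bar>r\<bar> < \<delta>" for r
    proof (rule LIMSEQ_le_const2)
      show "(\<lambda>i. \<bar>dq h e r x - l i\<bar>) \<longlonglongrightarrow> \<bar>dq h e r x - D\<bar>" by (intro tendsto_intros D)
      have "(\<lambda>n. 1 / real (Suc n)) \<longlonglongrightarrow> 0" using LIMSEQ_Suc[OF lim_1_over_n] by simp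
      then have "\<forall>\<^sub>F n in sequentially. 1 / real (Suc n) < \<delta>" using \<delta>(1) by (rule order_tendstoD(2))
      then obtain N where "\<And>n. n \<ge> N \<Longrightarrow> 1 / real (Suc n) < \<delta>" by (auto simp: eventually_sequentially)
      then show "\<exists>N. \<forall>i\<ge>N. \<bar>dq h e r x - l i\<bar> \<le> 1 / Suc k"
        using r unfolding l_def by (intro exI[of _ N] allI impI \<delta>(2)) simp
    qed
    then show "\<forall>\<^sub>F t in at 0. dist (dq h e t x) D < \<epsilon>"
      unfolding eventually_at dist_real_def using \<delta>(1) k
      by (intro exI[of _ \<delta>] conjI ballI impI) (auto intro: le_less_trans)
  qed
  then show "ddiff h e x" unfolding ddiff_def dq_def
    by (auto simp: real_differentiable_def has_field_derivative_iff)
qed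

lemma measurable_ddiff:
  fixes h :: "'b::euclidean_space \<Rightarrow> real"
  assumes cont: "continuous_on UNIV h"
  shows "Measurable.pred borel (ddiff h e)"
proof -
  have [measurable]: "h \<in> borel_measurable borel" by (rule borel_measurable_continuous_onI[OF cont])
  have [measurable]: "(\<lambda>x. dq h e t x) \<in> borel_measurable borel" for t unfolding dq_def by measurable
  have "Measurable.pred borel (\<lambda>x. ddiff h e x)"
    unfolding ddiff_iff_rational[OF cont] Rats_def ball_simps(9) by measurable
  then show ?thesis by simp
qed

lemma measurable_pd:
  fixes h :: "'b::euclidean_space \<Rightarrow> real"
  assumes cont: "continuous_on UNIV h"
  shows "pd h e \<in> borel_measurable borel"
proof -
  have [measurable]: "h \<in> borel_measurable borel" by (rule borel_measurable_continuous_onI[OF cont])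
  have [measurable]: "(\<lambda>x. dq h e t x) \<in> borel_measurable borel" for t unfolding dq_def by measurable
  note measurable_ddiff[OF cont, measurable]
  show ?thesis
  proof (rule borel_measurable_LIMSEQ_metric)
    show "(\<lambda>x. if ddiff h e x then dq h e (1 / Suc n) x else 0) \<in> borel_measurable borel" for n
      by measurable
    show "(\<lambda>n. if ddiff h e x then dq h e (1 / Suc n) x else 0) \<longlonglongrightarrow> pd h e x" for x
    proof (cases "ddiff h e x")
      case True
      have "(\<lambda>n. 1 / real (Suc n)) \<longlonglongrightarrow> 0" using LIMSEQ_Suc[OF lim_1_over_n] by simp
      then have "filterlim (\<lambda>n. 1 / real (Suc n)) (at 0) sequentially"
        by (auto simp: filterlim_at)
      from filterlim_compose[OF pd_tendsto[OF True] this] show ?thesis using True by simp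
    qed (simp add: pd_def)
  qed
qed

text \<open>Fubini for a direction \<open>e\<close> that need not be a coordinate axis: integrate the indicator of \<open>N\<close> at
  \<open>x + t e\<close> over all \<open>x\<close> and \<open>0 \<le> t \<le> 1\<close>. Integrating in \<open>t\<close> first gives \<open>0\<close>, integrating in \<open>x\<close>
  first gives the measure of \<open>N\<close> by translation invariance.\<close>

lemma AE_lines:
  fixes N :: "'b::euclidean_space set"
  assumes N[measurable]: "N \<in> sets borel" and null: "\<And>x. emeasure lborel {t. x + t *\<^sub>R e \<in> N} = 0"
  shows "emeasure lborel N = 0"
proof -
  have inner: "(\<integral>\<^sup>+t. indicator N (x + t *\<^sub>R e) * indicator {0..1::real} t \<partial>lborel) = 0" for x
  proof -
    have "AE t in lborel. t \<notin> {t. x + t *\<^sub>R e \<in> N}"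
      using null[of x] by (intro AE_not_in) (auto simp: null_sets_def)
    then show ?thesis by (subst nn_integral_0_iff_AE) (auto split: split_indicator)
  qed
  have shift: "(\<integral>\<^sup>+x. indicator N (x + t *\<^sub>R e) \<partial>lborel) = emeasure lborel N" for t
  proof -
    have "emeasure lborel N = emeasure (distr lborel borel ((+) (t *\<^sub>R e))) N"
      using lborel_distr_plus[of "t *\<^sub>R e"] by simp
    also have "\<dots> = (\<integral>\<^sup>+x. indicator N x \<partial>distr lborel borel ((+) (t *\<^sub>R e)))" by simp
    also have "\<dots> = (\<integral>\<^sup>+x. indicator N (x + t *\<^sub>R e) \<partial>lborel)"
      by (subst nn_integral_distr) (auto simp: add.commute)
    finally show ?thesis by simp
  qed
  have "0 = (\<integral>\<^sup>+x. (\<integral>\<^sup>+t. indicator N (x + t *\<^sub>R e) * indicator {0..1::real} t \<partial>lborel) \<partial>lborel)"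
    by (simp only: inner) simp
  also have "\<dots> = (\<integral>\<^sup>+t. (\<integral>\<^sup>+x. indicator N (x + t *\<^sub>R e) * indicator {0..1::real} t \<partial>lborel) \<partial>lborel)"
    by (rule lborel_pair.Fubini') measurable
  also have "\<dots> = (\<integral>\<^sup>+t. emeasure lborel N * indicator {0..1::real} t \<partial>lborel)"
    by (intro nn_integral_cong) (simp add: nn_integral_multc shift)
  also have "\<dots> = emeasure lborel N" by (simp add: nn_integral_cmult)
  finally show ?thesis by simp
qed

lemma lipschitz_AE_ddiff:
  fixes h :: "'b::euclidean_space \<Rightarrow> real"
  assumes lip: "L-lipschitz_on UNIV h"
  shows "AE x in lborel. ddiff h e x"
proof -
  have cont: "continuous_on UNIV h" using lip lipschitz_on_continuous_on by blast
  define N where "N = - {x. ddiff h e x}"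
  have N: "N \<in> sets borel" unfolding N_def using measurable_ddiff[OF cont, of e]
    using borel_comp by (auto simp: pred_def)
  have "emeasure lborel N = 0"
  proof (rule AE_lines[OF N, of e])
    fix x
    define \<phi> where "\<phi> = (\<lambda>t. h (x + t *\<^sub>R e))"
    have "(L * norm e)-lipschitz_on UNIV \<phi>"
    proof (rule lipschitz_onI)
      fix s t :: real
      have "dist (\<phi> s) (\<phi> t) \<le> L * dist (x + s *\<^sub>R e) (x + t *\<^sub>R e)"
        unfolding \<phi>_def by (rule lipschitz_onD[OF lip]) auto
      also have "dist (x + s *\<^sub>R e) (x + t *\<^sub>R e) = norm e * dist s t"
        by (simp add: dist_norm flip: scaleR_diff_left)
      finally show "dist (\<phi> s) (\<phi> t) \<le> L * norm e * dist s t" by (simp add: mult_ac)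
    next
      show "0 \<le> L * norm e" using lipschitz_on_nonneg[OF lip] by simp
    qed
    then obtain Z where Z: "negligible Z" "\<And>t. t \<notin> Z \<Longrightarrow> \<phi> differentiable at t"
      using lipschitz_real_differentiable_AE by blast
    have "t \<in> Z" if "x + t *\<^sub>R e \<in> N" for t
    proof (rule ccontr)
      assume "t \<notin> Z"
      then obtain D where "(\<phi> has_real_derivative D) (at t)"
        using Z(2) real_differentiable_def by blast
      then have "((\<lambda>s. \<phi> (s + t)) has_real_derivative D) (at 0)" using DERIV_shift[of \<phi> D 0 t] by simp
      moreover have "(\<lambda>s. \<phi> (s + t)) = (\<lambda>s. h ((x + t *\<^sub>R e) + s *\<^sub>R e))"
        by (auto simp: \<phi>_def algebra_simps)
      ultimately have "ddiff h e (x + t *\<^sub>R e)" unfolding ddiff_def real_differentiable_def by auto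
      then show False using that by (simp add: N_def)
    qed
    then have "{t. x + t *\<^sub>R e \<in> N} \<subseteq> Z" by auto
    then have n: "negligible {t. x + t *\<^sub>R e \<in> N}" using Z(1) negligible_subset by blast
    have "{t. x + t *\<^sub>R e \<in> N} = (\<lambda>t. x + t *\<^sub>R e) -` N \<inter> space borel" by auto
    also have "\<dots> \<in> sets borel" by (rule measurable_sets[OF _ N]) measurable
    finally have "{t. x + t *\<^sub>R e \<in> N} \<in> sets lborel" by simp
    with n show "emeasure lborel {t. x + t *\<^sub>R e \<in> N} = 0"
      using null_sets_completion_iff negligible_iff_null_sets by blast
  qed
  then show ?thesis using N by (intro AE_I'[of N]) (auto simp: N_def null_sets_def)
qed

section \<open>Weak gradients of Lipschitz functions\<close>

text \<open>McShane's extension. The functions of the problem live on the closed cylinder; as restrictions of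
  Lipschitz functions on the whole space they have difference quotients in every direction.\<close>

lemma lipschitz_extension_real:
  fixes u :: "'b::metric_space \<Rightarrow> real"
  assumes lip: "L-lipschitz_on S u"
  obtains h where "L-lipschitz_on UNIV h" "\<And>x. x \<in> S \<Longrightarrow> h x = u x"
proof (cases "S = {}")
  case True
  have "L-lipschitz_on UNIV (\<lambda>x::'b. 0::real)"
    using lipschitz_on_nonneg[OF lip] by (intro lipschitz_onI) auto
  then show ?thesis using that True by blast
next
  case False
  have L: "0 \<le> L" by (rule lipschitz_on_nonneg[OF lip])
  define h where "h = (\<lambda>x. INF z\<in>S. u z + L * dist x z)"
  obtain z0 where z0: "z0 \<in> S" using False by auto
  have bdd: "bdd_below ((\<lambda>z. u z + L * dist x z) ` S)" for x
  proof (rule bdd_belowI2)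
    fix z assume z: "z \<in> S"
    have "u z0 - u z \<le> L * dist z0 z" using lipschitz_onD[OF lip z0 z] by (simp add: dist_real_def)
    also have "\<dots> \<le> L * (dist x z0 + dist x z)"
      using L dist_triangle3[of z0 z x] by (intro mult_left_mono) (auto simp: dist_commute)
    finally show "u z0 - L * dist x z0 \<le> u z + L * dist x z" by (simp add: algebra_simps)
  qed
  have le: "h x \<le> h y + L * dist x y" for x y
  proof -
    have "h x - L * dist x y \<le> u z + L * dist y z" if z: "z \<in> S" for z
    proof -
      have "h x \<le> u z + L * dist x z" unfolding h_def by (rule cINF_lower[OF bdd z])
      also have "L * dist x z \<le> L * (dist x y + dist y z)"
        using L by (intro mult_left_mono dist_triangle) auto
      finally show ?thesis by (simp add: algebra_simps)
    qed
    then have "h x - L * dist x y \<le> h y"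
      unfolding h_def[of] by (intro cINF_greatest False) (simp add: h_def)
    then show ?thesis by simp
  qed
  have "L-lipschitz_on UNIV h"
  proof (rule lipschitz_onI[OF _ L])
    fix x y show "dist (h x) (h y) \<le> L * dist x y"
      using le[of x y] le[of y x] by (simp add: dist_real_def dist_commute abs_le_iff)
  qed
  moreover have "h x = u x" if x: "x \<in> S" for x
  proof (rule antisym)
    show "h x \<le> u x" unfolding h_def using cINF_lower[OF bdd x, of x] by simp
    show "u x \<le> h x" unfolding h_def
    proof (rule cINF_greatest[OF False])
      fix z assume "z \<in> S"
      then show "u x \<le> u z + L * dist x z" using lipschitz_onD[OF lip x] by (fastforce simp: dist_real_def)
    qed
  qed
  ultimately show ?thesis using that by blast
qed

text \<open>Inside a box, Lebesgue's differentiation theorem recovers \<open>g\<close> from its integrals over small boxes;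
  an open set is a countable union of boxes.\<close>

lemma zero_box_integrals_imp_zero:
  fixes g :: "'b::euclidean_space \<Rightarrow> 'c::euclidean_space"
  assumes "open D"
    and int: "\<And>a b. cbox a b \<subseteq> D \<Longrightarrow> g absolutely_integrable_on cbox a b"
    and zero: "\<And>a b. cbox a b \<subseteq> D \<Longrightarrow> integral (cbox a b) g = 0"
  shows "AE x in lebesgue. x \<in> D \<longrightarrow> g x = 0"
proof -
  have box: "\<exists>N. negligible N \<and> (\<forall>x\<in>cbox a b. x \<notin> N \<longrightarrow> g x = 0)" if ab: "cbox a b \<subseteq> D" for a b
  proof -
    define G where "G = (\<lambda>x. if x \<in> cbox a b then g x else 0)"
    have "g integrable_on cbox a b" using int[OF ab] by (rule set_lebesgue_integral_eq_integral(1))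
    then have "G integrable_on UNIV" unfolding G_def using integrable_restrict_UNIV by blast
    then have "G integrable_on cbox c d" for c d by (rule integrable_on_subcbox) auto
    then obtain N where N: "negligible N"
      "\<And>x e. x \<notin> N \<Longrightarrow> 0 < e \<Longrightarrow> \<exists>d>0. \<forall>h. 0 < h \<and> h < d \<longrightarrow>
         norm (integral (cbox x (x + h *\<^sub>R One)) G /\<^sub>R h ^ DIM('b) - G x) < e"
      using integrable_ccontinuous_explicit[of G] by blast
    have "g x = 0" if x: "x \<in> box a b" "x \<notin> N" for x
    proof (rule ccontr)
      assume "g x \<noteq> 0"
      then obtain d where d: "d > 0" "\<And>h. 0 < h \<Longrightarrow> h < d \<Longrightarrow>
         norm (integral (cbox x (x + h *\<^sub>R One)) G /\<^sub>R h ^ DIM('b) - G x) < norm (g x)"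
        using N(2)[OF x(2), of "norm (g x)"] by auto
      obtain r where r: "r > 0" "\<And>i. i \<in> Basis \<Longrightarrow> x \<bullet> i + r \<le> b \<bullet> i"
      proof
        define r where "r = Min ((\<lambda>i. b \<bullet> i - x \<bullet> i) ` Basis)"
        show "r > 0" unfolding r_def using x(1) by (subst Min_gr_iff) (auto simp: mem_box)
        fix i :: 'b assume "i \<in> Basis"
        then have "r \<le> b \<bullet> i - x \<bullet> i" unfolding r_def by (intro Min_le) auto
        then show "x \<bullet> i + r \<le> b \<bullet> i" by simp
      qed
      define h where "h = min r (d / 2)"
      have h: "0 < h" "h < d" "h \<le> r" using r(1) d(1) by (auto simp: h_def)
      have sub: "cbox x (x + h *\<^sub>R One) \<subseteq> cbox a b"
      proof
        fix y assume y: "y \<in> cbox x (x + h *\<^sub>R One)"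
        have "a \<bullet> i \<le> y \<bullet> i \<and> y \<bullet> i \<le> b \<bullet> i" if i: "i \<in> Basis" for i
        proof -
          have "x \<bullet> i \<le> y \<bullet> i" "y \<bullet> i \<le> x \<bullet> i + h"
            using y i by (auto simp: mem_box inner_add_left)
          then show ?thesis using x(1) i r(2)[OF i] h(3) by (auto simp: mem_box intro: less_imp_le le_less_trans)
        qed
        then show "y \<in> cbox a b" by (simp add: mem_box)
      qed
      have "integral (cbox x (x + h *\<^sub>R One)) G = integral (cbox x (x + h *\<^sub>R One)) g"
        by (rule integral_cong) (use sub in \<open>auto simp: G_def\<close>)
      also have "\<dots> = 0" using sub ab by (intro zero) auto
      finally have "norm (G x) < norm (g x)" using d(2)[OF h(1,2)] by simp
      then show False using x(1) box_subset_cbox by (auto simp: G_def split: if_splits)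
    qed
    then show ?thesis using N(1) negligible_frontier_interval[of a b]
      by (intro exI[of _ "N \<union> (cbox a b - box a b)"]) (auto simp: negligible_Un)
  qed
  obtain A where A: "countable A" "A \<subseteq> Pow D" "\<And>X. X \<in> A \<Longrightarrow> \<exists>a b. X = cbox a b" "\<Union>A = D"
    by (rule open_countable_Union_open_cbox[OF assms(1)]) blast
  have "\<exists>N. negligible N \<and> (\<forall>x\<in>X. x \<notin> N \<longrightarrow> g x = 0)" if "X \<in> A" for X
    using A(2,3) that box by (metis PowD subsetD)
  then obtain N where N: "\<And>X. X \<in> A \<Longrightarrow> negligible (N X)" "\<And>X x. X \<in> A \<Longrightarrow> x \<in> X \<Longrightarrow> x \<notin> N X \<Longrightarrow> g x = 0"
    by metis
  have "negligible (\<Union>X\<in>A. N X)"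
    using A(1) N(1) negligible_countable_Union[of "N ` A"] by auto
  then show ?thesis
    using A(4) N(2) by (intro AE_I'[of "\<Union>X\<in>A. N X"]) (auto simp: negligible_iff_null_sets)
qed

text \<open>A continuously differentiable substitute for the positive part: test functions are built from it,
  and moments truncated by it can be differentiated under the integral.\<close>

definition sqpos :: "real \<Rightarrow> real" where "sqpos t = (max 0 t)\<^sup>2"

lemma sqpos_deriv: "(sqpos has_real_derivative 2 * max 0 t) (at t)"
proof (cases "t = 0")
  case True
  have "((\<lambda>h. (sqpos h - sqpos 0) / (h - 0)) \<longlongrightarrow> 0) (at 0)"
  proof (rule Lim_null_comparison)
    show "\<forall>\<^sub>F h in at 0. norm ((sqpos h - sqpos 0) / (h - 0)) \<le> \<bar>h\<bar>"
      by (intro always_eventually) (auto simp: sqpos_def power2_eq_square max_def)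
    show "((\<lambda>h::real. \<bar>h\<bar>) \<longlongrightarrow> 0) (at 0)" by (intro tendsto_rabs_zero tendsto_ident_at)
  qed
  then show ?thesis using True by (simp add: has_field_derivative_iff)
next
  case False
  show ?thesis
  proof (cases "t > 0")
    case True
    have "((\<lambda>t. t\<^sup>2) has_real_derivative 2 * t) (at t)" by (auto intro!: derivative_eq_intros)
    then have "(sqpos has_real_derivative 2 * t) (at t)"
      by (rule has_field_derivative_transform_within_open[where S="{0<..}"]) (use True in \<open>auto simp: sqpos_def\<close>)
    then show ?thesis using True by simp
  next
    case neg: False
    have "((\<lambda>t. 0) has_real_derivative 0) (at t)" by simp
    then have "(sqpos has_real_derivative 0) (at t)"
      by (rule has_field_derivative_transform_within_open[where S="{..<0}"]) (use neg False in \<open>auto simp: sqpos_def\<close>)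
    then show ?thesis using neg by simp
  qed
qed

lemma sqpos_has_derivative:
  assumes "(g has_derivative g') (at x)"
  shows "((\<lambda>x. sqpos (g x)) has_derivative (\<lambda>h. g' h * (2 * max 0 (g x)))) (at x)"
  by (rule DERIV_compose_FDERIV[where f=sqpos and g=g, OF sqpos_deriv assms])

lemma sqpos_nonneg: "0 \<le> sqpos t" by (simp add: sqpos_def)
lemma sqpos_eq_0: "sqpos t = 0 \<longleftrightarrow> t \<le> 0" by (auto simp: sqpos_def max_def)

text \<open>A continuously differentiable function vanishing exactly on the box, in the role of the squared
  distance from it; \<open>dboxgap\<close> is its gradient.\<close>

definition boxgap :: "'b::euclidean_space \<Rightarrow> 'b \<Rightarrow> 'b \<Rightarrow> real" where
  "boxgap a b x = (\<Sum>i\<in>Basis. sqpos (a \<bullet> i - x \<bullet> i) + sqpos (x \<bullet> i - b \<bullet> i))"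

lemma boxgap_nonneg: "0 \<le> boxgap a b x"
  unfolding boxgap_def by (intro sum_nonneg add_nonneg_nonneg sqpos_nonneg)

lemma boxgap_eq_0: "boxgap a b x = 0 \<longleftrightarrow> x \<in> cbox a b"
proof -
  have "boxgap a b x = 0 \<longleftrightarrow> (\<forall>i\<in>Basis. sqpos (a \<bullet> i - x \<bullet> i) + sqpos (x \<bullet> i - b \<bullet> i) = 0)"
    unfolding boxgap_def by (intro sum_nonneg_eq_0_iff) (auto intro: add_nonneg_nonneg sqpos_nonneg)
  then show ?thesis by (simp add: add_nonneg_eq_0_iff sqpos_nonneg sqpos_eq_0 mem_box)
qed

definition dboxgap :: "'b::euclidean_space \<Rightarrow> 'b \<Rightarrow> 'b \<Rightarrow> 'b" where
  "dboxgap a b x = (\<Sum>i\<in>Basis. (2 * max 0 (x \<bullet> i - b \<bullet> i) - 2 * max 0 (a \<bullet> i - x \<bullet> i)) *\<^sub>R i)"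

lemma boxgap_deriv: "(boxgap a b has_derivative (\<lambda>h. h \<bullet> dboxgap a b x)) (at x)"
proof -
  have 1: "((\<lambda>x. sqpos (a \<bullet> i - x \<bullet> i)) has_derivative (\<lambda>h. 2 * max 0 (a \<bullet> i - x \<bullet> i) * (- (h \<bullet> i)))) (at x)" for i :: 'a
    by (rule has_derivative_eq_rhs, rule sqpos_has_derivative[where g'="\<lambda>h. - (h \<bullet> i)"])
       (auto intro!: derivative_eq_intros)
  have 2: "((\<lambda>x. sqpos (x \<bullet> i - b \<bullet> i)) has_derivative (\<lambda>h. 2 * max 0 (x \<bullet> i - b \<bullet> i) * (h \<bullet> i))) (at x)" for i :: 'a
    by (rule has_derivative_eq_rhs, rule sqpos_has_derivative[where g'="\<lambda>h. h \<bullet> i"])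
       (auto intro!: derivative_eq_intros)
  show ?thesis unfolding boxgap_def[abs_def]
    by (rule has_derivative_eq_rhs, rule has_derivative_sum, rule has_derivative_add, rule 1, rule 2)
       (auto simp: dboxgap_def inner_sum_right algebra_simps intro!: ext sum.cong)
qed

lemma continuous_dboxgap: "continuous_on UNIV (dboxgap a b)"
  unfolding dboxgap_def by (intro continuous_intros)

lemma continuous_boxgap: "continuous_on UNIV (boxgap a b)"
  using boxgap_deriv has_derivative_continuous by (metis continuous_at_imp_continuous_on)

lemma boxgap_le_1_subset: "{x. boxgap a b x \<le> 1} \<subseteq> cbox (a - One) (b + One)"
proof
  fix x assume x: "x \<in> {x. boxgap a b x \<le> 1}"
  have "a \<bullet> i - 1 \<le> x \<bullet> i \<and> x \<bullet> i \<le> b \<bullet> i + 1" if i: "i \<in> Basis" for i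
  proof -
    have "sqpos (a \<bullet> i - x \<bullet> i) + sqpos (x \<bullet> i - b \<bullet> i) \<le> boxgap a b x"
      unfolding boxgap_def by (rule member_le_sum) (use i in \<open>auto intro: add_nonneg_nonneg sqpos_nonneg\<close>)
    then have "sqpos (a \<bullet> i - x \<bullet> i) \<le> 1\<^sup>2" "sqpos (x \<bullet> i - b \<bullet> i) \<le> 1\<^sup>2"
      using x sqpos_nonneg[of "a \<bullet> i - x \<bullet> i"] sqpos_nonneg[of "x \<bullet> i - b \<bullet> i"] by auto
    then have "max 0 (a \<bullet> i - x \<bullet> i) \<le> 1" "max 0 (x \<bullet> i - b \<bullet> i) \<le> 1"
      unfolding sqpos_def using power2_le_imp_le[OF _ zero_le_one] by blast+
    then show ?thesis by auto
  qed
  then show "x \<in> cbox (a - One) (b + One)" by (auto simp: mem_box inner_diff_left inner_add_left)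
qed

text \<open>Test functions that decrease to the indicator of the box as \<open>k\<close> grows; \<open>dboxbump\<close> is the
  gradient.\<close>

definition boxbump :: "real \<Rightarrow> 'b::euclidean_space \<Rightarrow> 'b \<Rightarrow> 'b \<Rightarrow> real" where
  "boxbump k a b x = sqpos (1 - k * boxgap a b x)"

definition dboxbump :: "real \<Rightarrow> 'b::euclidean_space \<Rightarrow> 'b \<Rightarrow> 'b \<Rightarrow> 'b" where
  "dboxbump k a b x = (- (2 * max 0 (1 - k * boxgap a b x) * k)) *\<^sub>R dboxgap a b x"

lemma boxbump_test_fun:
  fixes a b :: "'b::euclidean_space"
  assumes k: "k \<ge> 1" and D: "{x. boxgap a b x \<le> 1 / k} \<subseteq> D"
  shows "test_fun D (boxbump k a b) (dboxbump k a b)"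
  unfolding test_fun_def
proof (intro conjI allI)
  fix x
  have "((\<lambda>x. 1 - k * boxgap a b x) has_derivative (\<lambda>h. - (k * (h \<bullet> dboxgap a b x)))) (at x)"
    by (auto intro!: derivative_eq_intros boxgap_deriv)
  from sqpos_has_derivative[OF this]
  show "GDERIV (boxbump k a b) x :> dboxbump k a b x"
    unfolding gderiv_def boxbump_def[abs_def] dboxbump_def by (simp add: algebra_simps)
next
  show "continuous_on UNIV (dboxbump k a b)"
    unfolding dboxbump_def by (intro continuous_intros continuous_boxgap continuous_dboxgap)
next
  have cl: "closed {x. boxgap a b x \<le> 1 / k}"
    by (intro closed_Collect_le continuous_boxgap continuous_intros)
  have "boxbump k a b x = 0" if "\<not> boxgap a b x \<le> 1 / k" for x
  proof -
    have "1 < k * boxgap a b x" using that k by (simp add: field_simps)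
    then show ?thesis by (simp add: boxbump_def sqpos_eq_0)
  qed
  then have sub: "closure {x. boxbump k a b x \<noteq> 0} \<subseteq> {x. boxgap a b x \<le> 1 / k}"
    by (intro closure_minimal cl) blast
  have "1 / k \<le> 1" using k by simp
  then have "{x. boxgap a b x \<le> 1 / k} \<subseteq> cbox (a - One) (b + One)"
    using boxgap_le_1_subset[of a b] by (auto intro: order_trans)
  then show "compact (closure {x. boxbump k a b x \<noteq> 0})"
    using sub by (metis bounded_cbox bounded_subset closed_closure compact_eq_bounded_closed)
  show "closure {x. boxbump k a b x \<noteq> 0} \<subseteq> D" using sub D by blast
qed

lemma boxbump_bounds: "0 \<le> k \<Longrightarrow> 0 \<le> boxbump k a b x" "0 \<le> k \<Longrightarrow> boxbump k a b x \<le> 1"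
proof -
  assume k: "0 \<le> k"
  then have "max 0 (1 - k * boxgap a b x) \<le> 1" using boxgap_nonneg[of a b x] by simp
  then show "boxbump k a b x \<le> 1" unfolding boxbump_def sqpos_def by (intro power_le_one) auto
qed (simp add: boxbump_def sqpos_nonneg)

lemma boxbump_tendsto: "(\<lambda>n. boxbump (real (n + m)) a b x) \<longlonglongrightarrow> indicator (cbox a b) x"
proof (cases "x \<in> cbox a b")
  case True
  then show ?thesis using boxgap_eq_0[of a b x] by (simp add: boxbump_def sqpos_def)
next
  case False
  then have p: "boxgap a b x > 0" using boxgap_eq_0[of a b x] boxgap_nonneg[of a b x] by linarith
  obtain N :: nat where N: "1 / boxgap a b x < N" using reals_Archimedean2 by blast
  have "boxbump (real (n + m)) a b x = 0" if "n \<ge> N" for n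
  proof -
    have "1 / boxgap a b x < real (n + m)" using N that by linarith
    then have "1 < real (n + m) * boxgap a b x" using p by (simp add: field_simps)
    then show ?thesis by (simp add: boxbump_def sqpos_eq_0)
  qed
  then have "(\<lambda>n. boxbump (real (n + m)) a b x) \<longlonglongrightarrow> 0"
    by (intro tendsto_eventually) (auto simp: eventually_sequentially)
  then show ?thesis using False by simp
qed

text \<open>The part of \<open>{boxgap \<le> 1}\<close> outside \<open>D\<close> is compact and disjoint from the box, so \<open>boxgap\<close> has a positive
  minimum on it.\<close>

lemma boxgap_neighbourhood:
  fixes a b :: "'b::euclidean_space"
  assumes "open D" "cbox a b \<subseteq> D"
  obtains m :: nat where "m \<ge> 1" "{x. boxgap a b x \<le> 1 / m} \<subseteq> D"
proof -
  define K where "K = {x. boxgap a b x \<le> 1} - D"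
  have "compact {x. boxgap a b x \<le> 1}"
    using boxgap_le_1_subset[of a b] closed_Collect_le[OF continuous_boxgap[of a b] continuous_on_const[of _ 1]]
    by (metis bounded_cbox bounded_subset compact_eq_bounded_closed)
  then have K: "compact K" unfolding K_def using assms(1) by (rule compact_diff)
  have "\<exists>c>0. \<forall>x\<in>K. c \<le> boxgap a b x"
  proof (cases "K = {}")
    case False
    obtain x0 where x0: "x0 \<in> K" "\<And>x. x \<in> K \<Longrightarrow> boxgap a b x0 \<le> boxgap a b x"
      using continuous_attains_inf[OF K False continuous_on_subset[OF continuous_boxgap]] by blast
    have "x0 \<notin> cbox a b" using x0(1) assms(2) by (auto simp: K_def)
    then have "boxgap a b x0 > 0" using boxgap_eq_0[of a b x0] boxgap_nonneg[of a b x0] by linarith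
    then show ?thesis using x0 by blast
  qed (auto intro: exI[of _ 1])
  then obtain c where c: "c > 0" "\<And>x. x \<in> K \<Longrightarrow> c \<le> boxgap a b x" by blast
  obtain n :: nat where n: "1 / Suc n < c" using c(1) nat_approx_posE by blast
  have "{x. boxgap a b x \<le> 1 / Suc n} \<subseteq> D"
  proof
    fix x assume x: "x \<in> {x. boxgap a b x \<le> 1 / Suc n}"
    have "1 / real (Suc n) \<le> 1" by simp
    then have "boxgap a b x \<le> 1" using x by (auto intro: order_trans)
    then show "x \<in> D" using c(2)[of x] x n unfolding K_def by force
  qed
  then show ?thesis using that[of "Suc n"] by simp
qed

text \<open>Testing with \<open>boxbump k\<close> and letting \<open>k\<close> tend to infinity shows that the difference of two weak
  gradients has integral zero over every box in \<open>D\<close>.\<close>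

lemma weak_gradient_unique:
  fixes u :: "'b::euclidean_space \<Rightarrow> real"
  assumes D: "open D" and g: "has_weak_gradient u g D" and g': "has_weak_gradient u g' D"
  shows "AE x in lebesgue. x \<in> D \<longrightarrow> g x = g' x"
proof -
  have loc: "set_integrable lebesgue K g" "set_integrable lebesgue K g'" if "compact K" "K \<subseteq> D" for K
    using g g' that unfolding has_weak_gradient_def locally_integrable_on_def by auto
  have z: "integral (cbox a b) (\<lambda>x. g x - g' x) = 0" if ab: "cbox a b \<subseteq> D" for a b
  proof -
    obtain m :: nat where m: "m \<ge> 1" "{x. boxgap a b x \<le> 1 / m} \<subseteq> D"
      using boxgap_neighbourhood[OF D ab] by blast
    define K where "K = {x. boxgap a b x \<le> 1 / m}"
    have "1 / real m \<le> 1" using m(1) by simp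
    then have "K \<subseteq> cbox (a - One) (b + One)"
      unfolding K_def using boxgap_le_1_subset[of a b] by (auto intro: order_trans)
    moreover have "closed K" unfolding K_def
      by (intro closed_Collect_le continuous_boxgap continuous_intros)
    ultimately have K: "compact K" by (metis bounded_cbox bounded_subset compact_eq_bounded_closed)
    have KD: "K \<subseteq> D" using m(2) by (simp add: K_def)
    define d where "d = (\<lambda>x. indicator K x *\<^sub>R (g x - g' x))"
    have intd: "integrable lebesgue d"
      using set_integral_diff(1)[OF loc[OF K KD]] by (simp add: set_integrable_def d_def)
    define \<phi> where "\<phi> = (\<lambda>n. boxbump (real (n + m)) a b)"
    have tf: "test_fun D (\<phi> n) (dboxbump (real (n + m)) a b)" for n unfolding \<phi>_def
    proof (rule boxbump_test_fun)
      have "1 / real (n + m) \<le> 1 / real m" using m(1) by (intro divide_left_mono) auto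
      then show "{x. boxgap a b x \<le> 1 / real (n + m)} \<subseteq> D" using m(2) by (auto intro: order_trans)
    qed (use m(1) in simp)
    have out: "\<phi> n x = 0" if "x \<notin> K" for n x
    proof -
      have "1 < real m * boxgap a b x" using that m(1) by (auto simp: K_def field_simps)
      also have "\<dots> \<le> real (n + m) * boxgap a b x" by (intro mult_right_mono boxgap_nonneg) auto
      finally show ?thesis by (simp add: \<phi>_def boxbump_def sqpos_eq_0)
    qed
    have \<phi>c: "continuous_on UNIV (\<phi> n)" for n unfolding \<phi>_def boxbump_def sqpos_def
      by (intro continuous_intros continuous_boxgap)
    then have \<phi>m: "\<phi> n \<in> borel_measurable lebesgue" for n
      by (intro measurable_completion) (simp add: borel_measurable_continuous_onI)
    have bnd: "norm (\<phi> n x *\<^sub>R G x) \<le> norm (G x)" for n x and G :: "'b \<Rightarrow> 'b"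
      using boxbump_bounds[of "real (n + m)" a b x] by (simp add: \<phi>_def mult_left_le_one_le)
    have gg: "integrable lebesgue (\<lambda>x. indicator K x *\<^sub>R g x)" "integrable lebesgue (\<lambda>x. indicator K x *\<^sub>R g' x)"
      using loc[OF K KD] by (auto simp: set_integrable_def)
    have iprod: "integrable lebesgue (\<lambda>x. \<phi> n x *\<^sub>R (indicator K x *\<^sub>R G x))"
      if "integrable lebesgue (\<lambda>x. indicator K x *\<^sub>R G x)" for n and G :: "'b \<Rightarrow> 'b"
    proof (rule Bochner_Integration.integrable_bound[OF that])
      show "(\<lambda>x. \<phi> n x *\<^sub>R (indicator K x *\<^sub>R G x)) \<in> borel_measurable lebesgue"
        by (rule borel_measurable_scaleR[OF \<phi>m borel_measurable_integrable[OF that]])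
      show "AE x in lebesgue. norm (\<phi> n x *\<^sub>R (indicator K x *\<^sub>R G x)) \<le> norm (indicator K x *\<^sub>R G x)"
        by (intro always_eventually allI bnd)
    qed
    have red: "(LINT x:D|lebesgue. \<phi> n x *\<^sub>R G x) = (LINT x|lebesgue. \<phi> n x *\<^sub>R (indicator K x *\<^sub>R G x))" for n and G :: "'b \<Rightarrow> 'b"
      unfolding set_lebesgue_integral_def
      by (intro Bochner_Integration.integral_cong) (use out KD in \<open>auto split: split_indicator\<close>)
    have zero: "(LINT x|lebesgue. \<phi> n x *\<^sub>R d x) = 0" for n
    proof -
      have "(LINT x:D|lebesgue. \<phi> n x *\<^sub>R g x) = (LINT x:D|lebesgue. \<phi> n x *\<^sub>R g' x)"
      proof -
        have "(LINT x:D|lebesgue. u x *\<^sub>R dboxbump (real (n + m)) a b x) = - (LINT x:D|lebesgue. \<phi> n x *\<^sub>R g x)"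
          "(LINT x:D|lebesgue. u x *\<^sub>R dboxbump (real (n + m)) a b x) = - (LINT x:D|lebesgue. \<phi> n x *\<^sub>R g' x)"
          using g g' tf[of n] unfolding has_weak_gradient_def by blast+
        then show ?thesis by simp
      qed
      then have "(LINT x|lebesgue. \<phi> n x *\<^sub>R (indicator K x *\<^sub>R g x)) - (LINT x|lebesgue. \<phi> n x *\<^sub>R (indicator K x *\<^sub>R g' x)) = 0"
        by (simp add: red)
      then show ?thesis
        by (subst (asm) Bochner_Integration.integral_diff[symmetric, OF iprod[OF gg(1)] iprod[OF gg(2)]])
           (simp add: d_def algebra_simps)
    qed
    have "(\<lambda>n. LINT x|lebesgue. \<phi> n x *\<^sub>R d x) \<longlonglongrightarrow> (LINT x|lebesgue. indicator (cbox a b) x *\<^sub>R d x)"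
    proof (rule integral_dominated_convergence[where w="\<lambda>x. norm (d x)"])
      show "AE x in lebesgue. (\<lambda>n. \<phi> n x *\<^sub>R d x) \<longlonglongrightarrow> indicator (cbox a b) x *\<^sub>R d x"
        unfolding \<phi>_def by (intro always_eventually allI tendsto_intros boxbump_tendsto)
      show "AE x in lebesgue. norm (\<phi> n x *\<^sub>R d x) \<le> norm (d x)" for n by (intro always_eventually allI bnd)
      show "(\<lambda>x. indicator (cbox a b) x *\<^sub>R d x) \<in> borel_measurable lebesgue"
        by (intro borel_measurable_scaleR borel_measurable_integrable[OF intd] borel_measurable_indicator) simp
      show "(\<lambda>x. \<phi> n x *\<^sub>R d x) \<in> borel_measurable lebesgue" for n
        by (intro borel_measurable_scaleR borel_measurable_integrable[OF intd] \<phi>m)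
      show "integrable lebesgue (\<lambda>x. norm (d x))" using intd by (rule integrable_norm)
    qed
    then have "(LINT x|lebesgue. indicator (cbox a b) x *\<^sub>R d x) = 0"
      by (simp add: zero LIMSEQ_const_iff)
    moreover have "cbox a b \<subseteq> K" by (auto simp: K_def boxgap_eq_0[THEN iffD2])
    then have "indicator (cbox a b) x *\<^sub>R d x = indicator (cbox a b) x *\<^sub>R (g x - g' x)" for x
      by (auto simp: d_def split: split_indicator)
    ultimately have "(LINT x:cbox a b|lebesgue. g x - g' x) = 0" by (simp add: set_lebesgue_integral_def)
    then show ?thesis
      using set_lebesgue_integral_eq_integral(2)[OF set_integral_diff(1)[OF loc[OF _ ab]]] by simp
  qed
  have "AE x in lebesgue. x \<in> D \<longrightarrow> g x - g' x = 0"
    by (rule zero_box_integrals_imp_zero[OF D]) (use z set_integral_diff(1) loc in auto)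
  then show ?thesis by simp
qed

lemma test_fun_facts:
  fixes \<phi> :: "'b::euclidean_space \<Rightarrow> real"
  assumes "test_fun D \<phi> d\<phi>"
  obtains R B where "R > 0" "B-lipschitz_on UNIV \<phi>" "\<And>x. \<phi> x \<noteq> 0 \<Longrightarrow> norm x \<le> R" "\<And>x. norm (d\<phi> x) \<le> B"
    "\<And>x. d\<phi> x \<noteq> 0 \<Longrightarrow> x \<in> closure {x. \<phi> x \<noteq> 0}"
proof -
  let ?S = "closure {x. \<phi> x \<noteq> 0}"
  have der: "(\<phi> has_derivative (\<lambda>h. h \<bullet> d\<phi> x)) (at x)" for x
    using assms by (auto simp: test_fun_def gderiv_def)
  have S: "compact ?S" and dc: "continuous_on UNIV d\<phi>" using assms by (auto simp: test_fun_def)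
  have out: "d\<phi> x = 0" if "x \<notin> ?S" for x
  proof -
    have "((\<lambda>x. 0) has_derivative (\<lambda>h. 0)) (at x)" by simp
    then have "(\<phi> has_derivative (\<lambda>h. 0)) (at x)"
    proof (rule has_derivative_transform_within_open)
      show "open (- ?S)" "x \<in> - ?S" using that by auto
      fix y assume "y \<in> - ?S"
      then show "0 = \<phi> y" using closure_subset[of "{x. \<phi> x \<noteq> 0}"] by auto
    qed
    then have "(\<lambda>h. h \<bullet> d\<phi> x) = (\<lambda>h. 0)" using der[of x] has_derivative_unique by blast
    then have "d\<phi> x \<bullet> d\<phi> x = 0" by meson
    then show ?thesis by simp
  qed
  obtain R where R: "R > 0" "\<And>x. x \<in> ?S \<Longrightarrow> norm x \<le> R"
    using compact_imp_bounded[OF S] unfolding bounded_pos by blast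
  have "bounded (d\<phi> ` ?S)"
    by (intro compact_imp_bounded compact_continuous_image S continuous_on_subset[OF dc]) simp
  then obtain B where B: "B > 0" "\<And>x. x \<in> ?S \<Longrightarrow> norm (d\<phi> x) \<le> B"
    unfolding bounded_pos by blast
  have B': "norm (d\<phi> x) \<le> B" for x using B out by (cases "x \<in> ?S") auto
  have "B-lipschitz_on UNIV \<phi>"
  proof (rule bounded_derivative_imp_lipschitz[where f'="\<lambda>x h. h \<bullet> d\<phi> x"])
    fix x :: 'b
    show "(\<phi> has_derivative (\<lambda>h. h \<bullet> d\<phi> x)) (at x within UNIV)" using der by simp
    show "onorm (\<lambda>h. h \<bullet> d\<phi> x) \<le> B"
    proof (rule onorm_bound)
      fix h
      have "norm (h \<bullet> d\<phi> x) \<le> norm h * norm (d\<phi> x)" by (simp add: Cauchy_Schwarz_ineq2)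
      also have "\<dots> \<le> norm h * B" by (intro mult_left_mono B') auto
      finally show "norm (h \<bullet> d\<phi> x) \<le> B * norm h" by (simp add: mult.commute)
    qed (use B in simp)
  qed (use B in auto)
  moreover have "norm x \<le> R" if "\<phi> x \<noteq> 0" for x using that closure_subset[of "{x. \<phi> x \<noteq> 0}"] by (intro R(2)) auto
  ultimately show ?thesis using that[of R B] R(1) B' out by blast
qed

lemma integrable_bounded_compact_support:
  fixes F :: "'b::euclidean_space \<Rightarrow> 'c::{banach,second_countable_topology}"
  assumes m: "F \<in> borel_measurable borel" and K: "compact K"
    and out: "\<And>x. x \<notin> K \<Longrightarrow> F x = 0" and bnd: "\<And>x. x \<in> K \<Longrightarrow> norm (F x) \<le> C"
  shows "integrable lborel F"
proof (rule Bochner_Integration.integrable_bound)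
  have "emeasure lborel K < \<infinity>" using K emeasure_bounded_finite compact_imp_bounded by blast
  then show "integrable lborel (\<lambda>x. C * indicator K x :: real)"
    using K by (intro integrable_mult_right integrable_real_indicator) (auto simp: compact_imp_closed)
  show "F \<in> borel_measurable lborel" using m by simp
  show "AE x in lborel. norm (F x) \<le> norm (C * indicator K x)"
  proof (intro always_eventually allI)
    fix x show "norm (F x) \<le> norm (C * indicator K x)"
      using bnd[of x] out[of x] by (cases "x \<in> K") auto
  qed
qed

lemma integrable_continuous_compact_support:
  fixes F :: "'b::euclidean_space \<Rightarrow> 'c::euclidean_space"
  assumes F: "continuous_on UNIV F" and K: "compact K" and out: "\<And>x. x \<notin> K \<Longrightarrow> F x = 0"
  shows "integrable lborel F"
proof -
  have "bounded (F ` K)" by (intro compact_imp_bounded compact_continuous_image continuous_on_subset[OF F] K) auto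
  then obtain C where "\<forall>y\<in>F ` K. norm y \<le> C" unfolding bounded_iff by blast
  then show ?thesis
    by (intro integrable_bounded_compact_support[OF borel_measurable_continuous_onI[OF F] K out]) auto
qed

lemma lborel_integral_translate:
  fixes f :: "'b::euclidean_space \<Rightarrow> real"
  assumes [measurable]: "f \<in> borel_measurable borel"
  shows "(LINT x|lborel. f (x + c)) = (LINT x|lborel. f x)"
proof -
  have "(LINT x|lborel. f x) = (LINT x|distr lborel borel ((+) c). f x)" by (simp add: lborel_distr_plus)
  also have "\<dots> = (LINT x|lborel. f (c + x))" by (rule integral_distr) auto
  finally show ?thesis by (simp add: add.commute)
qed

text \<open>For difference quotients, integration by parts is a translation of the variable. The quotients are
  bounded by the Lipschitz constants, so dominated convergence passes to the derivatives.\<close>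

lemma lipschitz_integration_by_parts:
  fixes h :: "'b::euclidean_space \<Rightarrow> real"
  assumes lip: "L-lipschitz_on UNIV h" and tf: "test_fun D \<phi> d\<phi>"
  shows "(LINT x|lborel. h x * (d\<phi> x \<bullet> e)) = - (LINT x|lborel. \<phi> x * pd h e x)"
proof -
  obtain R B where R: "R > 0" and lip\<phi>: "B-lipschitz_on UNIV \<phi>" and supp: "\<And>x. \<phi> x \<noteq> 0 \<Longrightarrow> norm x \<le> R"
    by (rule test_fun_facts[OF tf]) blast
  have hc: "continuous_on UNIV h" and \<phi>c: "continuous_on UNIV \<phi>"
    using lip lip\<phi> lipschitz_on_continuous_on by blast+
  have dc: "continuous_on UNIV d\<phi>" using tf by (auto simp: test_fun_def)
  have [measurable]: "h \<in> borel_measurable borel" "\<phi> \<in> borel_measurable borel" "d\<phi> \<in> borel_measurable borel"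
    by (intro borel_measurable_continuous_onI hc \<phi>c dc)+
  note measurable_pd[OF hc, of e, measurable]
  have [measurable]: "dq h e t \<in> borel_measurable borel" "dq \<phi> e t \<in> borel_measurable borel"
    "dq \<phi> (- e) t \<in> borel_measurable borel" for t unfolding dq_def[abs_def] by measurable
  \<comment> \<open>large enough for the supports of all translates of \<open>\<phi>\<close> by at most \<open>e\<close>\<close>
  define K where "K = cball (0::'b) (R + norm e)"
  have K: "compact K" by (simp add: K_def)
  obtain M where M: "M > 0" "\<And>x. x \<in> K \<Longrightarrow> \<bar>h x\<bar> \<le> M"
    using compact_imp_bounded[OF compact_continuous_image[OF continuous_on_subset[OF hc] K]]
    unfolding bounded_pos by auto
  obtain M' where M': "M' > 0" "\<And>x. x \<in> K \<Longrightarrow> \<bar>\<phi> x\<bar> \<le> M'"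
    using compact_imp_bounded[OF compact_continuous_image[OF continuous_on_subset[OF \<phi>c] K]]
    unfolding bounded_pos by auto
  have out: "\<phi> x = 0" if "x \<notin> K" for x using supp[of x] that by (force simp: K_def intro: order_trans)
  have out': "\<phi> (x + t *\<^sub>R - e) = 0" if "x \<notin> K" "\<bar>t\<bar> \<le> 1" for x t
  proof (rule ccontr)
    assume "\<phi> (x + t *\<^sub>R - e) \<noteq> 0"
    then have "norm (x - t *\<^sub>R e) \<le> R" using supp by simp
    moreover have "norm x \<le> norm (x - t *\<^sub>R e) + norm (t *\<^sub>R e)"
      using norm_triangle_ineq[of "x - t *\<^sub>R e" "t *\<^sub>R e"] by simp
    moreover have "norm (t *\<^sub>R e) \<le> norm e" using that(2) by (simp add: mult_left_le_one_le)
    ultimately show False using that(1) by (simp add: K_def)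
  qed
  have intK: "integrable lborel (\<lambda>x. c * indicator K x :: real)" for c
    by (intro integrable_mult_right integrable_real_indicator)
       (use emeasure_bounded_finite[OF bounded_cball, of "0::'b" "R + norm e"] in \<open>auto simp: K_def\<close>)
  define t where "t = (\<lambda>n. 1 / real (Suc n))"
  have t: "t n \<noteq> 0" "\<bar>t n\<bar> \<le> 1" for n by (auto simp: t_def)
  have "t \<longlonglongrightarrow> 0" unfolding t_def using LIMSEQ_Suc[OF lim_1_over_n] by simp
  then have tlim: "filterlim t (at 0) sequentially" using t(1) by (auto simp: filterlim_at)
  have parts: "(LINT x|lborel. h x * dq \<phi> (- e) (t n) x) = (LINT x|lborel. \<phi> x * dq h e (t n) x)" for n
  proof -
    have i1: "integrable lborel (\<lambda>x. h x * \<phi> (x - t n *\<^sub>R e))"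
      by (intro integrable_continuous_compact_support[OF _ K] continuous_intros continuous_on_compose2[OF \<phi>c] hc)
         (use out' t(2) in simp_all)
    have i2: "integrable lborel (\<lambda>x. h x * \<phi> x)"
      by (intro integrable_continuous_compact_support[OF _ K] continuous_intros hc \<phi>c) (simp add: out)
    have i3: "integrable lborel (\<lambda>x. h (x + t n *\<^sub>R e) * \<phi> x)"
      by (intro integrable_continuous_compact_support[OF _ K] continuous_intros continuous_on_compose2[OF hc] \<phi>c)
         (simp_all add: out)
    have "(LINT x|lborel. h x * dq \<phi> (- e) (t n) x) = (LINT x|lborel. (h x * \<phi> (x - t n *\<^sub>R e) - h x * \<phi> x) / t n)"
      by (simp add: dq_def algebra_simps)
    also have "\<dots> = ((LINT x|lborel. h x * \<phi> (x - t n *\<^sub>R e)) - (LINT x|lborel. h x * \<phi> x)) / t n"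
      using i1 i2 by simp
    also have "(LINT x|lborel. h x * \<phi> (x - t n *\<^sub>R e)) = (LINT x|lborel. h (x + t n *\<^sub>R e) * \<phi> x)"
      using lborel_integral_translate[of "\<lambda>x. h x * \<phi> (x - t n *\<^sub>R e)" "t n *\<^sub>R e"] by simp
    also have "((LINT x|lborel. h (x + t n *\<^sub>R e) * \<phi> x) - (LINT x|lborel. h x * \<phi> x)) / t n
        = (LINT x|lborel. (h (x + t n *\<^sub>R e) * \<phi> x - h x * \<phi> x) / t n)"
      using i3 i2 by simp
    also have "\<dots> = (LINT x|lborel. \<phi> x * dq h e (t n) x)"
      by (simp add: dq_def algebra_simps)
    finally show ?thesis .
  qed
  have lim1: "(\<lambda>n. LINT x|lborel. h x * dq \<phi> (- e) (t n) x) \<longlonglongrightarrow> (LINT x|lborel. h x * (- (d\<phi> x \<bullet> e)))"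
  proof (rule integral_dominated_convergence[where w="\<lambda>x. M * (B * norm e) * indicator K x"])
    show "AE x in lborel. (\<lambda>n. h x * dq \<phi> (- e) (t n) x) \<longlonglongrightarrow> h x * (- (d\<phi> x \<bullet> e))"
    proof (intro always_eventually allI tendsto_mult tendsto_const)
      fix x
      have "(\<phi> has_derivative (\<lambda>h. h \<bullet> d\<phi> x)) (at (x + 0 *\<^sub>R - e))"
        using tf by (auto simp: test_fun_def gderiv_def)
      then have "((\<lambda>s. \<phi> (x + s *\<^sub>R - e)) has_derivative (\<lambda>s. (s *\<^sub>R - e) \<bullet> d\<phi> x)) (at 0)"
        by (rule has_derivative_compose[rotated]) (auto intro!: derivative_eq_intros)
      then have "((\<lambda>s. \<phi> (x + s *\<^sub>R - e)) has_real_derivative (- (d\<phi> x \<bullet> e))) (at 0)"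
        unfolding has_field_derivative_def
        by (rule has_derivative_eq_rhs) (simp add: fun_eq_iff inner_commute)
      then have "((\<lambda>s. dq \<phi> (- e) s x) \<longlongrightarrow> - (d\<phi> x \<bullet> e)) (at 0)"
        by (simp add: has_field_derivative_iff dq_def)
      from filterlim_compose[OF this tlim]
      show "(\<lambda>n. dq \<phi> (- e) (t n) x) \<longlonglongrightarrow> - (d\<phi> x \<bullet> e)" .
    qed
    show "AE x in lborel. norm (h x * dq \<phi> (- e) (t n) x) \<le> M * (B * norm e) * indicator K x" for n
    proof (intro always_eventually allI)
      fix x show "norm (h x * dq \<phi> (- e) (t n) x) \<le> M * (B * norm e) * indicator K x"
      proof (cases "x \<in> K")
        case True
        then show ?thesis using M(2)[OF True] dq_bound[OF lip\<phi>, of "- e" "t n" x] M(1)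
          by (simp add: abs_mult mult_mono)
      next
        case False
        then show ?thesis using out'[OF False t(2)[of n]] out[OF False] by (simp add: dq_def)
      qed
    qed
  qed (use intK in measurable)
  have lim2: "(\<lambda>n. LINT x|lborel. \<phi> x * dq h e (t n) x) \<longlonglongrightarrow> (LINT x|lborel. \<phi> x * pd h e x)"
  proof (rule integral_dominated_convergence[where w="\<lambda>x. M' * (L * norm e) * indicator K x"])
    show "AE x in lborel. (\<lambda>n. \<phi> x * dq h e (t n) x) \<longlonglongrightarrow> \<phi> x * pd h e x"
      using lipschitz_AE_ddiff[OF lip, of e]
    proof (rule eventually_mono)
      fix x assume "ddiff h e x"
      from filterlim_compose[OF pd_tendsto[OF this] tlim]
      show "(\<lambda>n. \<phi> x * dq h e (t n) x) \<longlonglongrightarrow> \<phi> x * pd h e x" by (rule tendsto_mult_left)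
    qed
    show "AE x in lborel. norm (\<phi> x * dq h e (t n) x) \<le> M' * (L * norm e) * indicator K x" for n
    proof (intro always_eventually allI)
      fix x show "norm (\<phi> x * dq h e (t n) x) \<le> M' * (L * norm e) * indicator K x"
      proof (cases "x \<in> K")
        case True
        then show ?thesis using M'(2)[OF True] dq_bound[OF lip, of e "t n" x] M'(1)
          by (simp add: abs_mult mult_mono)
      next
        case False
        then show ?thesis using out[OF False] by simp
      qed
    qed
  qed (use intK in measurable)
  have "(LINT x|lborel. h x * (- (d\<phi> x \<bullet> e))) = (LINT x|lborel. \<phi> x * pd h e x)"
    using LIMSEQ_unique[OF lim1] lim2 by (simp add: parts)
  then show ?thesis by simp
qed

text \<open>Test functions vanish off \<open>D\<close>, where \<open>u\<close> and \<open>h\<close> may differ, so the integration by parts for \<open>h\<close> on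
  the whole space is one for \<open>u\<close> on \<open>D\<close>.\<close>

lemma weak_gradient_lipschitz:
  fixes h :: "'b::euclidean_space \<Rightarrow> real"
  assumes lip: "L-lipschitz_on UNIV h" and uh: "\<And>x. x \<in> D \<Longrightarrow> u x = h x"
  shows "has_weak_gradient u (\<lambda>x. \<Sum>e\<in>Basis. pd h e x *\<^sub>R e) D"
proof -
  define g where "g = (\<lambda>x. \<Sum>e\<in>Basis. pd h e x *\<^sub>R e)"
  have hc: "continuous_on UNIV h" using lip lipschitz_on_continuous_on by blast
  have hm[measurable]: "h \<in> borel_measurable borel" by (intro borel_measurable_continuous_onI hc)
  have gm[measurable]: "g \<in> borel_measurable borel"
    unfolding g_def by (intro borel_measurable_sum borel_measurable_scaleR measurable_pd[OF hc]) auto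
  have gb: "norm (g x) \<le> DIM('b) * L" for x
  proof -
    have "norm (g x) \<le> (\<Sum>e\<in>(Basis :: 'b set). L)"
      unfolding g_def
    proof (rule sum_norm_le)
      fix e :: 'b assume "e \<in> Basis"
      then show "norm (pd h e x *\<^sub>R e) \<le> L" using pd_bound[OF lip, of e x] by simp
    qed
    then show ?thesis by simp
  qed
  have ge: "g x \<bullet> e = pd h e x" if "e \<in> Basis" for x e
    unfolding g_def using that by simp
  have hb: "\<exists>M>0. \<forall>x\<in>K. \<bar>h x\<bar> \<le> M" if "compact K" for K
    using compact_imp_bounded[OF compact_continuous_image[OF continuous_on_subset[OF hc] that]]
    unfolding bounded_pos by auto
  have locg: "locally_integrable_on g D"
    unfolding locally_integrable_on_def
  proof (intro allI impI)
    fix K assume K: "compact K \<and> K \<subseteq> D"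
    have [measurable]: "K \<in> sets borel" using K by (auto simp: compact_imp_closed)
    have "integrable lborel (\<lambda>x. indicator K x *\<^sub>R g x)"
      using K gb by (intro integrable_bounded_compact_support[of _ K "DIM('b) * L"]) auto
    then show "set_integrable lebesgue K g"
      unfolding set_integrable_def by (subst integrable_completion) measurable
  qed
  have locu: "locally_integrable_on u D"
    unfolding locally_integrable_on_def
  proof (intro allI impI)
    fix K assume K: "compact K \<and> K \<subseteq> D"
    obtain M where M: "M > 0" "\<And>x. x \<in> K \<Longrightarrow> \<bar>h x\<bar> \<le> M" using hb[of K] K by auto
    have [measurable]: "K \<in> sets borel" using K by (auto simp: compact_imp_closed)
    have "integrable lborel (\<lambda>x. indicator K x *\<^sub>R h x)"
      using K M by (intro integrable_bounded_compact_support[of _ K M]) auto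
    then have "integrable lebesgue (\<lambda>x. indicator K x *\<^sub>R h x)"
      by (subst integrable_completion) measurable
    moreover have "(\<lambda>x. indicator K x *\<^sub>R h x) = (\<lambda>x. indicator K x *\<^sub>R u x)"
      using uh K by (auto simp: fun_eq_iff indicator_def)
    ultimately show "set_integrable lebesgue K u" by (simp add: set_integrable_def)
  qed
  have parts: "(LINT x:D|lebesgue. u x *\<^sub>R d\<phi> x) = - (LINT x:D|lebesgue. \<phi> x *\<^sub>R g x)"
    if tf: "test_fun D \<phi> d\<phi>" for \<phi> d\<phi>
  proof -
    obtain R B where R: "R > 0" "B-lipschitz_on UNIV \<phi>" "\<And>x. \<phi> x \<noteq> 0 \<Longrightarrow> norm x \<le> R"
      "\<And>x. norm (d\<phi> x) \<le> B" "\<And>x. d\<phi> x \<noteq> 0 \<Longrightarrow> x \<in> closure {x. \<phi> x \<noteq> 0}"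
      by (rule test_fun_facts[OF tf]) blast
    let ?S = "closure {x. \<phi> x \<noteq> 0}"
    have S: "compact ?S" "?S \<subseteq> D" using tf by (auto simp: test_fun_def)
    have \<phi>S: "\<phi> x \<noteq> 0 \<Longrightarrow> x \<in> ?S" for x using closure_subset[of "{x. \<phi> x \<noteq> 0}"] by auto
    have \<phi>c: "continuous_on UNIV \<phi>" using R(2) lipschitz_on_continuous_on by blast
    have dc: "continuous_on UNIV d\<phi>" using tf by (auto simp: test_fun_def)
    have [measurable]: "\<phi> \<in> borel_measurable borel" "d\<phi> \<in> borel_measurable borel"
      by (intro borel_measurable_continuous_onI \<phi>c dc)+
    obtain M' where M': "M' > 0" "\<And>x. x \<in> ?S \<Longrightarrow> \<bar>\<phi> x\<bar> \<le> M'"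
      using compact_imp_bounded[OF compact_continuous_image[OF continuous_on_subset[OF \<phi>c] S(1)]]
      unfolding bounded_pos by auto
    have i1: "integrable lborel (\<lambda>x. h x *\<^sub>R d\<phi> x)"
    proof (rule integrable_continuous_compact_support[OF _ S(1)])
      fix x assume "x \<notin> ?S" then show "h x *\<^sub>R d\<phi> x = 0" using R(5) by force
    qed (intro continuous_intros hc dc)
    have i2: "integrable lborel (\<lambda>x. \<phi> x *\<^sub>R g x)"
    proof (rule integrable_bounded_compact_support[OF _ S(1), of _ "M' * (DIM('b) * L)"])
      fix x assume "x \<in> ?S"
      then show "norm (\<phi> x *\<^sub>R g x) \<le> M' * (DIM('b) * L)" using M' gb[of x]
        by (simp add: mult_mono)
    next
      fix x assume "x \<notin> ?S" then show "\<phi> x *\<^sub>R g x = 0" using \<phi>S by force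
    qed measurable
    have "(LINT x:D|lebesgue. u x *\<^sub>R d\<phi> x) = (LINT x|lebesgue. h x *\<^sub>R d\<phi> x)"
      unfolding set_lebesgue_integral_def
    proof (rule Bochner_Integration.integral_cong[OF refl])
      fix x show "indicator D x *\<^sub>R u x *\<^sub>R d\<phi> x = h x *\<^sub>R d\<phi> x"
        using uh[of x] R(5)[of x] S(2) by (cases "x \<in> D") auto
    qed
    also have "\<dots> = (LINT x|lborel. h x *\<^sub>R d\<phi> x)" by (rule integral_completion) measurable
    also have "\<dots> = - (LINT x|lborel. \<phi> x *\<^sub>R g x)"
    proof (rule euclidean_eqI)
      fix e :: 'b assume e: "e \<in> Basis"
      have "(LINT x|lborel. h x *\<^sub>R d\<phi> x) \<bullet> e = (LINT x|lborel. h x * (d\<phi> x \<bullet> e))"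
        by (subst integral_inner_left[OF i1, symmetric]) simp
      also have "\<dots> = - (LINT x|lborel. \<phi> x * pd h e x)"
        by (rule lipschitz_integration_by_parts[OF lip tf])
      also have "(LINT x|lborel. \<phi> x * pd h e x) = (LINT x|lborel. (\<phi> x *\<^sub>R g x) \<bullet> e)"
        using e by (simp add: ge)
      also have "\<dots> = (LINT x|lborel. \<phi> x *\<^sub>R g x) \<bullet> e" by (rule integral_inner_left[OF i2])
      finally show "(LINT x|lborel. h x *\<^sub>R d\<phi> x) \<bullet> e = - (LINT x|lborel. \<phi> x *\<^sub>R g x) \<bullet> e" by simp
    qed
    also have "(LINT x|lborel. \<phi> x *\<^sub>R g x) = (LINT x|lebesgue. \<phi> x *\<^sub>R g x)"
      by (rule integral_completion[symmetric]) measurable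
    also have "\<dots> = (LINT x:D|lebesgue. \<phi> x *\<^sub>R g x)"
      unfolding set_lebesgue_integral_def
    proof (rule Bochner_Integration.integral_cong[OF refl])
      fix x show "\<phi> x *\<^sub>R g x = indicator D x *\<^sub>R \<phi> x *\<^sub>R g x"
        using \<phi>S[of x] S(2) by (cases "x \<in> D") auto
    qed
    finally show ?thesis .
  qed
  show ?thesis unfolding has_weak_gradient_def g_def[symmetric]
    by (intro conjI allI impI locu locg parts)
qed

lemma weak_grad_lipschitz_AE:
  fixes h :: "'b::euclidean_space \<Rightarrow> real"
  assumes D: "open D" and lip: "L-lipschitz_on UNIV h" and uh: "\<And>x. x \<in> D \<Longrightarrow> u x = h x"
  shows "AE x in lborel. x \<in> D \<longrightarrow> (\<forall>e\<in>Basis. weak_grad D u x \<bullet> e = pd h e x)"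
proof -
  note g = weak_gradient_lipschitz[OF lip uh]
  have "has_weak_gradient u (weak_grad D u) D"
    unfolding weak_grad_def by (rule someI[of "\<lambda>g. has_weak_gradient u g D", OF g])
  from weak_gradient_unique[OF D this g]
  have "AE x in lborel. x \<in> D \<longrightarrow> weak_grad D u x = (\<Sum>e\<in>Basis. pd h e x *\<^sub>R e)"
    by (simp add: AE_completion_iff)
  then show ?thesis by (rule eventually_mono) simp
qed

section \<open>Decreasing rearrangement of functions of one variable\<close>

text \<open>What a vertical section of a function in the class satisfies. The level \<open>c = 0\<close> is included because
  such a section vanishes far out.\<close>

definition profile :: "ereal \<Rightarrow> real \<Rightarrow> (real \<Rightarrow> real) \<Rightarrow> bool" where
  "profile \<alpha> M p \<longleftrightarrow> (\<forall>t\<in>ivl \<alpha>. 0 \<le> p t \<and> p t \<le> M) \<and> (\<forall>c\<ge>0. {t \<in> ivl \<alpha>. c < p t} \<in> lmeasurable)"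

definition level_meas :: "ereal \<Rightarrow> (real \<Rightarrow> real) \<Rightarrow> real \<Rightarrow> real" where
  "level_meas \<alpha> p c = measure lebesgue {t \<in> ivl \<alpha>. c < p t}"

definition rearr1 :: "ereal \<Rightarrow> (real \<Rightarrow> real) \<Rightarrow> real \<Rightarrow> real" where
  "rearr1 \<alpha> p y = (let C = {c. 0 < c \<and> 0 < y \<and> y < level_meas \<alpha> p c} in if C = {} then 0 else Sup C)"

lemma rearr_pt_eq: "rearr_pt \<alpha> u (x', y) = rearr1 \<alpha> (\<lambda>t. u (x', t)) y"
  by (simp add: rearr_pt_def rearr1_def set_star_def level_meas_def)

lemma level_meas_antimono:
  assumes "profile \<alpha> M p" "0 \<le> c" "c \<le> d"
  shows "level_meas \<alpha> p d \<le> level_meas \<alpha> p c"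
  unfolding level_meas_def
  by (rule measure_mono_fmeasurable) (use assms in \<open>auto simp: profile_def fmeasurableD\<close>)

text \<open>As \<open>c\<close> decreases to \<open>s\<close> the sets \<open>{c < p}\<close> increase to \<open>{s < p}\<close>.\<close>

lemma level_meas_right_cont:
  assumes p: "profile \<alpha> M p" and s: "0 \<le> s" and y: "y < level_meas \<alpha> p s"
  shows "\<exists>c>s. y < level_meas \<alpha> p c"
proof -
  define A where "A = (\<lambda>n::nat. {t \<in> ivl \<alpha>. s + 1 / Suc n < p t})"
  have A: "A n \<in> lmeasurable" for n unfolding A_def using p s by (auto simp: profile_def)
  have U: "(\<Union>n. A n) = {t \<in> ivl \<alpha>. s < p t}"
  proof (intro equalityI subsetI)
    fix t assume t: "t \<in> {t \<in> ivl \<alpha>. s < p t}"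
    then have "0 < p t - s" by simp
    then obtain n :: nat where "1 / Suc n < p t - s" using nat_approx_posE by blast
    then show "t \<in> (\<Union>n. A n)" using t by (auto simp: A_def algebra_simps intro!: exI[of _ n])
  next
    fix t assume "t \<in> (\<Union>n. A n)"
    then obtain n where n: "t \<in> ivl \<alpha>" "s + 1 / Suc n < p t" by (auto simp: A_def)
    have "0 < 1 / real (Suc n)" by simp
    then have "s < p t" using n(2) by linarith
    then show "t \<in> {t \<in> ivl \<alpha>. s < p t}" using n(1) by blast
  qed
  have "(\<lambda>n. measure lebesgue (A n)) \<longlonglongrightarrow> measure lebesgue (\<Union>n. A n)"
  proof (rule Lim_measure_incseq)
    show "range A \<subseteq> sets lebesgue" using A by (auto simp: fmeasurableD)
    show "incseq A"
    proof (rule incseq_SucI)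
      fix n
      have "1 / real (Suc (Suc n)) \<le> 1 / real (Suc n)" by (intro divide_left_mono) auto
      then show "A n \<le> A (Suc n)" unfolding A_def by (auto intro: le_less_trans[rotated])
    qed
    show "emeasure lebesgue (\<Union>n. A n) \<noteq> \<infinity>"
      unfolding U using p s fmeasurableD2[of "{t \<in> ivl \<alpha>. s < p t}" lebesgue] by (auto simp: profile_def)
  qed
  then have "(\<lambda>n. measure lebesgue (A n)) \<longlonglongrightarrow> level_meas \<alpha> p s" by (simp add: U level_meas_def)
  from order_tendstoD(1)[OF this y] obtain n where "y < measure lebesgue (A n)"
    by (auto simp: eventually_sequentially)
  then show ?thesis by (intro exI[of _ "s + 1 / Suc n"]) (auto simp: level_meas_def A_def add_strict_increasing)
qed

lemma level_meas_above: "profile \<alpha> M p \<Longrightarrow> M \<le> c \<Longrightarrow> level_meas \<alpha> p c = 0"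
proof -
  assume "profile \<alpha> M p" "M \<le> c"
  then have "{t \<in> ivl \<alpha>. c < p t} = {}" by (auto simp: profile_def not_less intro: order_trans)
  then show ?thesis unfolding level_meas_def by (simp only: measure_empty)
qed

text \<open>The rearrangement is the generalized inverse of the distribution function. Right continuity of the
  latter makes the strict inequalities equivalent; the order properties below are all read off from
  this equivalence.\<close>

lemma rearr1_gt_iff:
  assumes p: "profile \<alpha> M p" and y: "0 < y" and s: "0 \<le> s"
  shows "s < rearr1 \<alpha> p y \<longleftrightarrow> y < level_meas \<alpha> p s"
proof -
  define C where "C = {c. 0 < c \<and> 0 < y \<and> y < level_meas \<alpha> p c}"
  have r: "rearr1 \<alpha> p y = (if C = {} then 0 else Sup C)"
    unfolding rearr1_def C_def Let_def by (rule refl)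
  have bd: "bdd_above C"
  proof (rule bdd_aboveI)
    fix c assume "c \<in> C"
    then have "level_meas \<alpha> p c \<noteq> 0" by (auto simp: C_def)
    then show "c \<le> M" using level_meas_above[OF p, of c] by linarith
  qed
  show ?thesis
  proof
    assume gt: "s < rearr1 \<alpha> p y"
    then have ne: "C \<noteq> {}" using s r by auto
    then obtain c where c: "c \<in> C" "s < c" using gt r less_cSupE[of s C] by auto
    then show "y < level_meas \<alpha> p s"
      using level_meas_antimono[OF p s, of c] by (auto simp: C_def)
  next
    assume "y < level_meas \<alpha> p s"
    then obtain c where c: "c > s" "y < level_meas \<alpha> p c" using level_meas_right_cont[OF p s] by blast
    then have cC: "c \<in> C" using s y by (auto simp: C_def)
    then have "c \<le> Sup C" using bd by (rule cSup_upper)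
    then show "s < rearr1 \<alpha> p y" using c cC r by auto
  qed
qed

lemma rearr1_nonneg: "profile \<alpha> M p \<Longrightarrow> 0 \<le> rearr1 \<alpha> p y"
proof -
  assume p: "profile \<alpha> M p"
  define C where "C = {c. 0 < c \<and> 0 < y \<and> y < level_meas \<alpha> p c}"
  have bd: "bdd_above C"
  proof (rule bdd_aboveI)
    fix c assume "c \<in> C"
    then have "level_meas \<alpha> p c \<noteq> 0" by (auto simp: C_def)
    then show "c \<le> M" using level_meas_above[OF p, of c] by linarith
  qed
  have "0 \<le> Sup C" if "c \<in> C" for c
    using cSup_upper[OF that bd] that by (auto simp: C_def)
  then show ?thesis by (auto simp: rearr1_def C_def Let_def)
qed

lemma rearr1_le:
  assumes p: "profile \<alpha> M p" and y: "0 < y" and M: "0 \<le> M" shows "rearr1 \<alpha> p y \<le> M"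
  using rearr1_gt_iff[OF p y M] level_meas_above[OF p order_refl] y by linarith

lemma rearr1_antimono:
  assumes p: "profile \<alpha> M p" and y: "0 < y1" "y1 \<le> y2"
  shows "rearr1 \<alpha> p y2 \<le> rearr1 \<alpha> p y1"
proof (rule ccontr)
  assume "\<not> ?thesis"
  then have "rearr1 \<alpha> p y1 < rearr1 \<alpha> p y2" by simp
  then have "y2 < level_meas \<alpha> p (rearr1 \<alpha> p y1)"
    using rearr1_gt_iff[OF p _ rearr1_nonneg[OF p], of y2] y by auto
  then have "rearr1 \<alpha> p y1 < rearr1 \<alpha> p y1"
    using rearr1_gt_iff[OF p y(1) rearr1_nonneg[OF p], of y1] y(2) by linarith
  then show False by simp
qed

text \<open>If \<open>p \<le> q + \<delta>\<close> then \<open>{s + \<delta> < p}\<close> is contained in \<open>{s < q}\<close>. This gives the Lipschitz estimate in the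
  horizontal variables, where the sections move by at most \<open>L\<close> times the distance.\<close>

lemma rearr1_nonexpansive:
  assumes p: "profile \<alpha> M p" and q: "profile \<alpha> M' q" and y: "0 < y"
    and d: "\<And>t. t \<in> ivl \<alpha> \<Longrightarrow> p t \<le> q t + \<delta>" and \<delta>: "0 \<le> \<delta>"
  shows "rearr1 \<alpha> p y \<le> rearr1 \<alpha> q y + \<delta>"
proof (rule ccontr)
  define s where "s = rearr1 \<alpha> q y"
  have s: "0 \<le> s" unfolding s_def by (rule rearr1_nonneg[OF q])
  assume "\<not> ?thesis"
  then have "s + \<delta> < rearr1 \<alpha> p y" by (simp add: s_def)
  then have "y < level_meas \<alpha> p (s + \<delta>)" using rearr1_gt_iff[OF p y] s \<delta> by auto
  also have "\<dots> \<le> level_meas \<alpha> q s"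
    unfolding level_meas_def
  proof (rule measure_mono_fmeasurable)
    show "{t \<in> ivl \<alpha>. s + \<delta> < p t} \<subseteq> {t \<in> ivl \<alpha>. s < q t}"
    proof
      fix t assume "t \<in> {t \<in> ivl \<alpha>. s + \<delta> < p t}"
      then show "t \<in> {t \<in> ivl \<alpha>. s < q t}" using d[of t] by simp
    qed
    show "{t \<in> ivl \<alpha>. s + \<delta> < p t} \<in> sets lebesgue" "{t \<in> ivl \<alpha>. s < q t} \<in> lmeasurable"
      using p q s \<delta> by (auto simp: profile_def fmeasurableD)
  qed
  finally have "s < rearr1 \<alpha> q y" using rearr1_gt_iff[OF q y s] by auto
  then show False by (simp add: s_def)
qed

lemma level_meas_le: "ereal (level_meas \<alpha> p s) \<le> \<alpha>" if "0 < \<alpha>" "profile \<alpha> M p" "0 \<le> s"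
proof (cases \<alpha>)
  case (real a)
  have "level_meas \<alpha> p s \<le> measure lebesgue {0<..<a}"
    unfolding level_meas_def
    by (rule measure_mono_fmeasurable) (use that in \<open>auto simp: profile_def fmeasurableD ivl_def real\<close>)
  then show ?thesis using that real by simp
qed (use that in auto)

lemma rearr1_level_set:
  assumes "0 < \<alpha>" and p: "profile \<alpha> M p" and s: "0 \<le> s"
  shows "{y \<in> ivl \<alpha>. s < rearr1 \<alpha> p y} = {0<..<level_meas \<alpha> p s}"
proof (intro equalityI subsetI)
  fix y assume "y \<in> {y \<in> ivl \<alpha>. s < rearr1 \<alpha> p y}"
  then show "y \<in> {0<..<level_meas \<alpha> p s}" using rearr1_gt_iff[OF p _ s] by (auto simp: ivl_def)
next
  fix y assume y: "y \<in> {0<..<level_meas \<alpha> p s}"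
  then have "ereal y < ereal (level_meas \<alpha> p s)" by simp
  also have "\<dots> \<le> \<alpha>" by (rule level_meas_le[OF assms])
  finally show "y \<in> {y \<in> ivl \<alpha>. s < rearr1 \<alpha> p y}" using rearr1_gt_iff[OF p _ s] y by (auto simp: ivl_def)
qed

text \<open>Take the last point with value at least \<open>a\<close> and, after it, the first one with value at most \<open>b\<close>.\<close>

lemma crossing_right:
  fixes p :: "real \<Rightarrow> real"
  assumes c: "continuous_on {t1..t2} p" and t: "t1 \<le> t2" and p: "a \<le> p t1" "p t2 \<le> b" and ab: "b < a"
  obtains s1 s2 where "t1 \<le> s1" "s1 < s2" "s2 \<le> t2" "a \<le> p s1" "p s2 \<le> b"
    "\<And>t. s1 < t \<Longrightarrow> t < s2 \<Longrightarrow> b < p t \<and> p t < a"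
proof -
  define A where "A = {t \<in> {t1..t2}. a \<le> p t}"
  have "A = {t1..t2} \<inter> p -` {a..}" by (auto simp: A_def)
  then have "closed A" using continuous_closed_preimage[OF c closed_atLeastAtMost closed_atLeast, of a] by simp
  moreover have "bounded A" by (rule bounded_subset[OF bounded_closed_interval[of t1 t2]]) (auto simp: A_def)
  ultimately have "compact A" by (simp add: compact_eq_bounded_closed)
  moreover have "A \<noteq> {}" using p t by (auto simp: A_def)
  ultimately obtain s1 where s1: "s1 \<in> A" "\<And>t. t \<in> A \<Longrightarrow> t \<le> s1" using compact_attains_sup by metis
  define B where "B = {t \<in> {s1..t2}. p t \<le> b}"
  have c': "continuous_on {s1..t2} p" using c s1(1) by (auto simp: A_def intro: continuous_on_subset)
  have "B = {s1..t2} \<inter> p -` {..b}" by (auto simp: B_def)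
  then have "closed B" using continuous_closed_preimage[OF c' closed_atLeastAtMost closed_atMost, of b] by simp
  moreover have "bounded B" by (rule bounded_subset[OF bounded_closed_interval[of s1 t2]]) (auto simp: B_def)
  ultimately have "compact B" by (simp add: compact_eq_bounded_closed)
  moreover have "B \<noteq> {}" using p s1(1) by (auto simp: A_def B_def)
  ultimately obtain s2 where s2: "s2 \<in> B" "\<And>t. t \<in> B \<Longrightarrow> s2 \<le> t" using compact_attains_inf by metis
  have "s1 \<noteq> s2" using s1(1) s2(1) ab by (auto simp: A_def B_def)
  then have lt: "s1 < s2" using s2(1) by (auto simp: B_def)
  have "b < p t \<and> p t < a" if "s1 < t" "t < s2" for t
  proof -
    have t: "t \<in> {t1..t2}" "t \<in> {s1..t2}" using s1(1) s2(1) that by (auto simp: A_def B_def)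
    have "t \<notin> A" "t \<notin> B" using s1(2)[of t] s2(2)[of t] that by linarith+
    then show ?thesis using t by (simp add: A_def B_def)
  qed
  moreover have "t1 \<le> s1" "s2 \<le> t2" "a \<le> p s1" "p s2 \<le> b" using s1(1) s2(1) by (auto simp: A_def B_def)
  ultimately show ?thesis by (intro that[of s1 s2] lt)
qed

lemma crossing_length:
  fixes p :: "real \<Rightarrow> real"
  assumes lip: "L-lipschitz_on I p" and I: "is_interval I" and t: "t1 \<in> I" "t2 \<in> I"
    and p: "a \<le> p t1" "p t2 \<le> b" and ab: "b < a"
  obtains s1 s2 where "s1 < s2" "{s1..s2} \<subseteq> I" "a - b \<le> L * (s2 - s1)"
    "\<And>t. s1 < t \<Longrightarrow> t < s2 \<Longrightarrow> b < p t \<and> p t < a"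
proof -
  have sub: "{s..t} \<subseteq> I" if "s \<in> I" "t \<in> I" for s t
    using mem_is_interval_1_I[OF I that] by (metis atLeastAtMost_iff subsetI)
  have con: "continuous_on I p" using lip lipschitz_on_continuous_on by blast
  show ?thesis
  proof (cases "t1 \<le> t2")
    case True
    obtain s1 s2 where s: "t1 \<le> s1" "s1 < s2" "s2 \<le> t2" "a \<le> p s1" "p s2 \<le> b"
      "\<And>t. s1 < t \<Longrightarrow> t < s2 \<Longrightarrow> b < p t \<and> p t < a"
      by (rule crossing_right[OF continuous_on_subset[OF con sub[OF t]] True p ab]) (rule that)
    have sI: "{s1..s2} \<subseteq> I" using sub[OF t] s(1-3) by auto
    have "dist (p s1) (p s2) \<le> L * dist s1 s2" using sI s(2) by (intro lipschitz_onD[OF lip]) auto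
    then have "a - b \<le> L * (s2 - s1)" using s(2,4,5) by (simp add: dist_real_def)
    then show ?thesis by (rule that[OF s(2) sI _ s(6)])
  next
    case False
    define q where "q = (\<lambda>t. p (- t))"
    have cq: "continuous_on {-t1..-t2} q" unfolding q_def
      by (rule continuous_on_compose2[OF continuous_on_subset[OF con sub[OF t(2,1)]]]) (auto intro!: continuous_intros)
    have pq: "-t1 \<le> -t2" "a \<le> q (-t1)" "q (-t2) \<le> b" using False p by (auto simp: q_def)
    obtain s1 s2 where s: "-t1 \<le> s1" "s1 < s2" "s2 \<le> -t2" "a \<le> q s1" "q s2 \<le> b"
      "\<And>t. s1 < t \<Longrightarrow> t < s2 \<Longrightarrow> b < q t \<and> q t < a"
      by (rule crossing_right[OF cq pq ab]) (rule that)
    have sI: "{-s2..-s1} \<subseteq> I" using sub[OF t(2,1)] s(1-3) by auto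
    have "dist (p (-s1)) (p (-s2)) \<le> L * dist (-s1) (-s2)" using sI s(2) by (intro lipschitz_onD[OF lip]) auto
    then have "a - b \<le> L * (s2 - s1)" using s(2,4,5) by (simp add: dist_real_def q_def)
    moreover have "b < p t \<and> p t < a" if "- s2 < t" "t < - s1" for t
      using s(6)[of "-t"] that by (simp add: q_def)
    ultimately show ?thesis using s(2) sI by (intro that[of "-s2" "-s1"]) auto
  qed
qed

lemma is_interval_ivl: "is_interval (ivl \<alpha>)"
  unfolding is_interval_1
proof (intro ballI allI impI)
  fix a b t assume "a \<in> ivl \<alpha>" "b \<in> ivl \<alpha>" "a \<le> t \<and> t \<le> b"
  then show "t \<in> ivl \<alpha>" unfolding ivl_def using le_less_trans[of "ereal t" "ereal b" \<alpha>] by simp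
qed

text \<open>Suppose the drop from \<open>y1\<close> to \<open>y2\<close> exceeds \<open>L * (y2 - y1)\<close>. Then there are levels \<open>b < a\<close> with
  \<open>a - b > L * (y2 - y1)\<close> such that the set where \<open>b < p \<le> a\<close> has measure less than \<open>y2 - y1\<close>. But \<open>p\<close> has to
  cross from \<open>a\<close> to \<open>b\<close>, and it spends at least the length \<open>(a - b) / L\<close> in between.\<close>

lemma rearr1_lipschitz_decrease:
  assumes p: "profile \<alpha> M p" and lip: "L-lipschitz_on (ivl \<alpha>) p" and y: "0 < y1" "y1 < y2" "y2 \<in> ivl \<alpha>"
  shows "rearr1 \<alpha> p y1 \<le> rearr1 \<alpha> p y2 + L * (y2 - y1)"
proof (rule ccontr)
  define b where "b = rearr1 \<alpha> p y2"
  have L: "0 \<le> L" by (rule lipschitz_on_nonneg[OF lip])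
  have b: "0 \<le> b" unfolding b_def by (rule rearr1_nonneg[OF p])
  assume "\<not> ?thesis"
  then obtain a where a: "b + L * (y2 - y1) < a" "a < rearr1 \<alpha> p y1"
    using dense[of "b + L * (y2 - y1)" "rearr1 \<alpha> p y1"] unfolding b_def not_le by blast
  have ab: "b < a" using a(1) mult_nonneg_nonneg[OF L, of "y2 - y1"] y by linarith
  have ma: "y1 < level_meas \<alpha> p a" using rearr1_gt_iff[OF p y(1)] a ab b by auto
  have mb: "level_meas \<alpha> p b \<le> y2" using rearr1_gt_iff[OF p _ b, of y2] y by (auto simp: b_def)
  have fm: "{t \<in> ivl \<alpha>. c < p t} \<in> lmeasurable" if "c \<ge> 0" for c using p that by (auto simp: profile_def)
  obtain t1 where t1: "t1 \<in> ivl \<alpha>" "a < p t1"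
  proof (cases "{t \<in> ivl \<alpha>. a < p t} = {}")
    case True
    then have "level_meas \<alpha> p a = 0" unfolding level_meas_def by (simp only: measure_empty)
    then show ?thesis using ma y by simp
  qed (use that in blast)
  obtain t2 where t2: "t2 \<in> ivl \<alpha>" "p t2 \<le> b"
  proof (cases "\<exists>t\<in>ivl \<alpha>. p t \<le> b")
    case False
    \<comment> \<open>then \<open>{b < p}\<close> is the whole interval, which extends beyond \<open>y2\<close>\<close>
    then have eq: "{t \<in> ivl \<alpha>. b < p t} = ivl \<alpha>" by (auto simp: not_le)
    obtain y3 where y3: "y2 < y3" "y3 \<in> ivl \<alpha>"
    proof -
      have "ereal y2 < \<alpha>" using y(3) by (simp add: ivl_def)
      then obtain z where "ereal y2 < ereal z" "ereal z < \<alpha>" using ereal_dense2 by blast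
      then show ?thesis using that[of z] y by (auto simp: ivl_def)
    qed
    have sub: "{0<..<y3} \<subseteq> ivl \<alpha>"
    proof
      fix t assume "t \<in> {0<..<y3}"
      then show "t \<in> ivl \<alpha>" using y3(2) less_trans[of "ereal t" "ereal y3" \<alpha>] unfolding ivl_def by simp
    qed
    have "measure lebesgue {0<..<y3} \<le> level_meas \<alpha> p b"
      unfolding level_meas_def
    proof (rule measure_mono_fmeasurable)
      show "{0<..<y3} \<subseteq> {t \<in> ivl \<alpha>. b < p t}" using sub unfolding eq .
      show "{t \<in> ivl \<alpha>. b < p t} \<in> lmeasurable" by (rule fm[OF b])
    qed simp
    then have "y3 \<le> level_meas \<alpha> p b" using y3 y by simp
    then show ?thesis using mb y3(1) by linarith
  qed (use that in blast)
  obtain s1 s2 where s: "s1 < s2" "{s1..s2} \<subseteq> ivl \<alpha>" "a - b \<le> L * (s2 - s1)"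
    "\<And>t. s1 < t \<Longrightarrow> t < s2 \<Longrightarrow> b < p t \<and> p t < a"
    by (rule crossing_length[OF lip is_interval_ivl t1(1) t2(1) less_imp_le[OF t1(2)] t2(2) ab]) (rule that)
  have "0 \<le> a" using ab b by simp
  then have fa: "{t \<in> ivl \<alpha>. a < p t} \<in> lmeasurable" by (rule fm)
  have "measure lebesgue ({t \<in> ivl \<alpha>. a < p t} \<union> {s1<..<s2}) \<le> level_meas \<alpha> p b"
    unfolding level_meas_def
  proof (rule measure_mono_fmeasurable)
    show "{t \<in> ivl \<alpha>. a < p t} \<union> {s1<..<s2} \<subseteq> {t \<in> ivl \<alpha>. b < p t}"
    proof
      fix t assume "t \<in> {t \<in> ivl \<alpha>. a < p t} \<union> {s1<..<s2}"
      then consider "t \<in> ivl \<alpha>" "a < p t" | "s1 < t" "t < s2" by auto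
      then show "t \<in> {t \<in> ivl \<alpha>. b < p t}"
      proof cases
        case 1 then show ?thesis using ab by simp
      next
        case 2
        then have "t \<in> ivl \<alpha>" using s(2) by auto
        then show ?thesis using s(4)[OF 2] by simp
      qed
    qed
    show "{t \<in> ivl \<alpha>. b < p t} \<in> lmeasurable" by (rule fm[OF b])
    show "{t \<in> ivl \<alpha>. a < p t} \<union> {s1<..<s2} \<in> sets lebesgue"
      by (rule sets.Un[OF fmeasurableD[OF fa]]) simp
  qed
  moreover have "measure lebesgue ({t \<in> ivl \<alpha>. a < p t} \<union> {s1<..<s2}) = level_meas \<alpha> p a + (s2 - s1)"
  proof -
    have "\<not> a < p t" if "t \<in> {s1<..<s2}" for t using s(4)[of t] that by simp
    then have dis: "{t \<in> ivl \<alpha>. a < p t} \<inter> {s1<..<s2} = {}" by blast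
    have "measure lebesgue ({t \<in> ivl \<alpha>. a < p t} \<union> {s1<..<s2})
        = measure lebesgue {t \<in> ivl \<alpha>. a < p t} + measure lebesgue {s1<..<s2}"
    proof (rule measure_Union)
      show "emeasure lebesgue {t \<in> ivl \<alpha>. a < p t} \<noteq> \<infinity>" using fmeasurableD2[OF fa] by simp
      show "{t \<in> ivl \<alpha>. a < p t} \<in> sets lebesgue" by (rule fmeasurableD[OF fa])
    qed (use s(1) dis in simp_all)
    then show ?thesis using s(1) by (simp add: level_meas_def)
  qed
  ultimately have "s2 - s1 < y2 - y1" using ma mb by linarith
  then have "L * (s2 - s1) \<le> L * (y2 - y1)" using L by (intro mult_left_mono) auto
  then show False using s(3) a(1) by linarith
qed

section \<open>The rearrangement of a Lipschitz function with compact support\<close>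

lemma closure_cyl: "closure (cyl \<alpha> \<Omega>) = closure \<Omega> \<times> closure (ivl \<alpha>)"
  by (simp add: cyl_def closure_Times)

lemma open_ivl: "open (ivl \<alpha>)"
proof -
  have eq: "ivl \<alpha> = {0<..} \<inter> ereal -` {..<\<alpha>}" by (auto simp: ivl_def)
  have "open (ereal -` {..<\<alpha>})"
    by (rule open_vimage[OF open_lessThan]) (simp add: continuous_on_ereal)
  then show ?thesis unfolding eq by (rule open_Int[OF open_greaterThan])
qed

lemma open_cyl: "open \<Omega> \<Longrightarrow> open (cyl \<alpha> \<Omega>)"
  by (simp add: cyl_def open_Times open_ivl)

text \<open>Bounds that hold for all vertical sections simultaneously.\<close>

lemma L_class_facts:
  fixes \<Omega>' :: "'a::euclidean_space set"
  assumes u: "u \<in> L_class \<alpha> \<Omega>'"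
  obtains L R M where "L-lipschitz_on (closure (cyl \<alpha> \<Omega>')) u" "0 < R" "0 \<le> M"
    "\<And>x t. (x, t) \<in> cyl \<alpha> \<Omega>' \<Longrightarrow> R < t \<Longrightarrow> u (x, t) = 0"
    "\<And>x. x \<in> cyl \<alpha> \<Omega>' \<Longrightarrow> 0 \<le> u x \<and> u x \<le> M"
    "\<And>x. x \<in> \<Omega>' \<Longrightarrow> profile \<alpha> M (\<lambda>t. u (x, t))"
proof -
  define Q where "Q = closure (cyl \<alpha> \<Omega>')"
  obtain L where L: "L-lipschitz_on Q u" using u by (auto simp: L_class_def Q_def)
  have pos: "0 \<le> u x" if "x \<in> Q" for x using u that by (auto simp: L_class_def S_class_def Q_def)
  define S where "S = closure {x \<in> Q. u x \<noteq> 0}"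
  have S: "compact S" using u by (auto simp: L_class_def S_def Q_def)
  have SQ: "S \<subseteq> Q" unfolding S_def Q_def by (rule closure_minimal) auto
  have inS: "x \<in> S" if "x \<in> Q" "u x \<noteq> 0" for x
    using that closure_subset[of "{x \<in> Q. u x \<noteq> 0}"] by (auto simp: S_def)
  have CQ: "cyl \<alpha> \<Omega>' \<subseteq> Q" unfolding Q_def by (rule closure_subset)
  obtain R where R: "R > 0" "\<And>x. x \<in> S \<Longrightarrow> norm x \<le> R"
    using compact_imp_bounded[OF S] unfolding bounded_pos by blast
  have "bounded (u ` S)"
    using compact_continuous_image[OF continuous_on_subset[OF lipschitz_on_continuous_on[OF L] SQ] S]
    by (rule compact_imp_bounded)
  then obtain M where M: "M > 0" "\<And>x. x \<in> S \<Longrightarrow> \<bar>u x\<bar> \<le> M" unfolding bounded_pos by auto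
  have le: "u x \<le> M" if "x \<in> Q" for x using M(2)[of x] M(1) inS[OF that] by (cases "u x = 0") auto
  have zero: "u (x, t) = 0" if "(x, t) \<in> cyl \<alpha> \<Omega>'" "R < t" for x t
  proof (rule ccontr)
    assume "u (x, t) \<noteq> 0"
    then have "norm (x, t) \<le> R" using inS[of "(x, t)"] that CQ R(2) by blast
    moreover have "\<bar>t\<bar> \<le> norm (x, t)" using norm_snd_le[of t x] by simp
    ultimately show False using that(2) by simp
  qed
  have prof: "profile \<alpha> M (\<lambda>t. u (x, t))" if x: "x \<in> \<Omega>'" for x
    unfolding profile_def
  proof (intro conjI ballI allI impI)
    fix t assume "t \<in> ivl \<alpha>"
    then have xt: "(x, t) \<in> Q" using x CQ by (auto simp: cyl_def)
    show "0 \<le> u (x, t)" "u (x, t) \<le> M" using pos[OF xt] le[OF xt] by auto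
  next
    fix c :: real assume c: "0 \<le> c"
    have con: "continuous_on (ivl \<alpha>) (\<lambda>t. u (x, t))"
      by (rule continuous_on_compose2[OF lipschitz_on_continuous_on[OF L]])
         (use CQ x in \<open>auto simp: cyl_def intro!: continuous_intros\<close>)
    have "open {t \<in> ivl \<alpha>. c < u (x, t)}"
      using continuous_open_preimage[OF con open_ivl, of "{c<..}"] by (simp add: vimage_def Int_def)
    moreover have "{t \<in> ivl \<alpha>. c < u (x, t)} \<subseteq> {0..R}"
    proof
      fix t assume t: "t \<in> {t \<in> ivl \<alpha>. c < u (x, t)}"
      then have "\<not> R < t" using zero[of x t] x c by (auto simp: cyl_def)
      then show "t \<in> {0..R}" using t by (auto simp: ivl_def)
    qed
    then have "bounded {t \<in> ivl \<alpha>. c < u (x, t)}" by (rule bounded_subset[OF bounded_closed_interval])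
    ultimately show "{t \<in> ivl \<alpha>. c < u (x, t)} \<in> lmeasurable" by (rule lmeasurable_open[rotated])
  qed
  have "0 \<le> u x \<and> u x \<le> M" if "x \<in> cyl \<alpha> \<Omega>'" for x
    using pos[of x] le[of x] subsetD[OF CQ that] by simp
  then show ?thesis
    using L R(1) M(1) zero prof by (intro that[of L R M]) (simp_all add: Q_def)
qed

lemma lipschitz_sectionI:
  assumes L: "L-lipschitz_on (closure (cyl \<alpha> \<Omega>')) u" and x: "x \<in> \<Omega>'"
  shows "L-lipschitz_on (ivl \<alpha>) (\<lambda>t. u (x, t))"
proof (rule lipschitz_onI)
  fix s t assume "s \<in> ivl \<alpha>" "t \<in> ivl \<alpha>"
  then have "(x, s) \<in> closure (cyl \<alpha> \<Omega>')" "(x, t) \<in> closure (cyl \<alpha> \<Omega>')"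
    using x closure_subset[of "cyl \<alpha> \<Omega>'"] by (auto simp: cyl_def)
  from lipschitz_onD[OF L this] show "dist (u (x, s)) (u (x, t)) \<le> L * dist s t"
    by (simp add: dist_Pair_Pair)
qed (rule lipschitz_on_nonneg[OF L])

lemma rearr_pt_lipschitz:
  fixes \<Omega>' :: "'a::euclidean_space set"
  assumes L: "L-lipschitz_on (closure (cyl \<alpha> \<Omega>')) u"
    and prof: "\<And>x. x \<in> \<Omega>' \<Longrightarrow> profile \<alpha> M (\<lambda>t. u (x, t))"
  shows "(2 * L)-lipschitz_on (cyl \<alpha> \<Omega>') (rearr_pt \<alpha> u)"
proof (rule lipschitz_onI)
  have L0: "0 \<le> L" by (rule lipschitz_on_nonneg[OF L])
  then show "0 \<le> 2 * L" by simp
  have xdir: "rearr_pt \<alpha> u (x1, y) \<le> rearr_pt \<alpha> u (x2, y) + L * dist x1 x2"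
    if x: "x1 \<in> \<Omega>'" "x2 \<in> \<Omega>'" and y: "y \<in> ivl \<alpha>" for x1 x2 y
    unfolding rearr_pt_eq
  proof (rule rearr1_nonexpansive[OF prof[OF x(1)] prof[OF x(2)]])
    show "0 < y" using y by (simp add: ivl_def)
    show "0 \<le> L * dist x1 x2" using L0 by simp
    fix t assume "t \<in> ivl \<alpha>"
    then have "(x1, t) \<in> closure (cyl \<alpha> \<Omega>')" "(x2, t) \<in> closure (cyl \<alpha> \<Omega>')"
      using x closure_subset[of "cyl \<alpha> \<Omega>'"] by (auto simp: cyl_def)
    from lipschitz_onD[OF L this] show "u (x1, t) \<le> u (x2, t) + L * dist x1 x2"
      by (simp add: dist_Pair_Pair dist_real_def)
  qed
  have ydir: "\<bar>rearr_pt \<alpha> u (x, y1) - rearr_pt \<alpha> u (x, y2)\<bar> \<le> L * (y2 - y1)"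
    if x: "x \<in> \<Omega>'" and y: "y1 \<in> ivl \<alpha>" "y2 \<in> ivl \<alpha>" "y1 \<le> y2" for x y1 y2
  proof (cases "y1 = y2")
    case False
    have y0: "0 < y1" "y1 < y2" using y False by (auto simp: ivl_def)
    show ?thesis unfolding rearr_pt_eq
      using rearr1_antimono[OF prof[OF x] y0(1) y(3)]
        rearr1_lipschitz_decrease[OF prof[OF x] lipschitz_sectionI[OF L x] y0 y(2)] by linarith
  qed simp
  fix a b assume ab: "a \<in> cyl \<alpha> \<Omega>'" "b \<in> cyl \<alpha> \<Omega>'"
  obtain x1 y1 x2 y2 where e: "a = (x1, y1)" "b = (x2, y2)" by fastforce
  have m: "x1 \<in> \<Omega>'" "x2 \<in> \<Omega>'" "y1 \<in> ivl \<alpha>" "y2 \<in> ivl \<alpha>" using ab e by (auto simp: cyl_def)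
  have 1: "\<bar>rearr_pt \<alpha> u (x1, y1) - rearr_pt \<alpha> u (x2, y1)\<bar> \<le> L * dist x1 x2"
    using xdir[OF m(1,2,3)] xdir[OF m(2,1,3)] by (simp add: dist_commute abs_le_iff)
  have 2: "\<bar>rearr_pt \<alpha> u (x2, y1) - rearr_pt \<alpha> u (x2, y2)\<bar> \<le> L * dist y1 y2"
    using ydir[OF m(2,3,4)] ydir[OF m(2,4,3)] by (cases "y1 \<le> y2") (auto simp: dist_real_def abs_minus_commute)
  have "dist x1 x2 \<le> dist a b" "dist y1 y2 \<le> dist a b"
    using dist_fst_le[of a b] dist_snd_le[of a b] e by auto
  then have "L * dist x1 x2 \<le> L * dist a b" "L * dist y1 y2 \<le> L * dist a b"
    using L0 by (auto intro: mult_left_mono)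
  then show "dist (rearr_pt \<alpha> u a) (rearr_pt \<alpha> u b) \<le> 2 * L * dist a b"
    using 1 2 unfolding e dist_real_def by linarith
qed

text \<open>The pointwise rearrangement is Lipschitz on the cylinder and extends to a Lipschitz function on
  the closure; its limits are the values that \<open>rearr\<close> takes there. If \<open>u(x', \<cdot>)\<close> vanishes beyond \<open>R\<close>, then
  its positivity set has measure at most \<open>R\<close>, so the rearrangement vanishes beyond \<open>R\<close> as well.\<close>

lemma rearr_L_class:
  fixes \<Omega>' :: "'a::euclidean_space set"
  assumes \<alpha>: "0 < \<alpha>" and \<Omega>: "open \<Omega>'" "bounded \<Omega>'" and u: "u \<in> L_class \<alpha> \<Omega>'"
  shows "rearr \<alpha> \<Omega>' u \<in> L_class \<alpha> \<Omega>'"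
proof -
  obtain L R M where L: "L-lipschitz_on (closure (cyl \<alpha> \<Omega>')) u" and R: "0 < R" and M: "0 \<le> M"
    and zero: "\<And>x t. (x, t) \<in> cyl \<alpha> \<Omega>' \<Longrightarrow> R < t \<Longrightarrow> u (x, t) = 0"
    and prof: "\<And>x. x \<in> \<Omega>' \<Longrightarrow> profile \<alpha> M (\<lambda>t. u (x, t))"
    by (rule L_class_facts[OF u]) blast
  define Q where "Q = closure (cyl \<alpha> \<Omega>')"
  have CQ: "cyl \<alpha> \<Omega>' \<subseteq> Q" unfolding Q_def by (rule closure_subset)
  obtain g where g: "(2 * L)-lipschitz_on Q g" "\<And>x. x \<in> cyl \<alpha> \<Omega>' \<Longrightarrow> g x = rearr_pt \<alpha> u x"
    using lipschitz_extend_closure[OF rearr_pt_lipschitz[OF L prof]] unfolding Q_def by blast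
  have gc: "continuous_on Q g" using g(1) lipschitz_on_continuous_on by blast
  have eq: "rearr \<alpha> \<Omega>' u x = g x" if x: "x \<in> Q" for x
  proof (cases "x \<in> cyl \<alpha> \<Omega>'")
    case False
    have "(g \<longlongrightarrow> g x) (at x within Q)" using gc x by (simp add: continuous_on_def)
    then have "(g \<longlongrightarrow> g x) (at x within cyl \<alpha> \<Omega>')" using CQ by (rule tendsto_within_subset)
    then have lim: "(rearr_pt \<alpha> u \<longlongrightarrow> g x) (at x within cyl \<alpha> \<Omega>')"
    proof (rule Lim_transform_eventually)
      show "\<forall>\<^sub>F y in at x within cyl \<alpha> \<Omega>'. g y = rearr_pt \<alpha> u y"
        unfolding eventually_at_filter by (intro always_eventually) (simp add: g(2))
    qed
    have "x islimpt cyl \<alpha> \<Omega>'" using x False unfolding Q_def closure_def by simp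
    then have "\<not> trivial_limit (at x within cyl \<alpha> \<Omega>')" by (simp add: trivial_limit_within)
    then show ?thesis unfolding rearr_def using False tendsto_Lim[OF _ lim] by simp
  qed (simp add: rearr_def g(2))
  have lip: "(2 * L)-lipschitz_on Q (rearr \<alpha> \<Omega>' u)"
    by (rule lipschitz_on_transform[OF g(1)]) (simp add: eq)
  have con: "continuous_on Q (rearr \<alpha> \<Omega>' u)" using lip lipschitz_on_continuous_on by blast
  have Qm: "Q \<in> sets lebesgue" unfolding Q_def by simp
  have meas: "rearr \<alpha> \<Omega>' u \<in> borel_measurable (lebesgue_on Q)"
    by (rule continuous_imp_measurable_on_sets_lebesgue[OF con Qm])
  have pos: "0 \<le> rearr \<alpha> \<Omega>' u x" if "x \<in> Q" for x
  proof (rule continuous_ge_on_closure[of "cyl \<alpha> \<Omega>'" "rearr \<alpha> \<Omega>' u" x 0])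
    show "continuous_on (closure (cyl \<alpha> \<Omega>')) (rearr \<alpha> \<Omega>' u)" using con by (simp add: Q_def)
    show "x \<in> closure (cyl \<alpha> \<Omega>')" using that by (simp add: Q_def)
    fix z assume z: "z \<in> cyl \<alpha> \<Omega>'"
    then show "0 \<le> rearr \<alpha> \<Omega>' u z"
      using rearr1_nonneg[OF prof] by (cases z) (auto simp: rearr_def rearr_pt_eq cyl_def)
  qed
  have van: "rearr \<alpha> \<Omega>' u (x, t) = 0" if xt: "(x, t) \<in> cyl \<alpha> \<Omega>'" and t: "R < t" for x t
  proof -
    have x: "x \<in> \<Omega>'" and ti: "t \<in> ivl \<alpha>" using xt by (auto simp: cyl_def)
    have "level_meas \<alpha> (\<lambda>t. u (x, t)) 0 \<le> measure lebesgue {0..R}"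
      unfolding level_meas_def
    proof (rule measure_mono_fmeasurable)
      show "{s \<in> ivl \<alpha>. 0 < u (x, s)} \<subseteq> {0..R}"
      proof
        fix s assume s: "s \<in> {s \<in> ivl \<alpha>. 0 < u (x, s)}"
        then have "\<not> R < s" using zero[of x s] x by (auto simp: cyl_def)
        then show "s \<in> {0..R}" using s by (auto simp: ivl_def)
      qed
      show "{s \<in> ivl \<alpha>. 0 < u (x, s)} \<in> sets lebesgue" using prof[OF x] by (auto simp: profile_def fmeasurableD)
    qed simp
    then have "\<not> t < level_meas \<alpha> (\<lambda>t. u (x, t)) 0" using t R by simp
    then have "\<not> 0 < rearr1 \<alpha> (\<lambda>t. u (x, t)) t"
      using rearr1_gt_iff[OF prof[OF x], of t 0] ti by (simp add: ivl_def)
    then show ?thesis using rearr1_nonneg[OF prof[OF x], of t] xt by (simp add: rearr_def rearr_pt_eq)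
  qed
  have slices: "{y \<in> ivl \<alpha>. c < rearr \<alpha> \<Omega>' u (x, y)} \<in> lmeasurable" if x: "x \<in> \<Omega>'" and c: "c > 0" for x c
  proof -
    have "{y \<in> ivl \<alpha>. c < rearr \<alpha> \<Omega>' u (x, y)} = {y \<in> ivl \<alpha>. c < rearr1 \<alpha> (\<lambda>t. u (x, t)) y}"
      using x by (auto simp: rearr_def rearr_pt_eq cyl_def)
    also have "\<dots> = {0<..<level_meas \<alpha> (\<lambda>t. u (x, t)) c}"
      using rearr1_level_set[OF \<alpha> prof[OF x]] c by simp
    finally show ?thesis by simp
  qed
  have supp: "compact (closure {x \<in> Q. rearr \<alpha> \<Omega>' u x \<noteq> 0})"
  proof -
    \<comment> \<open>\<open>R + 1\<close> leaves room to approach boundary points from inside the region where \<open>u\<^sup>*\<close> vanishes\<close>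
    have "rearr \<alpha> \<Omega>' u (x, t) = 0" if xt: "(x, t) \<in> Q" and t: "R + 1 < t" for x t
    proof -
      let ?T = "cyl \<alpha> \<Omega>' \<inter> {z. R < snd z}"
      have o: "open {z :: 'a \<times> real. R < snd z}" by (intro open_Collect_less continuous_intros)
      have "(x, t) \<in> closure ?T"
        using open_Int_closure_subset[OF o, of "cyl \<alpha> \<Omega>'"] xt t by (auto simp: Q_def Int_commute)
      moreover have "closure ?T \<subseteq> Q" unfolding Q_def by (intro closure_mono) auto
      ultimately show ?thesis
        using continuous_constant_on_closure[of ?T "rearr \<alpha> \<Omega>' u" 0 "(x, t)"]
          continuous_on_subset[OF con] van by force
    qed
    then have "{x \<in> Q. rearr \<alpha> \<Omega>' u x \<noteq> 0} \<subseteq> closure \<Omega>' \<times> {0..R + 1}"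
      unfolding Q_def closure_cyl
    proof (safe, goal_cases)
      case (1 x t)
      have "closure (ivl \<alpha>) \<subseteq> {0..}" by (rule closure_minimal) (auto simp: ivl_def)
      then have "0 \<le> t" using 1 by auto
      moreover have "\<not> R + 1 < t" using 1 by blast
      ultimately show ?case by simp
    qed
    then have "bounded {x \<in> Q. rearr \<alpha> \<Omega>' u x \<noteq> 0}"
      using bounded_Times[OF bounded_closure[OF \<Omega>(2)] bounded_closed_interval[of 0 "R+1"]] bounded_subset by blast
    then show ?thesis by (simp add: compact_closure)
  qed
  show ?thesis
    unfolding L_class_def S_class_def using meas pos slices lip supp unfolding Q_def by auto
qed

section \<open>A coarea inequality on the line\<close>

text \<open>The change of variables formula on \<open>real^1\<close>, transported to the line.\<close>

lemma differentiable_image_measure_le: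
  fixes p dp :: "real \<Rightarrow> real"
  assumes der: "\<And>t. t \<in> S \<Longrightarrow> (p has_real_derivative dp t) (at t)"
    and int: "(\<lambda>t. \<bar>dp t\<bar>) integrable_on S"
  shows "p ` S \<in> lmeasurable" "measure lebesgue (p ` S) \<le> integral S (\<lambda>t. \<bar>dp t\<bar>)"
proof -
  let ?lift = "vec :: real \<Rightarrow> real^1"
  let ?drop = "(\<lambda>x::real^1. x $ 1)"
  have "((\<lambda>x. vec (p (x $ 1))) has_derivative (*\<^sub>R) (dp z)) (at (vec z) within ?lift ` S)"
    if "z \<in> S" for z
    using has_field_derivative_at_within[OF der[OF that], of S]
    by (simp add: has_real_derivative_iff_has_vector_derivative has_vector_derivative_def has_derivative_vector_1)
  then have der': "\<And>x. x \<in> ?lift ` S \<Longrightarrow>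
        (?lift \<circ> p \<circ> ?drop has_derivative (*\<^sub>R) (dp (?drop x))) (at x within ?lift ` S)"
    by (auto simp: o_def)
  have eq: "(\<lambda>x. \<bar>det (matrix ((*\<^sub>R) (dp (?drop x)) :: real^1 \<Rightarrow> real^1))\<bar>) = (\<lambda>x. \<bar>dp (?drop x)\<bar>)"
    by (simp add: fun_eq_iff)
  have drop: "?drop ` ?lift ` A = A" for A :: "real set" by (simp add: image_comp o_def)
  have "(\<lambda>t. \<bar>dp t\<bar>) absolutely_integrable_on S" using int by (simp add: absolutely_integrable_on_iff_nonneg)
  then have "(\<lambda>x. \<bar>dp (?drop x)\<bar>) absolutely_integrable_on ?lift ` S"
    by (simp add: absolutely_integrable_drop drop o_def)
  then have int': "(\<lambda>x. \<bar>det (matrix ((*\<^sub>R) (dp (?drop x)) :: real^1 \<Rightarrow> real^1))\<bar> * 1) absolutely_integrable_on ?lift ` S"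
    unfolding eq by simp
  have im: "(?lift \<circ> p \<circ> ?drop) ` ?lift ` S = ?lift ` p ` S" by (auto simp: image_comp o_def)
  have 1: "(\<lambda>_. 1::real) absolutely_integrable_on ?lift ` p ` S"
    using absolutely_integrable_on_image_real[of "?lift ` S" "?lift \<circ> p \<circ> ?drop" "\<lambda>x. (*\<^sub>R) (dp (?drop x))" "\<lambda>_. 1", OF der' int']
    unfolding im .
  have 2: "integral (?lift ` p ` S) (\<lambda>_. 1::real) \<le> integral (?lift ` S) (\<lambda>x. \<bar>det (matrix ((*\<^sub>R) (dp (?drop x)) :: real^1 \<Rightarrow> real^1))\<bar> * 1)"
    using integral_on_image_ubound[of "?lift ` S" "\<lambda>_. 1" "?lift \<circ> p \<circ> ?drop" "\<lambda>x. (*\<^sub>R) (dp (?drop x))", OF _ der' set_lebesgue_integral_eq_integral(1)[OF int']]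
    unfolding im by simp
  have "(\<lambda>_. 1::real) absolutely_integrable_on p ` S"
    using 1 unfolding absolutely_integrable_drop drop by (simp add: o_def)
  then show m: "p ` S \<in> lmeasurable"
    using set_lebesgue_integral_eq_integral(1) lmeasurable_iff_integrable_on by blast
  show "measure lebesgue (p ` S) \<le> integral S (\<lambda>t. \<bar>dp t\<bar>)"
    using 2 unfolding eq integral_vec1_eq drop by (simp add: o_def lmeasure_integral[OF m])
qed

text \<open>The null set where \<open>p\<close> is not differentiable has a null image, since \<open>p\<close> is Lipschitz.\<close>

lemma lipschitz_image_emeasure_le:
  fixes p dp :: "real \<Rightarrow> real"
  assumes lip: "L-lipschitz_on UNIV p" and T: "T \<in> sets borel" "bounded T"
    and dp[measurable]: "dp \<in> borel_measurable borel" and bnd: "\<And>t. \<bar>dp t\<bar> \<le> L"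
    and der: "AE t in lborel. (p has_real_derivative dp t) (at t)"
  shows "p ` T \<in> sets lebesgue" "emeasure lebesgue (p ` T) \<le> (\<integral>\<^sup>+t. ennreal \<bar>dp t\<bar> * indicator T t \<partial>lborel)"
proof -
  note T(1)[measurable]
  obtain N where N: "N \<in> null_sets lborel" "{t. \<not> (p has_real_derivative dp t) (at t)} \<subseteq> N"
    using der unfolding eventually_ae_filter by auto
  have Nb[measurable]: "N \<in> sets borel" using N(1) by (simp add: null_sets_def)
  define S where "S = T - N"
  have Sb[measurable]: "S \<in> sets borel" unfolding S_def by measurable
  have Sbd: "bounded S" using T(2) unfolding S_def by (rule bounded_subset) auto
  have SD: "(p has_real_derivative dp t) (at t)" if "t \<in> S" for t using that N(2) by (auto simp: S_def)
  have fin: "emeasure lborel S < \<infinity>" by (rule emeasure_bounded_finite[OF Sbd])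
  have "integrable lborel (\<lambda>t. \<bar>dp t\<bar> * indicator S t)"
  proof (rule Bochner_Integration.integrable_bound)
    show "integrable lborel (\<lambda>t. L * indicator S t :: real)"
      using fin by (intro integrable_mult_right integrable_real_indicator) auto
    show "AE t in lborel. norm (\<bar>dp t\<bar> * indicator S t) \<le> norm (L * indicator S t)"
    proof (intro always_eventually allI)
      fix t show "norm (\<bar>dp t\<bar> * indicator S t) \<le> norm (L * indicator S t)"
        using bnd[of t] by (cases "t \<in> S") auto
    qed
  qed measurable
  then have nn: "(\<integral>\<^sup>+t. ennreal (\<bar>dp t\<bar> * indicator S t) \<partial>lborel) = ennreal (LINT t|lborel. \<bar>dp t\<bar> * indicator S t)"
    and hi: "((\<lambda>t. \<bar>dp t\<bar> * indicator S t) has_integral (LINT t|lborel. \<bar>dp t\<bar> * indicator S t)) UNIV"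
    by (auto intro!: nn_integral_eq_integral has_integral_integral_lborel)
  have "(\<lambda>t. \<bar>dp t\<bar> * indicator S t) = (\<lambda>t. if t \<in> S then \<bar>dp t\<bar> else 0)" by auto
  with hi have hiS: "((\<lambda>t. \<bar>dp t\<bar>) has_integral (LINT t|lborel. \<bar>dp t\<bar> * indicator S t)) S"
    by (simp only: has_integral_restrict_UNIV)
  have ints: "(\<lambda>t. \<bar>dp t\<bar>) integrable_on S" using hiS by (rule has_integral_integrable)
  note im = differentiable_image_measure_le[OF SD ints]
  have "negligible (T \<inter> N)"
    using N(1) by (intro negligible_subset[of N "T \<inter> N"]) (auto simp: negligible_iff_null_sets null_sets_completionI)
  then have negl: "negligible (p ` (T \<inter> N))"
  proof (rule negligible_locally_Lipschitz_image[rotated])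
    fix x assume "x \<in> T \<inter> N"
    have "norm (p y - p x) \<le> L * norm (y - x)" for y
      using lipschitz_onD[OF lip, of y x] by (simp add: dist_norm)
    then show "\<exists>U B. open U \<and> x \<in> U \<and> (\<forall>y\<in>T \<inter> N \<inter> U. norm (p y - p x) \<le> B * norm (y - x))"
      by (intro exI[of _ UNIV] exI[of _ L]) simp
  qed simp
  have un: "p ` T = p ` S \<union> p ` (T \<inter> N)" unfolding S_def by auto
  show "p ` T \<in> sets lebesgue" unfolding un
    using im(1) negl by (intro sets.Un fmeasurableD negligible_imp_sets)
  have "emeasure lebesgue (p ` T) \<le> emeasure lebesgue (p ` S) + emeasure lebesgue (p ` (T \<inter> N))"
    unfolding un using im(1) negl by (intro emeasure_subadditive fmeasurableD negligible_imp_sets)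
  also have "emeasure lebesgue (p ` (T \<inter> N)) = 0" using negl
    by (simp only: negligible_iff_null_sets null_setsD1)
  also have "emeasure lebesgue (p ` S) = ennreal (measure lebesgue (p ` S))" using im(1) by (rule emeasure_eq_measure2)
  also have "ennreal (measure lebesgue (p ` S)) + 0 \<le> ennreal (LINT t|lborel. \<bar>dp t\<bar> * indicator S t)"
    using im(2) integral_unique[OF hiS] by (simp add: ennreal_leI)
  also have "\<dots> = (\<integral>\<^sup>+t. ennreal (\<bar>dp t\<bar> * indicator S t) \<partial>lborel)" by (rule nn[symmetric])
  also have "\<dots> \<le> (\<integral>\<^sup>+t. ennreal \<bar>dp t\<bar> * indicator T t \<partial>lborel)"
    by (intro nn_integral_mono) (auto simp: S_def split: split_indicator)
  finally show "emeasure lebesgue (p ` T) \<le> (\<integral>\<^sup>+t. ennreal \<bar>dp t\<bar> * indicator T t \<partial>lborel)" .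
qed

lemma DERIV_const_left:
  assumes "(q has_real_derivative D) (at t)" "s < t" "\<And>r. s \<le> r \<Longrightarrow> r \<le> t \<Longrightarrow> q r = q t"
  shows "D = 0"
proof -
  have "((\<lambda>y. (q y - q t) / (y - t)) \<longlongrightarrow> D) (at t)" using assms(1) by (simp add: has_field_derivative_iff)
  then have "((\<lambda>y. (q y - q t) / (y - t)) \<longlongrightarrow> D) (at_left t)" by (rule tendsto_within_subset) simp
  moreover have "((\<lambda>y. (q y - q t) / (y - t)) \<longlongrightarrow> 0) (at_left t)"
  proof (rule tendsto_eventually)
    show "\<forall>\<^sub>F y in at_left t. (q y - q t) / (y - t) = 0"
      unfolding eventually_at_left_field
    proof (intro exI[of _ s] conjI allI impI)
      fix y assume "s < y" "y < t"
      then have "q y = q t" by (intro assms(3)) simp_all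
      then show "(q y - q t) / (y - t) = 0" by simp
    qed (rule assms(2))
  qed
  ultimately show ?thesis using tendsto_unique[OF trivial_limit_at_left_real] by blast
qed

text \<open>Half-open cells of length \<open>1 / (n + 1)\<close>; the first \<open>K * (n + 1)\<close> of them partition \<open>{0<..K}\<close>.\<close>

definition cell :: "nat \<Rightarrow> nat \<Rightarrow> real set" where
  "cell n k = {real k / Suc n<..real (Suc k) / Suc n}"

lemma cell_disjoint: "t \<in> cell n k \<Longrightarrow> t \<in> cell n j \<Longrightarrow> k = j"
proof -
  assume "t \<in> cell n k" "t \<in> cell n j"
  then have "real k < t * Suc n" "t * Suc n \<le> real (Suc k)" "real j < t * Suc n" "t * Suc n \<le> real (Suc j)"
    by (auto simp: cell_def field_simps)
  then have "real k < real (Suc j)" "real j < real (Suc k)" by linarith+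
  then show "k = j" by (simp only: of_nat_less_iff)
qed

lemma cell_ex:
  assumes "0 < t" "t \<le> real K"
  shows "\<exists>k < K * Suc n. t \<in> cell n k"
proof -
  define k where "k = nat \<lceil>t * Suc n\<rceil> - 1"
  have "0 < t * Suc n" using assms by simp
  then have c: "0 < \<lceil>t * Suc n\<rceil>" by linarith
  then have k1: "real (Suc k) = of_int \<lceil>t * Suc n\<rceil>" unfolding k_def by (simp add: of_nat_nat)
  have "real k < t * Suc n" "t * Suc n \<le> real (Suc k)" using k1 ceiling_correct[of "t * Suc n"] by linarith+
  then have tc: "t \<in> cell n k" by (simp add: cell_def field_simps)
  have "real k < t * Suc n" by fact
  also have "\<dots> \<le> real K * Suc n" using assms by (intro mult_right_mono) auto
  finally have "real k < real (K * Suc n)" by (simp add: algebra_simps)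
  then show ?thesis using tc by (intro exI[of _ k]) (simp only: of_nat_less_iff)
qed

lemma cell_diam: "s \<in> cell n k \<Longrightarrow> t \<in> cell n k \<Longrightarrow> \<bar>s - t\<bar> < 1 / Suc n"
proof -
  assume "s \<in> cell n k" "t \<in> cell n k"
  moreover have "real (Suc k) / Suc n = real k / Suc n + 1 / Suc n" by (simp add: add_divide_distrib)
  ultimately show ?thesis by (simp only: cell_def greaterThanAtMost_iff) linarith
qed

text \<open>A discrete lower approximation of the sum of \<open>f\<close> over the points with \<open>p t = c\<close>: each cell on which
  the level \<open>c\<close> is attained contributes the infimum of \<open>f\<close> there.\<close>

definition cellsum :: "real set \<Rightarrow> (real \<Rightarrow> real) \<Rightarrow> (real \<Rightarrow> real) \<Rightarrow> nat \<Rightarrow> nat \<Rightarrow> real \<Rightarrow> ennreal" where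
  "cellsum I f p K n c = (\<Sum>k<K * Suc n. (INF t\<in>I \<inter> cell n k. ennreal (f t)) * indicator (p ` (I \<inter> cell n k)) c)"

text \<open>As soon as the mesh is finer than the distances between the points of \<open>F\<close>, these lie in different
  cells, and by continuity of \<open>f\<close> the infimum over each of the cells is close to the value at its point.\<close>

lemma cellsum_liminf:
  fixes f p :: "real \<Rightarrow> real"
  assumes F: "finite F" "F \<subseteq> I" and I: "I \<subseteq> {0<..}" "F \<subseteq> {..real K}" and f: "continuous_on I f" "\<And>t. t \<in> I \<Longrightarrow> 0 \<le> f t"
    and pc: "\<And>t. t \<in> F \<Longrightarrow> p t = c"
  shows "(\<Sum>t\<in>F. ennreal (f t)) \<le> liminf (\<lambda>n. cellsum I f p K n c)"
proof (rule ennreal_le_epsilon)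
  fix e :: real assume e: "0 < e"
  define \<epsilon> where "\<epsilon> = e / (real (card F) + 1)"
  have \<epsilon>: "\<epsilon> > 0" "real (card F) * \<epsilon> \<le> e" unfolding \<epsilon>_def using e by (auto simp: field_simps)
  have "\<exists>d>0. \<forall>s\<in>I. \<bar>s - t\<bar> < d \<longrightarrow> \<bar>f s - f t\<bar> < \<epsilon>" if "t \<in> F" for t
    using f(1) \<epsilon>(1) that F(2) unfolding continuous_on_iff dist_real_def by blast
  then obtain d where d: "\<And>t. t \<in> F \<Longrightarrow> d t > 0" "\<And>t s. t \<in> F \<Longrightarrow> s \<in> I \<Longrightarrow> \<bar>s - t\<bar> < d t \<Longrightarrow> \<bar>f s - f t\<bar> < \<epsilon>"
    by metis
  \<comment> \<open>no larger than the gaps between points of \<open>F\<close> and than all moduli of continuity\<close>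
  define \<delta> where "\<delta> = Min (insert 1 (d ` F \<union> (\<lambda>(s, t). \<bar>s - t\<bar>) ` (F \<times> F - Id)))"
  have finS: "finite (insert 1 (d ` F \<union> (\<lambda>(s, t). \<bar>s - t\<bar>) ` (F \<times> F - Id)))" using F(1) by simp
  have \<delta>: "\<delta> > 0" unfolding \<delta>_def using finS d(1) by (subst Min_gr_iff) auto
  have \<delta>d: "\<delta> \<le> d t" if "t \<in> F" for t unfolding \<delta>_def using finS that by (intro Min_le) auto
  have \<delta>s: "\<delta> \<le> \<bar>s - t\<bar>" if "s \<in> F" "t \<in> F" "s \<noteq> t" for s t unfolding \<delta>_def using finS that
    by (intro Min_le) (auto intro!: image_eqI[of _ _ "(s, t)"])
  obtain N :: nat where N: "1 / Suc N < \<delta>" using \<delta> nat_approx_posE by blast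
  have key: "(\<Sum>t\<in>F. ennreal (f t)) - ennreal e \<le> cellsum I f p K n c" if n: "n \<ge> N" for n
  proof -
    have "1 / real (Suc n) \<le> 1 / real (Suc N)" using n by (intro divide_left_mono) auto
    then have n\<delta>: "1 / real (Suc n) < \<delta>" using N by linarith
    have "\<exists>k<K * Suc n. t \<in> cell n k" if "t \<in> F" for t
      using that F(2) I by (intro cell_ex) auto
    then obtain k where k: "\<And>t. t \<in> F \<Longrightarrow> k t < K * Suc n" "\<And>t. t \<in> F \<Longrightarrow> t \<in> cell n (k t)" by metis
    have inj: "inj_on k F"
    proof (rule inj_onI, rule ccontr)
      fix s t assume st: "s \<in> F" "t \<in> F" "k s = k t" "s \<noteq> t"
      have "\<bar>s - t\<bar> < 1 / Suc n" using cell_diam[of s n "k s" t] k(2)[OF st(1)] k(2)[OF st(2)] st(3) by simp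
      then show False using \<delta>s[OF st(1,2,4)] n\<delta> by linarith
    qed
    have low: "ennreal (f t) \<le> (INF s\<in>I \<inter> cell n (k t). ennreal (f s)) + ennreal \<epsilon>" if t: "t \<in> F" for t
    proof -
      have "ennreal (f t) - ennreal \<epsilon> \<le> (INF s\<in>I \<inter> cell n (k t). ennreal (f s))"
      proof (rule INF_greatest)
        fix s assume s: "s \<in> I \<inter> cell n (k t)"
        then have "\<bar>s - t\<bar> < 1 / Suc n" using cell_diam[of s n "k t" t] k(2)[OF t] by simp
        then have "\<bar>f s - f t\<bar> < \<epsilon>" using d(2)[OF t, of s] s \<delta>d[OF t] n\<delta> by simp
        then have "f t \<le> f s + \<epsilon>" by linarith
        then have "ennreal (f t) \<le> ennreal (f s) + ennreal \<epsilon>"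
          using f(2)[of s] s \<epsilon>(1) by (simp add: ennreal_leI flip: ennreal_plus)
        then show "ennreal (f t) - ennreal \<epsilon> \<le> ennreal (f s)"
          by (simp add: ennreal_minus_le_iff add.commute)
      qed
      then show ?thesis by (simp add: ennreal_minus_le_iff add.commute)
    qed
    have "(\<Sum>t\<in>F. ennreal (f t)) \<le> (\<Sum>t\<in>F. (INF s\<in>I \<inter> cell n (k t). ennreal (f s)) + ennreal \<epsilon>)"
      by (rule sum_mono) (rule low)
    also have "\<dots> = (\<Sum>t\<in>F. (INF s\<in>I \<inter> cell n (k t). ennreal (f s))) + of_nat (card F) * ennreal \<epsilon>"
      by (simp add: sum.distrib)
    also have "of_nat (card F) * ennreal \<epsilon> = ennreal (real (card F) * \<epsilon>)"
      using \<epsilon>(1) by (simp add: ennreal_mult ennreal_of_nat_eq_real_of_nat)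
    also have "\<dots> \<le> ennreal e" using \<epsilon>(2) by (rule ennreal_leI)
    also have "(\<Sum>t\<in>F. (INF s\<in>I \<inter> cell n (k t). ennreal (f s)))
        = (\<Sum>t\<in>F. (INF s\<in>I \<inter> cell n (k t). ennreal (f s)) * indicator (p ` (I \<inter> cell n (k t))) c)"
    proof (rule sum.cong[OF refl])
      fix t assume t: "t \<in> F"
      then have "c \<in> p ` (I \<inter> cell n (k t))" using pc[OF t] k(2)[OF t] F(2) by (intro image_eqI[of _ _ t]) auto
      then show "(INF s\<in>I \<inter> cell n (k t). ennreal (f s)) = (INF s\<in>I \<inter> cell n (k t). ennreal (f s)) * indicator (p ` (I \<inter> cell n (k t))) c"
        by simp
    qed
    also have "\<dots> = (\<Sum>j\<in>k ` F. (INF s\<in>I \<inter> cell n j. ennreal (f s)) * indicator (p ` (I \<inter> cell n j)) c)"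
      by (simp add: sum.reindex[OF inj])
    also have "\<dots> \<le> cellsum I f p K n c"
      unfolding cellsum_def using k(1) by (intro sum_mono2) auto
    finally show ?thesis by (simp add: ennreal_minus_le_iff add.commute add_mono)
  qed
  have "(\<Sum>t\<in>F. ennreal (f t)) - ennreal e \<le> liminf (\<lambda>n. cellsum I f p K n c)"
    using key by (intro Liminf_bounded) (auto simp: eventually_sequentially)
  then show "(\<Sum>t\<in>F. ennreal (f t)) \<le> liminf (\<lambda>n. cellsum I f p K n c) + ennreal e"
    by (simp add: ennreal_minus_le_iff add.commute)
qed

lemma cell_image_borel:
  fixes p :: "real \<Rightarrow> real"
  assumes I: "is_interval I" and p: "continuous_on UNIV p"
  shows "p ` (I \<inter> cell n k) \<in> sets borel"
proof -
  have "is_interval (I \<inter> cell n k)" using I unfolding cell_def by (intro is_interval_Int is_interval_oc)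
  then have "connected (p ` (I \<inter> cell n k))"
    by (intro connected_continuous_image continuous_on_subset[OF p]) (auto simp: is_interval_connected)
  then have "is_interval (p ` (I \<inter> cell n k))" by (simp add: is_interval_connected_1)
  then show ?thesis by (rule real_interval_borel_measurable)
qed

lemma cellsum_measurable:
  assumes I: "is_interval I" and p: "continuous_on UNIV p"
  shows "cellsum I f p K n \<in> borel_measurable borel"
  unfolding cellsum_def[abs_def]
  by (intro borel_measurable_sum borel_measurable_times_ennreal borel_measurable_const borel_measurable_indicator
      cell_image_borel[OF assms])

text \<open>On a single cell, integrating over the levels gives the infimum of \<open>f\<close> times the measure of the
  image, which is at most the integral of \<open>f \<bar>p'\<bar>\<close> over the cell.\<close>

lemma cellsum_integral_le:
  fixes f p dp :: "real \<Rightarrow> real"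
  assumes I: "is_interval I" and lip: "L-lipschitz_on UNIV p"
    and dp[measurable]: "dp \<in> borel_measurable borel" and bnd: "\<And>t. \<bar>dp t\<bar> \<le> L"
    and der: "AE t in lborel. (p has_real_derivative dp t) (at t)"
    and E[measurable]: "E \<in> sets borel"
    and fm[measurable]: "(\<lambda>t. f t * indicator I t) \<in> borel_measurable borel"
  shows "(\<integral>\<^sup>+c. cellsum I f p K n c * indicator E c \<partial>lborel)
    \<le> (\<integral>\<^sup>+t. ennreal (f t) * ennreal \<bar>dp t\<bar> * indicator {t \<in> I. p t \<in> E} t \<partial>lborel)"
proof -
  have pc: "continuous_on UNIV p" using lip lipschitz_on_continuous_on by blast
  have pm[measurable]: "p \<in> borel_measurable borel" by (rule borel_measurable_continuous_onI[OF pc])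
  have Im[measurable]: "I \<in> sets borel" using I by (rule real_interval_borel_measurable)
  have cm[measurable]: "cell n k \<in> sets borel" for k unfolding cell_def by simp
  define T where "T = (\<lambda>k. {t \<in> I \<inter> cell n k. p t \<in> E})"
  have Tm[measurable]: "T k \<in> sets borel" for k unfolding T_def by measurable
  have Tb: "bounded (T k)" for k
    by (rule bounded_subset[OF bounded_closed_interval[of "real k / Suc n" "real (Suc k) / Suc n"]])
       (auto simp: T_def cell_def)
  define a where "a = (\<lambda>k. INF t\<in>I \<inter> cell n k. ennreal (f t))"
  have im: "p ` (I \<inter> cell n k) \<inter> E = p ` T k" for k by (auto simp: T_def)
  have meas: "p ` (I \<inter> cell n k) \<in> sets borel" for k by (rule cell_image_borel[OF I pc])
  have one: "(\<integral>\<^sup>+c. a k * indicator (p ` (I \<inter> cell n k)) c * indicator E c \<partial>lborel)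
      \<le> (\<integral>\<^sup>+t. ennreal (f t) * ennreal \<bar>dp t\<bar> * indicator (T k) t \<partial>lborel)" for k
  proof -
    have "(\<integral>\<^sup>+c. a k * indicator (p ` (I \<inter> cell n k)) c * indicator E c \<partial>lborel)
        = (\<integral>\<^sup>+c. a k * indicator (p ` (I \<inter> cell n k) \<inter> E) c \<partial>lborel)"
      by (intro nn_integral_cong) (auto split: split_indicator)
    also have "\<dots> = a k * emeasure lborel (p ` (I \<inter> cell n k) \<inter> E)"
      using meas by (intro nn_integral_cmult_indicator) auto
    also have "emeasure lborel (p ` (I \<inter> cell n k) \<inter> E) = emeasure lebesgue (p ` T k)"
    proof -
      have "p ` T k \<in> sets lborel" using meas[of k] E unfolding im[symmetric] by simp
      then show ?thesis unfolding im by simp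
    qed
    also have "a k * emeasure lebesgue (p ` T k) \<le> a k * (\<integral>\<^sup>+t. ennreal \<bar>dp t\<bar> * indicator (T k) t \<partial>lborel)"
      by (intro mult_left_mono lipschitz_image_emeasure_le(2)[OF lip Tm Tb dp bnd der]) simp
    also have "\<dots> = (\<integral>\<^sup>+t. a k * (ennreal \<bar>dp t\<bar> * indicator (T k) t) \<partial>lborel)"
      by (rule nn_integral_cmult[symmetric]) measurable
    also have "\<dots> \<le> (\<integral>\<^sup>+t. ennreal (f t) * ennreal \<bar>dp t\<bar> * indicator (T k) t \<partial>lborel)"
    proof (rule nn_integral_mono)
      fix t
      have "a k \<le> ennreal (f t)" if "t \<in> T k" unfolding a_def using that by (intro INF_lower) (auto simp: T_def)
      then show "a k * (ennreal \<bar>dp t\<bar> * indicator (T k) t) \<le> ennreal (f t) * ennreal \<bar>dp t\<bar> * indicator (T k) t"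
        by (auto split: split_indicator intro: mult_right_mono)
    qed
    finally show ?thesis .
  qed
  have "(\<integral>\<^sup>+c. cellsum I f p K n c * indicator E c \<partial>lborel)
      = (\<integral>\<^sup>+c. (\<Sum>k<K * Suc n. a k * indicator (p ` (I \<inter> cell n k)) c * indicator E c) \<partial>lborel)"
    unfolding cellsum_def a_def by (simp only: sum_distrib_right)
  also have "\<dots> = (\<Sum>k<K * Suc n. \<integral>\<^sup>+c. a k * indicator (p ` (I \<inter> cell n k)) c * indicator E c \<partial>lborel)"
    using meas E by (intro nn_integral_sum borel_measurable_times_ennreal borel_measurable_const borel_measurable_indicator) simp_all
  also have "\<dots> \<le> (\<Sum>k<K * Suc n. \<integral>\<^sup>+t. ennreal (f t) * ennreal \<bar>dp t\<bar> * indicator (T k) t \<partial>lborel)"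
    by (rule sum_mono) (rule one)
  also have "\<dots> \<le> (\<integral>\<^sup>+t. ennreal (f t) * ennreal \<bar>dp t\<bar> * indicator {t \<in> I. p t \<in> E} t \<partial>lborel)"
  proof -
    have m: "(\<lambda>t. ennreal (f t) * ennreal \<bar>dp t\<bar> * indicator (T k) t) \<in> borel_measurable borel" for k
    proof -
      have "(\<lambda>t. ennreal (f t) * ennreal \<bar>dp t\<bar> * indicator (T k) t)
          = (\<lambda>t. ennreal (f t * indicator I t) * ennreal \<bar>dp t\<bar> * indicator (T k) t)"
        by (auto simp: fun_eq_iff T_def split: split_indicator)
      then show ?thesis using fm by simp
    qed
    have dis: "disjoint_family_on T {..<K * Suc n}"
      unfolding disjoint_family_on_def T_def using cell_disjoint by blast
    have "(\<Sum>k<K * Suc n. \<integral>\<^sup>+t. ennreal (f t) * ennreal \<bar>dp t\<bar> * indicator (T k) t \<partial>lborel)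
        = (\<integral>\<^sup>+t. (\<Sum>k<K * Suc n. ennreal (f t) * ennreal \<bar>dp t\<bar> * indicator (T k) t) \<partial>lborel)"
      using m by (intro nn_integral_sum[symmetric]) simp
    also have "\<dots> = (\<integral>\<^sup>+t. ennreal (f t) * ennreal \<bar>dp t\<bar> * indicator (\<Union>k<K * Suc n. T k) t \<partial>lborel)"
      using dis by (simp only: sum_distrib_left[symmetric] indicator_UN_disjoint finite_lessThan)
    also have "\<dots> \<le> (\<integral>\<^sup>+t. ennreal (f t) * ennreal \<bar>dp t\<bar> * indicator {t \<in> I. p t \<in> E} t \<partial>lborel)"
      by (intro nn_integral_mono) (auto simp: T_def split: split_indicator)
    finally show ?thesis .
  qed
  finally show ?thesis .
qed

text \<open>For \<open>f = 1\<close> the lower limit of the cell sums dominates the number of points at level \<open>c\<close>, and by Fatou's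
  lemma it has a finite integral.\<close>

lemma coarea_finite_preimages:
  fixes p dp :: "real \<Rightarrow> real"
  assumes I: "is_interval I" "I \<subseteq> {0<..}" and lip: "L-lipschitz_on UNIV p"
    and dp[measurable]: "dp \<in> borel_measurable borel" and bnd: "\<And>t. \<bar>dp t\<bar> \<le> L"
    and der: "AE t in lborel. (p has_real_derivative dp t) (at t)"
    and supp: "\<And>t. t \<in> I \<Longrightarrow> 0 < p t \<Longrightarrow> t \<le> real K"
  shows "AE c in lborel. 0 < c \<longrightarrow> finite {t \<in> I. p t = c}"
proof -
  have Im[measurable]: "I \<in> sets borel" using I(1) by (rule real_interval_borel_measurable)
  have pc: "continuous_on UNIV p" using lip lipschitz_on_continuous_on by blast
  note [measurable] = cellsum_measurable[OF I(1) pc]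
  let ?S = "\<lambda>n. cellsum I (\<lambda>_. 1) p K n"
  have E: "{0<..} \<in> sets (borel :: real measure)" by simp
  have bd: "(\<integral>\<^sup>+c. ?S n c * indicator {0<..} c \<partial>lborel) \<le> ennreal (L * K)" for n
  proof -
    have "(\<integral>\<^sup>+c. ?S n c * indicator {0<..} c \<partial>lborel)
        \<le> (\<integral>\<^sup>+t. ennreal 1 * ennreal \<bar>dp t\<bar> * indicator {t \<in> I. p t \<in> {0<..}} t \<partial>lborel)"
      by (rule cellsum_integral_le[OF I(1) lip dp bnd der E]) simp
    also have "\<dots> \<le> (\<integral>\<^sup>+t. ennreal L * indicator {0..real K} t \<partial>lborel)"
    proof (rule nn_integral_mono)
      fix t show "ennreal 1 * ennreal \<bar>dp t\<bar> * indicator {t \<in> I. p t \<in> {0<..}} t \<le> ennreal L * indicator {0..real K} t"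
        using supp[of t] I(2) ennreal_leI[OF bnd[of t]] by (auto split: split_indicator)
    qed
    also have "\<dots> = ennreal L * ennreal (real K)" by (simp add: nn_integral_cmult_indicator)
    also have "\<dots> = ennreal (L * K)" using lipschitz_on_nonneg[OF lip] by (simp add: ennreal_mult)
    finally show ?thesis .
  qed
  have "(\<integral>\<^sup>+c. liminf (\<lambda>n. ?S n c * indicator {0<..} c) \<partial>lborel) \<le> liminf (\<lambda>n. \<integral>\<^sup>+c. ?S n c * indicator {0<..} c \<partial>lborel)"
    by (rule nn_integral_liminf) measurable
  also have "\<dots> \<le> ennreal (L * K)"
    by (rule Liminf_le) (use bd in \<open>auto intro: always_eventually\<close>)
  finally have fin: "(\<integral>\<^sup>+c. liminf (\<lambda>n. ?S n c * indicator {0<..} c) \<partial>lborel) \<noteq> \<infinity>"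
    using ennreal_less_top[of "L * K"] by (auto simp: top_unique)
  have "AE c in lborel. liminf (\<lambda>n. ?S n c * indicator {0<..} c) \<noteq> \<infinity>"
    by (rule nn_integral_PInf_AE[OF _ fin]) measurable
  then show ?thesis
  proof (rule eventually_mono, intro impI)
    fix c :: real assume l: "liminf (\<lambda>n. ?S n c * indicator {0<..} c) \<noteq> \<infinity>" and c: "0 < c"
    have card: "of_nat (card F) \<le> liminf (\<lambda>n. ?S n c)" if F: "finite F" "F \<subseteq> {t \<in> I. p t = c}" for F
    proof -
      have "F \<subseteq> {..real K}" using F(2) supp c by auto
      then have "(\<Sum>t\<in>F. ennreal 1) \<le> liminf (\<lambda>n. ?S n c)"
        using F I(2) by (intro cellsum_liminf) auto
      then show ?thesis by simp
    qed
    show "finite {t \<in> I. p t = c}"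
    proof (rule ccontr)
      assume inf: "infinite {t \<in> I. p t = c}"
      have big: "of_nat m \<le> liminf (\<lambda>n. ?S n c)" for m
      proof -
        obtain F where "finite F" "card F = m" "F \<subseteq> {t \<in> I. p t = c}"
          using infinite_arbitrarily_large[OF inf, of m] by blast
        then show ?thesis using card[of F] by simp
      qed
      have "liminf (\<lambda>n. ?S n c) \<noteq> top" using l c by simp
      then obtain m :: nat where "liminf (\<lambda>n. ?S n c) < of_nat m"
        using ennreal_Ex_less_of_nat[of "liminf (\<lambda>n. ?S n c)"] by (auto simp: less_top)
      then show False using big[of m] by (simp add: not_le[symmetric])
    qed
  qed
qed

text \<open>The inequality in the coarea formula that survives lower approximation: Fatou's lemma for the cell
  sums. It is stated for a minorant \<open>w\<close> of the sums over the level sets, because those sums are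
  evaluated only where the level set is finite.\<close>

lemma coarea_lower_bound:
  fixes f p dp :: "real \<Rightarrow> real"
  assumes I: "is_interval I" "I \<subseteq> {0<..}" and lip: "L-lipschitz_on UNIV p"
    and dp[measurable]: "dp \<in> borel_measurable borel" and bnd: "\<And>t. \<bar>dp t\<bar> \<le> L"
    and der: "AE t in lborel. (p has_real_derivative dp t) (at t)"
    and supp: "\<And>t. t \<in> I \<Longrightarrow> 0 < p t \<Longrightarrow> t \<le> real K"
    and f: "continuous_on I f" "\<And>t. t \<in> I \<Longrightarrow> 0 \<le> f t"
    and E: "E \<in> sets borel" "E \<subseteq> {0<..}"
    and w: "\<And>c. c \<in> E \<Longrightarrow> finite {t \<in> I. p t = c} \<Longrightarrow> w c \<le> (\<Sum>t\<in>{t \<in> I. p t = c}. ennreal (f t))"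
  shows "(\<integral>\<^sup>+c. w c * indicator E c \<partial>lborel)
    \<le> (\<integral>\<^sup>+t. ennreal (f t) * ennreal \<bar>dp t\<bar> * indicator {t \<in> I. p t \<in> E} t \<partial>lborel)"
proof -
  have Im: "I \<in> sets borel" using I(1) by (rule real_interval_borel_measurable)
  have pc: "continuous_on UNIV p" using lip lipschitz_on_continuous_on by blast
  note [measurable] = cellsum_measurable[OF I(1) pc] E(1)
  have fm: "(\<lambda>t. f t * indicator I t) \<in> borel_measurable borel"
    using borel_measurable_continuous_on_indicator[OF Im f(1)] by (simp add: mult.commute)
  let ?S = "\<lambda>n. cellsum I f p K n"
  let ?R = "(\<integral>\<^sup>+t. ennreal (f t) * ennreal \<bar>dp t\<bar> * indicator {t \<in> I. p t \<in> E} t \<partial>lborel)"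
  have "(\<integral>\<^sup>+c. w c * indicator E c \<partial>lborel) \<le> (\<integral>\<^sup>+c. liminf (\<lambda>n. ?S n c * indicator E c) \<partial>lborel)"
  proof (rule nn_integral_mono_AE)
    show "AE c in lborel. w c * indicator E c \<le> liminf (\<lambda>n. ?S n c * indicator E c)"
      using coarea_finite_preimages[OF I lip dp bnd der supp]
    proof (rule eventually_mono)
      fix c :: real assume fin: "0 < c \<longrightarrow> finite {t \<in> I. p t = c}"
      show "w c * indicator E c \<le> liminf (\<lambda>n. ?S n c * indicator E c)"
      proof (cases "c \<in> E")
        case True
        then have c: "0 < c" "finite {t \<in> I. p t = c}" using E(2) fin by auto
        have "{t \<in> I. p t = c} \<subseteq> {..real K}" using supp c(1) by auto
        then have "(\<Sum>t\<in>{t \<in> I. p t = c}. ennreal (f t)) \<le> liminf (\<lambda>n. ?S n c)"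
          using c(2) I(2) f by (intro cellsum_liminf) auto
        then show ?thesis using w[OF True c(2)] True by (auto intro: order_trans)
      qed simp
    qed
  qed
  also have "\<dots> \<le> liminf (\<lambda>n. \<integral>\<^sup>+c. ?S n c * indicator E c \<partial>lborel)"
    by (rule nn_integral_liminf) measurable
  also have "\<dots> \<le> ?R"
    by (rule Liminf_le) (use cellsum_integral_le[OF I(1) lip dp bnd der E(1) fm] in \<open>auto intro: always_eventually\<close>)
  finally show ?thesis .
qed

section \<open>The weight and the vertical derivatives\<close>

text \<open>Up to the points of \<open>F\<close>, the set \<open>U\<close> is a union of gaps between consecutive points of
  \<open>F \<union> {0}\<close>, and \<open>y\<close> is the largest of these points. Induction on the number of points: if the topmost
  gap is not in \<open>U\<close>, drop \<open>y\<close>. If it is, it is not in the complement \<open>V = {0<..<y} - U\<close>, so the induction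
  hypothesis bounds \<open>f \<bar>V\<bar>\<close> by the sum over the remaining points, and
  \<open>f \<bar>U\<bar> = f (y - \<bar>V\<bar>) \<le> f \<bar>V\<bar> + f y\<close> by the triangle-like inequality for \<open>f\<close>.\<close>

lemma weight_level_combinatorial_aux:
  fixes f :: "real \<Rightarrow> real"
  assumes nonneg: "\<And>t. t \<in> I \<Longrightarrow> 0 \<le> f t"
    and tri: "\<And>s t. s \<in> I \<Longrightarrow> t \<in> I \<Longrightarrow> s < t \<Longrightarrow> f (t - s) \<le> f s + f t"
    and F: "finite F" "F \<subseteq> I"  and y: "\<And>t. t \<in> F \<Longrightarrow> t \<le> y" "y \<in> F"
    and I: "\<And>t. t \<in> I \<Longrightarrow> {0<..t} \<subseteq> I" "I \<subseteq> {0<..}"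
    and U: "U \<in> sets borel" "U \<subseteq> {0<..<y}" "0 < measure lborel U"
    and sat: "\<And>a b. 0 \<le> a \<Longrightarrow> a < b \<Longrightarrow> b \<le> y \<Longrightarrow> F \<inter> {a<..<b} = {} \<Longrightarrow> {a<..<b} \<subseteq> U \<or> {a<..<b} \<inter> U = {}"
  shows "f (measure lborel U) \<le> (\<Sum>t\<in>F. f t)"
  using F y U sat
proof (induction "card F" arbitrary: F U y rule: less_induct)
  case less
  define F' where "F' = F - {y}"
  define z where "z = Max (insert 0 F')"
  have fin: "finite F'" using less.prems(1) by (simp add: F'_def)
  have cardF: "card F' < card F" unfolding F'_def by (rule card_Diff1_less[OF less.prems(1,4)])
  have sumF: "(\<Sum>t\<in>F. f t) = f y + (\<Sum>t\<in>F'. f t)"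
    unfolding F'_def using less.prems(1,4) by (rule sum.remove)
  have yI: "y \<in> I" using less.prems(2,4) by auto
  then have y0: "0 < y" using I(2) by auto
  have zmax: "t \<le> z" if "t \<in> F'" for t unfolding z_def using fin that by simp
  have z0: "0 \<le> z" unfolding z_def using fin by simp
  have zin: "z = 0 \<or> z \<in> F'" unfolding z_def using Max_in[of "insert 0 F'"] fin by auto
  have zy: "z < y"
  proof (cases "z = 0")
    case False
    then have "z \<in> F" "z \<noteq> y" using zin by (auto simp: F'_def)
    then show ?thesis using less.prems(3)[of z] by simp
  qed (use y0 in simp)
  have gap: "F \<inter> {z<..<y} = {}"
  proof -
    have "t \<notin> {z<..<y}" if "t \<in> F" for t using zmax[of t] that by (cases "t = y") (auto simp: F'_def)
    then show ?thesis by blast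
  qed
  have sumF'0: "0 \<le> (\<Sum>t\<in>F'. f t)"
    using less.prems(2) by (intro sum_nonneg nonneg) (auto simp: F'_def)
  have step: "f (measure lborel V) \<le> (\<Sum>t\<in>F'. f t)"
    if V: "V \<in> sets borel" "V \<subseteq> {0<..<y}" "0 < measure lborel V" "V \<inter> {z<..<y} = {}"
      and satV: "\<And>a b. 0 \<le> a \<Longrightarrow> a < b \<Longrightarrow> b \<le> y \<Longrightarrow> F \<inter> {a<..<b} = {} \<Longrightarrow> {a<..<b} \<subseteq> V \<or> {a<..<b} \<inter> V = {}" for V
  proof -
    \<comment> \<open>the point \<open>z\<close> itself may belong to \<open>V\<close>\<close>
    define V' where "V' = V - {z}"
    have V'm: "V' \<in> sets borel" using V(1) by (simp add: V'_def)
    have V'z: "V' \<subseteq> {0<..<z}"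
    proof
      fix t assume "t \<in> V'"
      then have "0 < t" "t < y" "t \<notin> {z<..<y}" "t \<noteq> z" using V(2,4) by (auto simp: V'_def)
      then show "t \<in> {0<..<z}" by auto
    qed
    have meq: "measure lborel V' = measure lborel V"
      unfolding V'_def measure_def using V(1) by (simp add: emeasure_Diff_null_set null_setsI)
    have zF: "z \<in> F'"
    proof (rule ccontr)
      assume "z \<notin> F'"
      then have "V' = {}" using zin V'z by auto
      then show False using meq V(3) by simp
    qed
    have "f (measure lborel V') \<le> (\<Sum>t\<in>F'. f t)"
    proof (rule less.hyps[OF cardF fin, of z])
      show "F' \<subseteq> I" using less.prems(2) by (auto simp: F'_def)
      show "0 < measure lborel V'" using meq V(3) by simp
      fix a b assume ab: "0 \<le> a" "a < b" "b \<le> z" "F' \<inter> {a<..<b} = {}"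
      have "t \<notin> {a<..<b}" if "t \<in> F" for t
      proof (cases "t = y")
        case False
        then have "t \<in> F'" using that by (simp add: F'_def)
        then show ?thesis using ab(4) by blast
      qed (use ab(3) zy in simp)
      then have "F \<inter> {a<..<b} = {}" by blast
      then have "{a<..<b} \<subseteq> V \<or> {a<..<b} \<inter> V = {}" using satV[of a b] ab zy by simp
      then show "{a<..<b} \<subseteq> V' \<or> {a<..<b} \<inter> V' = {}" using ab(3) by (auto simp: V'_def)
    qed (fact zmax zF V'm V'z)+
    then show ?thesis by (simp add: meq)
  qed
  from less.prems(8)[OF z0 zy order_refl gap] show ?case
  proof
    assume "{z<..<y} \<inter> U = {}"
    then have "U \<inter> {z<..<y} = {}" by blast
    then have "f (measure lborel U) \<le> (\<Sum>t\<in>F'. f t)"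
      by (rule step[OF less.prems(5-7) _ less.prems(8)])
    then show ?case using sumF nonneg[OF yI] by simp
  next
    assume sub: "{z<..<y} \<subseteq> U"
    define V where "V = {0<..<y} - U"
    have Vm: "V \<in> sets borel" using less.prems(5) by (simp add: V_def)
    have mU: "measure lborel U = y - measure lborel V"
    proof -
      have "U = {0<..<y} - V" using less.prems(6) by (auto simp: V_def)
      moreover have "measure lborel ({0<..<y} - V) = measure lborel {0<..<y} - measure lborel V"
        by (rule measure_Diff) (use Vm y0 in \<open>auto simp: V_def\<close>)
      ultimately show ?thesis using y0 by simp
    qed
    show ?case
    proof (cases "measure lborel V = 0")
      case True
      then show ?thesis using mU sumF sumF'0 by simp
    next
      case False
      then have V0: "0 < measure lborel V" by (simp add: zero_less_measure_iff)
      have "f (measure lborel V) \<le> (\<Sum>t\<in>F'. f t)"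
      proof (rule step[OF Vm _ V0])
        show "V \<subseteq> {0<..<y}" "V \<inter> {z<..<y} = {}" using sub by (auto simp: V_def)
        fix a b assume ab: "0 \<le> a" "a < b" "b \<le> y" "F \<inter> {a<..<b} = {}"
        have s: "{a<..<b} \<subseteq> {0<..<y}" using ab by auto
        show "{a<..<b} \<subseteq> V \<or> {a<..<b} \<inter> V = {}"
          using less.prems(8)[OF ab] s unfolding V_def by blast
      qed
      moreover have "measure lborel V < y" using mU less.prems(7) by simp
      moreover have "measure lborel V \<in> I" using I(1)[OF yI] V0 \<open>measure lborel V < y\<close> by auto
      ultimately have "f (y - measure lborel V) \<le> f y + (\<Sum>t\<in>F'. f t)"
        using tri[of "measure lborel V" y] yI by simp
      then show ?thesis using mU sumF by simp
    qed
  qed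
qed

lemma ivl_downward: "t \<in> ivl \<alpha> \<Longrightarrow> {0<..t} \<subseteq> ivl \<alpha>"
proof
  fix s assume "t \<in> ivl \<alpha>" "s \<in> {0<..t}"
  then show "s \<in> ivl \<alpha>" using le_less_trans[of "ereal s" "ereal t" \<alpha>] by (simp add: ivl_def)
qed

text \<open>It remains to treat the last gap, above the largest point of \<open>F\<close>. If \<open>\<alpha>\<close> is infinite, it is not in the
  bounded set \<open>U\<close>. If \<open>\<alpha>\<close> is finite and it is in \<open>U\<close>, pass to the complement of \<open>U\<close>, whose measure is
  \<open>\<alpha> - \<bar>U\<bar>\<close>, and use the symmetry of \<open>f\<close>.\<close>

lemma weight_level_combinatorial:
  fixes f :: "real \<Rightarrow> real"
  assumes nonneg: "\<And>t. t \<in> ivl \<alpha> \<Longrightarrow> 0 \<le> f t"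
    and tri: "\<And>s t. s \<in> ivl \<alpha> \<Longrightarrow> t \<in> ivl \<alpha> \<Longrightarrow> s < t \<Longrightarrow> f (t - s) \<le> f s + f t"
    and sym: "\<And>t. \<alpha> < \<infinity> \<Longrightarrow> t \<in> ivl \<alpha> \<Longrightarrow> f t = f (real_of_ereal \<alpha> - t)"
    and F: "finite F" "F \<subseteq> ivl \<alpha>"
    and U: "U \<in> sets borel" "U \<subseteq> ivl \<alpha>" "bounded U" "0 < measure lborel U" "ereal (measure lborel U) < \<alpha>"
    and sat: "\<And>a b. {a<..<b} \<subseteq> ivl \<alpha> \<Longrightarrow> F \<inter> {a<..<b} = {} \<Longrightarrow> {a<..<b} \<subseteq> U \<or> {a<..<b} \<inter> U = {}"
  shows "f (measure lborel U) \<le> (\<Sum>t\<in>F. f t)"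
proof -
  have I0: "ivl \<alpha> \<subseteq> {0<..}" by (auto simp: ivl_def)
  have Fmax: "F \<inter> {Max F<..} = {}"
  proof -
    have "\<not> Max F < t" if "t \<in> F" for t using Max_ge[OF F(1) that] by simp
    then show ?thesis by blast
  qed
  have aux: "f (measure lborel V) \<le> (\<Sum>t\<in>F. f t)"
    if V: "V \<in> sets borel" "V \<subseteq> ivl \<alpha>" "0 < measure lborel V" and Fne: "F \<noteq> {}" and top: "V \<inter> {Max F<..} = {}"
      and satV: "\<And>a b. {a<..<b} \<subseteq> ivl \<alpha> \<Longrightarrow> F \<inter> {a<..<b} = {} \<Longrightarrow> {a<..<b} \<subseteq> V \<or> {a<..<b} \<inter> V = {}" for V
  proof -
    define y where "y = Max F"
    have yF: "y \<in> F" unfolding y_def using F(1) Fne by simp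
    have ym: "t \<le> y" if "t \<in> F" for t unfolding y_def using F(1) that by simp
    have meq: "measure lborel (V - {y}) = measure lborel V"
      unfolding measure_def using V(1) by (simp add: emeasure_Diff_null_set null_setsI)
    have below: "t \<in> ivl \<alpha>" if "0 < t" "t \<le> y" for t
      using subsetD[OF ivl_downward[OF subsetD[OF F(2) yF]], of t] that by simp
    have "f (measure lborel (V - {y})) \<le> (\<Sum>t\<in>F. f t)"
    proof (rule weight_level_combinatorial_aux[where I="ivl \<alpha>" and y=y])
      show "V - {y} \<subseteq> {0<..<y}"
      proof
        fix t assume t: "t \<in> V - {y}"
        then have "\<not> Max F < t" using top by auto
        then show "t \<in> {0<..<y}" using t V(2) I0 by (auto simp: y_def)
      qed
      fix a b :: real assume ab: "0 \<le> a" "a < b" "b \<le> y" "F \<inter> {a<..<b} = {}"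
      have "{a<..<b} \<subseteq> ivl \<alpha>"
      proof
        fix t assume "t \<in> {a<..<b}" then show "t \<in> ivl \<alpha>" using ab by (intro below) auto
      qed
      then show "{a<..<b} \<subseteq> V - {y} \<or> {a<..<b} \<inter> (V - {y}) = {}" using satV[of a b] ab by fastforce
    next
      show "V - {y} \<in> sets borel" using V(1) by simp
      show "0 < measure lborel (V - {y})" using V(3) meq by simp
    qed (fact nonneg tri F ym yF I0 ivl_downward)+
    then show ?thesis by (simp add: meq)
  qed
  show ?thesis
  proof (cases \<alpha>)
    case (real a)
    have iv: "ivl \<alpha> = {0<..<a}" by (auto simp: ivl_def real)
    have mU: "measure lborel U < a" using U(5) real by simp
    then have a0: "0 < a" using U(4) by linarith
    have Fne: "F \<noteq> {}"
    proof
      assume "F = {}"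
      then have "{0<..<a} \<subseteq> U \<or> {0<..<a} \<inter> U = {}" using sat[of 0 a] iv by simp
      then have "U = {0<..<a} \<or> U = {}" using U(2) iv by auto
      moreover have m: "measure lborel {0<..<a} = a" using a0 by simp
      ultimately have "measure lborel U = a \<or> measure lborel U = 0"
        by (elim disjE) (simp_all only: m measure_empty simp_thms)
      then show False using U(4) mU by linarith
    qed
    define y where "y = Max F"
    have yF: "y \<in> F" unfolding y_def using F(1) Fne by simp
    then have y: "0 < y" "y < a" using F(2) iv by auto
    have gap: "F \<inter> {y<..<a} = {}"
    proof (rule ccontr)
      assume "F \<inter> {y<..<a} \<noteq> {}"
      then obtain t where "t \<in> F" "y < t" by (auto simp only: disjoint_iff greaterThanLessThan_iff)
      then show False using Max_ge[OF F(1), of t] unfolding y_def by linarith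
    qed
    have "{y<..<a} \<subseteq> ivl \<alpha>" unfolding iv using y(1) by (simp add: subset_iff)
    then have "{y<..<a} \<subseteq> U \<or> {y<..<a} \<inter> U = {}" by (rule sat[OF _ gap])
    then show ?thesis
    proof
      assume dis: "{y<..<a} \<inter> U = {}"
      have "t \<notin> U" if "y < t" for t
      proof
        assume "t \<in> U"
        then have "t \<in> {y<..<a}" using that U(2) iv by auto
        then show False using dis \<open>t \<in> U\<close> by blast
      qed
      then have "U \<inter> {Max F<..} = {}" by (auto simp: y_def)
      then show ?thesis by (rule aux[OF U(1,2,4) Fne _ sat])
    next
      assume sub: "{y<..<a} \<subseteq> U"
      define V where "V = {0<..<a} - U"
      have Vm: "V \<in> sets borel" using U(1) by (simp add: V_def)
      have mV: "measure lborel V = a - measure lborel U"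
        unfolding V_def
        using measure_Diff[of lborel "{0<..<a}" U] U(1,2) iv a0 by simp
      have "f (measure lborel V) \<le> (\<Sum>t\<in>F. f t)"
      proof (rule aux[OF Vm _ _ Fne])
        show "V \<subseteq> ivl \<alpha>" by (auto simp: V_def iv)
        show "0 < measure lborel V" using mV mU by simp
        show "V \<inter> {Max F<..} = {}" using sub by (auto simp: V_def y_def)
        fix c d assume cd: "{c<..<d} \<subseteq> ivl \<alpha>" "F \<inter> {c<..<d} = {}"
        then show "{c<..<d} \<subseteq> V \<or> {c<..<d} \<inter> V = {}" using sat[OF cd] unfolding V_def iv by blast
      qed
      moreover have "f (measure lborel U) = f (a - measure lborel U)"
        using sym[of "measure lborel U"] U(4) mU iv real by simp
      ultimately show ?thesis using mV by simp
    qed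
  next
    case PInf
    have iv: "ivl \<alpha> = {0<..}" by (auto simp: ivl_def PInf)
    obtain b where "\<forall>t\<in>U. norm t \<le> b" using U(3) unfolding bounded_iff by blast
    then have b: "t \<le> b" if "t \<in> U" for t using that by (auto dest!: bspec)
    have top: "U \<inter> {y<..} = {}" if y: "0 \<le> y" "F \<inter> {y<..} = {}" for y
    proof -
      \<comment> \<open>this interval contains points beyond \<open>U\<close>\<close>
      have "{y<..<max y b + 1} \<subseteq> U \<or> {y<..<max y b + 1} \<inter> U = {}"
        using y iv by (intro sat) auto
      moreover have "max y b + 1/2 \<notin> U" using b[of "max y b + 1/2"] by linarith
      moreover have "max y b + 1/2 \<in> {y<..<max y b + 1}" by auto
      ultimately have dis: "{y<..<max y b + 1} \<inter> U = {}" by blast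
      have "t \<notin> U" if "y < t" for t
      proof
        assume "t \<in> U"
        then have "t \<in> {y<..<max y b + 1}" using that b[of t] by auto
        then show False using dis \<open>t \<in> U\<close> by blast
      qed
      then show ?thesis by auto
    qed
    have Fne: "F \<noteq> {}"
    proof
      assume "F = {}"
      then have "U \<inter> {0<..} = {}" by (intro top) auto
      then have "U = {}" using U(2) iv by auto
      then show False using U(4) by simp
    qed
    have "0 \<le> Max F" using Max_in[OF F(1) Fne] F(2) iv by auto
    then have "U \<inter> {Max F<..} = {}" using Fmax by (intro top)
    then show ?thesis by (rule aux[OF U(1,2,4) Fne _ sat])
  next
    case MInf
    then show ?thesis using U(5) by simp
  qed
qed

lemma level_meas_lborel:
  assumes "{t \<in> ivl \<alpha>. c < p t} \<in> sets borel"
  shows "level_meas \<alpha> p c = measure lborel {t \<in> ivl \<alpha>. c < p t}"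
  unfolding level_meas_def using assms by simp

text \<open>By the intermediate value theorem, \<open>{c < p}\<close> is a union of gaps of the level set \<open>{p = c}\<close> up to points
  of the latter.\<close>

lemma weight_le_preimage_sum:
  fixes f p :: "real \<Rightarrow> real"
  assumes nonneg: "\<And>t. t \<in> ivl \<alpha> \<Longrightarrow> 0 \<le> f t"
    and tri: "\<And>s t. s \<in> ivl \<alpha> \<Longrightarrow> t \<in> ivl \<alpha> \<Longrightarrow> s < t \<Longrightarrow> f (t - s) \<le> f s + f t"
    and sym: "\<And>t. \<alpha> < \<infinity> \<Longrightarrow> t \<in> ivl \<alpha> \<Longrightarrow> f t = f (real_of_ereal \<alpha> - t)"
    and pc: "continuous_on UNIV p"
    and supp: "\<And>t. t \<in> ivl \<alpha> \<Longrightarrow> 0 < p t \<Longrightarrow> t \<le> real K"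
    and c: "0 < c" and fin: "finite {t \<in> ivl \<alpha>. p t = c}"
    and m: "0 < level_meas \<alpha> p c" "ereal (level_meas \<alpha> p c) < \<alpha>"
  shows "f (level_meas \<alpha> p c) \<le> (\<Sum>t\<in>{t \<in> ivl \<alpha>. p t = c}. f t)"
proof -
  define U where "U = {t \<in> ivl \<alpha>. c < p t}"
  have "open (ivl \<alpha> \<inter> p -` {c<..})"
    by (intro continuous_open_preimage continuous_on_subset[OF pc] open_ivl) auto
  moreover have "U = ivl \<alpha> \<inter> p -` {c<..}" by (auto simp: U_def)
  ultimately have Ub: "U \<in> sets borel" by simp
  have lm: "level_meas \<alpha> p c = measure lborel U"
    unfolding U_def by (rule level_meas_lborel) (use Ub in \<open>simp add: U_def\<close>)
  have "U \<subseteq> {0..real K}"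
  proof
    fix t assume "t \<in> U"
    then have "t \<in> ivl \<alpha>" "0 < p t" using c by (auto simp: U_def)
    then show "t \<in> {0..real K}" using supp[of t] by (simp add: ivl_def)
  qed
  then have bdd: "bounded U" by (rule bounded_subset[OF bounded_closed_interval])
  have sat: "{a<..<b} \<subseteq> U \<or> {a<..<b} \<inter> U = {}"
    if ab: "{a<..<b} \<subseteq> ivl \<alpha>" "{t \<in> ivl \<alpha>. p t = c} \<inter> {a<..<b} = {}" for a b
  proof (rule ccontr)
    assume "\<not> ?thesis"
    then obtain s t where st: "s \<in> {a<..<b}" "s \<notin> U" "t \<in> {a<..<b}" "t \<in> U" by blast
    have ps: "p s \<le> c" using st(1,2) ab(1) by (auto simp: U_def)
    have pt: "c \<le> p t" using st(4) by (simp add: U_def)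
    have "connected (p ` {a<..<b})"
      by (intro connected_continuous_image continuous_on_subset[OF pc]) auto
    then have "c \<in> p ` {a<..<b}"
      using connectedD_interval[of "p ` {a<..<b}" "p s" "p t" c] st(1,3) ps pt by blast
    then show False using ab by blast
  qed
  have "f (measure lborel U) \<le> (\<Sum>t\<in>{t \<in> ivl \<alpha>. p t = c}. f t)"
  proof (rule weight_level_combinatorial[OF nonneg tri sym fin _ Ub _ bdd])
    show "U \<subseteq> ivl \<alpha>" by (auto simp: U_def)
    show "{t \<in> ivl \<alpha>. p t = c} \<subseteq> ivl \<alpha>" by auto
    show "0 < measure lborel U" "ereal (measure lborel U) < \<alpha>" using m lm by auto
    show "{a<..<b} \<subseteq> U \<or> {a<..<b} \<inter> U = {}"
      if "{a<..<b} \<subseteq> ivl \<alpha>" "{t \<in> ivl \<alpha>. p t = c} \<inter> {a<..<b} = {}" for a b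
      using that by (rule sat)
  qed
  then show ?thesis by (simp add: lm)
qed

text \<open>Where the derivative of the decreasing function \<open>q\<close> exists and is not zero, \<open>q\<close> is strictly decreasing
  from the left, and the distribution function inverts it. So the substitution \<open>c = q t\<close> carries
  \<open>f \<bar>q'\<bar>\<close> to the function \<open>f (level_meas c)\<close> of the level.\<close>

lemma rearrangement_change_of_variables:
  fixes f p q dq :: "real \<Rightarrow> real"
  assumes \<alpha>: "0 < \<alpha>" and prof: "profile \<alpha> M p"
    and q: "\<And>t. t \<in> ivl \<alpha> \<Longrightarrow> q t = rearr1 \<alpha> p t"
    and lip: "L-lipschitz_on UNIV q" and dq[measurable]: "dq \<in> borel_measurable borel" and bnd: "\<And>t. \<bar>dq t\<bar> \<le> L"
    and der: "AE t in lborel. (q has_real_derivative dq t) (at t)"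
    and supp: "\<And>t. t \<in> ivl \<alpha> \<Longrightarrow> 0 < p t \<Longrightarrow> t \<le> real K"
    and f: "continuous_on (ivl \<alpha>) f" "\<And>t. t \<in> ivl \<alpha> \<Longrightarrow> 0 \<le> f t" "\<And>t. t \<in> ivl \<alpha> \<Longrightarrow> t \<le> real K \<Longrightarrow> f t \<le> B"
    and E[measurable]: "E \<in> sets borel" and E0: "E \<subseteq> {0<..}"
  shows "(\<integral>\<^sup>+t. ennreal (f t) * ennreal \<bar>dq t\<bar> * indicator {t \<in> ivl \<alpha>. q t \<in> E} t \<partial>lborel)
    \<le> (\<integral>\<^sup>+c. (if 0 < level_meas \<alpha> p c \<and> ereal (level_meas \<alpha> p c) < \<alpha> then ennreal (f (level_meas \<alpha> p c)) else 0) * indicator E c \<partial>lborel)"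
proof -
  let ?I = "ivl \<alpha>"
  let ?m = "level_meas \<alpha> p"
  have Im[measurable]: "?I \<in> sets borel" using open_ivl by (rule borel_open)
  have qm[measurable]: "q \<in> borel_measurable borel"
    using lip lipschitz_on_continuous_on borel_measurable_continuous_onI by blast
  have L0: "0 \<le> L" by (rule lipschitz_on_nonneg[OF lip])
  obtain N where N: "N \<in> null_sets lborel" "{t. \<not> (q has_real_derivative dq t) (at t)} \<subseteq> N"
    using der unfolding eventually_ae_filter by auto
  have Nm[measurable]: "N \<in> sets borel" using N(1) by (simp add: null_sets_def)
  define A where "A = {t \<in> ?I. q t \<in> E \<and> t \<notin> N \<and> dq t \<noteq> 0}"
  have Am[measurable]: "A \<in> sets borel" unfolding A_def by measurable
  have AD: "(q has_real_derivative dq t) (at t)" if "t \<in> A" for t using that N(2) by (auto simp: A_def)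
  have q0: "0 \<le> q t" if "t \<in> ?I" for t using q[OF that] rearr1_nonneg[OF prof] by simp
  have anti: "q t \<le> q s" if "s \<in> ?I" "t \<in> ?I" "s \<le> t" for s t
    using rearr1_antimono[OF prof, of s t] that q by (simp add: ivl_def)
  have strict: "q t < q s" if t: "t \<in> A" and s: "0 < s" "s < t" for s t
  proof (rule ccontr)
    assume n: "\<not> q t < q s"
    have tI: "t \<in> ?I" using t by (simp add: A_def)
    have inI: "r \<in> ?I" if "0 < r" "r \<le> t" for r using subsetD[OF ivl_downward[OF tI], of r] that by simp
    have const: "q r = q t" if r: "s \<le> r" "r \<le> t" for r
    proof (rule antisym)
      have rI: "r \<in> ?I" and sI: "s \<in> ?I" using inI[of r] inI[of s] r s by auto
      have "q r \<le> q s" using anti[OF sI rI] r by simp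
      then show "q r \<le> q t" using n by simp
      show "q t \<le> q r" using anti[OF rI tI] r by simp
    qed
    have "dq t = 0" by (rule DERIV_const_left[OF AD[OF t] s(2) const])
    then show False using t by (simp add: A_def)
  qed
  have mq: "?m (q t) = t" if t: "t \<in> A" for t
  proof (rule antisym)
    have tI: "t \<in> ?I" and t0: "0 < t" using t by (auto simp: A_def ivl_def)
    show "?m (q t) \<le> t"
      using rearr1_gt_iff[OF prof t0 q0[OF tI]] q[OF tI] by simp
    show "t \<le> ?m (q t)"
    proof (rule dense_le_bounded[OF t0])
      fix s assume s: "0 < s" "s < t"
      then have sI: "s \<in> ?I" using subsetD[OF ivl_downward[OF tI], of s] by simp
      have "q t < rearr1 \<alpha> p s" using strict[OF t s] q[OF sI] by simp
      then show "s \<le> ?m (q t)" using rearr1_gt_iff[OF prof s(1) q0[OF tI]] by simp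
    qed
  qed
  have inj: "inj_on q A" by (rule inj_on_inverseI[of A ?m]) (rule mq)
  define F where "F = (\<lambda>c. if 0 < ?m c \<and> ereal (?m c) < \<alpha> then f (?m c) else 0)"
  have Fq: "F (q t) = f t" if t: "t \<in> A" for t
    using mq[OF t] t by (simp add: F_def A_def ivl_def)
  have AK: "t \<le> real K" if t: "t \<in> A" for t
  proof -
    have tI: "t \<in> ?I" using t by (simp add: A_def)
    have qp: "0 < q t" using t E0 by (auto simp: A_def)
    then have "t < ?m 0" using rearr1_gt_iff[OF prof, of t 0] q[OF tI] tI by (simp add: ivl_def)
    also have "?m 0 \<le> measure lebesgue {0..real K}"
      unfolding level_meas_def
    proof (rule measure_mono_fmeasurable)
      show "{t \<in> ?I. 0 < p t} \<subseteq> {0..real K}"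
      proof
        fix s assume "s \<in> {t \<in> ?I. 0 < p t}"
        then show "s \<in> {0..real K}" using supp[of s] by (simp add: ivl_def)
      qed
      show "{t \<in> ?I. 0 < p t} \<in> sets lebesgue" using prof by (simp add: profile_def fmeasurableD)
    qed simp
    finally show ?thesis by simp
  qed
  have fm[measurable]: "(\<lambda>t. indicator ?I t * f t) \<in> borel_measurable borel"
    using borel_measurable_continuous_on_indicator[OF Im f(1)] by simp
  have eqA: "(\<lambda>t. indicator A t *\<^sub>R (\<bar>dq t\<bar> * F (q t))) = (\<lambda>t. indicator A t * (\<bar>dq t\<bar> * (indicator ?I t * f t)))"
    using Fq by (auto simp: fun_eq_iff A_def split: split_indicator)
  have mm: "(\<lambda>t. indicator A t * (\<bar>dq t\<bar> * (indicator ?I t * f t))) \<in> borel_measurable borel"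
    by (rule borel_measurable_times[OF _ borel_measurable_times[OF _ fm]]) measurable
  have int0: "integrable lborel (\<lambda>t. indicator A t * (\<bar>dq t\<bar> * (indicator ?I t * f t)))"
  proof (rule integrable_bounded_compact_support[where K="{0..real K}" and C="L * max 0 B"])
    fix t :: real assume tK: "t \<in> {0..real K}"
    show "norm (indicator A t * (\<bar>dq t\<bar> * (indicator ?I t * f t))) \<le> L * max 0 B"
    proof (cases "t \<in> A")
      case True
      then have tI: "t \<in> ?I" by (simp add: A_def)
      show ?thesis using True tI f(2)[OF tI] f(3)[OF tI AK[OF True]] bnd[of t] L0
        by (simp add: abs_mult mult_mono le_max_iff_disj)
    next
      case False
      then show ?thesis using L0 by simp
    qed
  next
    fix t :: real assume "t \<notin> {0..real K}"
    then have "t \<notin> A" using AK[of t] by (auto simp: A_def ivl_def)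
    then show "indicator A t * (\<bar>dq t\<bar> * (indicator ?I t * f t)) = 0" by simp
  qed (rule mm, simp)
  define b where "b = (LINT t|lborel. indicator A t * (\<bar>dq t\<bar> * (indicator ?I t * f t)))"
  have "(\<lambda>t. \<bar>dq t\<bar> * F (q t)) absolutely_integrable_on A"
    unfolding set_integrable_def eqA using int0 mm by (simp add: integrable_completion)
  moreover have "integral A (\<lambda>t. \<bar>dq t\<bar> * F (q t)) = b"
    unfolding set_lebesgue_integral_eq_integral(2)[OF calculation, symmetric]
    unfolding set_lebesgue_integral_def eqA b_def using mm by (simp add: integral_completion)
  ultimately have Fint: "F absolutely_integrable_on q ` A" "integral (q ` A) F = b"
    using has_absolute_integral_change_of_variables_1'[of A q dq F b] AD inj Am
    by (auto intro: has_field_derivative_at_within)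
  have F0: "0 \<le> F c" for c unfolding F_def using f(2)[of "?m c"] by (simp add: ivl_def)
  have qAE: "q ` A \<subseteq> E" by (auto simp: A_def)
  have "(\<integral>\<^sup>+t. ennreal (f t) * ennreal \<bar>dq t\<bar> * indicator {t \<in> ?I. q t \<in> E} t \<partial>lborel)
      = (\<integral>\<^sup>+t. ennreal (indicator A t * (\<bar>dq t\<bar> * (indicator ?I t * f t))) \<partial>lborel)"
  proof (rule nn_integral_cong_AE)
    have "AE t in lborel. t \<notin> N" using N(1) by (rule AE_not_in)
    then show "AE t in lborel. ennreal (f t) * ennreal \<bar>dq t\<bar> * indicator {t \<in> ?I. q t \<in> E} t
        = ennreal (indicator A t * (\<bar>dq t\<bar> * (indicator ?I t * f t)))"
    proof (rule eventually_mono)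
      fix t assume "t \<notin> N"
      then show "ennreal (f t) * ennreal \<bar>dq t\<bar> * indicator {t \<in> ?I. q t \<in> E} t
        = ennreal (indicator A t * (\<bar>dq t\<bar> * (indicator ?I t * f t)))"
        using f(2)[of t] by (auto simp: A_def ennreal_mult mult.commute split: split_indicator)
    qed
  qed
  also have "\<dots> = ennreal b"
    unfolding b_def by (rule nn_integral_eq_integral[OF int0]) (use f(2) in \<open>auto split: split_indicator\<close>)
  also have "ennreal b = (\<integral>\<^sup>+c. ennreal (indicator (q ` A) c *\<^sub>R F c) \<partial>lebesgue)"
  proof -
    have "b = (LINT c|lebesgue. indicator (q ` A) c *\<^sub>R F c)"
      using Fint set_lebesgue_integral_eq_integral(2)[OF Fint(1)] by (simp add: set_lebesgue_integral_def)
    then show ?thesis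
      using Fint(1) F0 unfolding set_integrable_def by (subst nn_integral_eq_integral) auto
  qed
  also have "\<dots> = (\<integral>\<^sup>+c. ennreal (indicator (q ` A) c *\<^sub>R F c) \<partial>lborel)" by (rule nn_integral_completion)
  also have "\<dots> \<le> (\<integral>\<^sup>+c. (if 0 < ?m c \<and> ereal (?m c) < \<alpha> then ennreal (f (?m c)) else 0) * indicator E c \<partial>lborel)"
    using qAE by (intro nn_integral_mono) (auto simp: F_def split: split_indicator)
  finally show ?thesis .
qed

text \<open>Between the two sides lies the integral of \<open>f (level_meas c)\<close> over the levels in \<open>E\<close>: it dominates the left side
  by substitution, and the right side dominates it by the coarea inequality and the combinatorial
  bound for the weight.\<close>

lemma weighted_coarea_rearrangement:
  fixes f p q dp dq :: "real \<Rightarrow> real"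
  assumes \<alpha>: "0 < \<alpha>" and prof: "profile \<alpha> M p"
    and q: "\<And>t. t \<in> ivl \<alpha> \<Longrightarrow> q t = rearr1 \<alpha> p t"
    and p: "L-lipschitz_on UNIV p" "dp \<in> borel_measurable borel" "\<And>t. \<bar>dp t\<bar> \<le> L"
      "AE t in lborel. (p has_real_derivative dp t) (at t)"
    and q': "L'-lipschitz_on UNIV q" "dq \<in> borel_measurable borel" "\<And>t. \<bar>dq t\<bar> \<le> L'"
      "AE t in lborel. (q has_real_derivative dq t) (at t)"
    and supp: "\<And>t. t \<in> ivl \<alpha> \<Longrightarrow> 0 < p t \<Longrightarrow> t \<le> real K"
    and f: "continuous_on (ivl \<alpha>) f" "\<And>t. t \<in> ivl \<alpha> \<Longrightarrow> 0 \<le> f t" "\<And>t. t \<in> ivl \<alpha> \<Longrightarrow> t \<le> real K \<Longrightarrow> f t \<le> B"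
    and tri: "\<And>s t. s \<in> ivl \<alpha> \<Longrightarrow> t \<in> ivl \<alpha> \<Longrightarrow> s < t \<Longrightarrow> f (t - s) \<le> f s + f t"
    and sym: "\<And>t. \<alpha> < \<infinity> \<Longrightarrow> t \<in> ivl \<alpha> \<Longrightarrow> f t = f (real_of_ereal \<alpha> - t)"
    and E: "E \<in> sets borel" "E \<subseteq> {0<..}"
  shows "(\<integral>\<^sup>+t. ennreal (f t) * ennreal \<bar>dq t\<bar> * indicator {t \<in> ivl \<alpha>. q t \<in> E} t \<partial>lborel)
    \<le> (\<integral>\<^sup>+t. ennreal (f t) * ennreal \<bar>dp t\<bar> * indicator {t \<in> ivl \<alpha>. p t \<in> E} t \<partial>lborel)"
proof (rule order_trans[OF rearrangement_change_of_variables[OF \<alpha> prof q q' supp f E]])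
  have pc: "continuous_on UNIV p" using p(1) lipschitz_on_continuous_on by blast
  have I0: "ivl \<alpha> \<subseteq> {0<..}" by (auto simp: ivl_def)
  show "(\<integral>\<^sup>+c. (if 0 < level_meas \<alpha> p c \<and> ereal (level_meas \<alpha> p c) < \<alpha> then ennreal (f (level_meas \<alpha> p c)) else 0) * indicator E c \<partial>lborel)
    \<le> (\<integral>\<^sup>+t. ennreal (f t) * ennreal \<bar>dp t\<bar> * indicator {t \<in> ivl \<alpha>. p t \<in> E} t \<partial>lborel)"
  proof (rule coarea_lower_bound[OF is_interval_ivl I0 p supp f(1,2) E])
    fix c assume c: "c \<in> E" and fin: "finite {t \<in> ivl \<alpha>. p t = c}"
    have c0: "0 < c" using c E(2) by auto
    show "(if 0 < level_meas \<alpha> p c \<and> ereal (level_meas \<alpha> p c) < \<alpha> then ennreal (f (level_meas \<alpha> p c)) else 0)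
        \<le> (\<Sum>t\<in>{t \<in> ivl \<alpha>. p t = c}. ennreal (f t))"
    proof (cases "0 < level_meas \<alpha> p c \<and> ereal (level_meas \<alpha> p c) < \<alpha>")
      case True
      then have "f (level_meas \<alpha> p c) \<le> (\<Sum>t\<in>{t \<in> ivl \<alpha>. p t = c}. f t)"
        using weight_le_preimage_sum[OF f(2) tri sym pc supp c0 fin] by simp
      then have "ennreal (f (level_meas \<alpha> p c)) \<le> ennreal (\<Sum>t\<in>{t \<in> ivl \<alpha>. p t = c}. f t)" by (rule ennreal_leI)
      also have "\<dots> = (\<Sum>t\<in>{t \<in> ivl \<alpha>. p t = c}. ennreal (f t))" using f(2) by (intro sum_ennreal[symmetric]) auto
      finally show ?thesis using True by simp
    next
      case False
      then show ?thesis by (subst if_not_P) simp_all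
    qed
  qed
qed

section \<open>Jensen's inequality on the fibres of a function\<close>

text \<open>The images of the weighted Lebesgue measures under \<open>p\<close> and \<open>q\<close>, restricted to positive levels, are finite
  Borel measures that agree on half-lines, hence are equal.\<close>

lemma weighted_distribution_eq:
  fixes p q a b :: "real \<Rightarrow> real"
  assumes [measurable]: "p \<in> borel_measurable borel" "q \<in> borel_measurable borel"
      "a \<in> borel_measurable borel" "b \<in> borel_measurable borel" "I \<in> sets borel"
    and eq: "\<And>s. 0 \<le> s \<Longrightarrow> (\<integral>\<^sup>+t. ennreal (a t) * indicator {t \<in> I. s < p t} t \<partial>lborel)
        = (\<integral>\<^sup>+t. ennreal (b t) * indicator {t \<in> I. s < q t} t \<partial>lborel)"
    and fin: "(\<integral>\<^sup>+t. ennreal (a t) * indicator {t \<in> I. 0 < p t} t \<partial>lborel) < \<infinity>"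
    and \<phi>: "\<phi> \<in> borel_measurable borel" "\<And>v. v \<le> 0 \<Longrightarrow> \<phi> v = 0"
  shows "(\<integral>\<^sup>+t. ennreal (a t) * (\<phi> (p t) * indicator I t) \<partial>lborel) = (\<integral>\<^sup>+t. ennreal (b t) * (\<phi> (q t) * indicator I t) \<partial>lborel)"
proof -
  define \<mu> where "\<mu> = (\<lambda>a p. distr (density lborel (\<lambda>t. ennreal (a t) * indicator {t \<in> I. 0 < p t} t)) borel p :: real measure)"
  have em: "emeasure (\<mu> a p) {s<..} = (\<integral>\<^sup>+t. ennreal (a t) * indicator {t \<in> I. max 0 s < p t} t \<partial>lborel)"
    if [measurable]: "a \<in> borel_measurable borel" "p \<in> borel_measurable borel" for a p :: "real \<Rightarrow> real" and s
  proof -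
    have "emeasure (\<mu> a p) {s<..} = (\<integral>\<^sup>+t. ennreal (a t) * indicator {t \<in> I. 0 < p t} t * indicator (p -` {s<..}) t \<partial>lborel)"
      unfolding \<mu>_def by (subst emeasure_distr) (auto intro!: emeasure_density measurable_sets_borel[OF that(2)])
    also have "\<dots> = (\<integral>\<^sup>+t. ennreal (a t) * indicator {t \<in> I. max 0 s < p t} t \<partial>lborel)"
      by (intro nn_integral_cong) (auto split: split_indicator)
    finally show ?thesis .
  qed
  have int: "(\<integral>\<^sup>+v. \<phi> v \<partial>\<mu> a p) = (\<integral>\<^sup>+t. ennreal (a t) * (\<phi> (p t) * indicator I t) \<partial>lborel)"
    if [measurable]: "a \<in> borel_measurable borel" "p \<in> borel_measurable borel" for a p :: "real \<Rightarrow> real"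
  proof -
    note \<phi>(1)[measurable]
    have "(\<integral>\<^sup>+v. \<phi> v \<partial>\<mu> a p) = (\<integral>\<^sup>+t. ennreal (a t) * indicator {t \<in> I. 0 < p t} t * \<phi> (p t) \<partial>lborel)"
      unfolding \<mu>_def by (subst nn_integral_distr) (auto intro!: nn_integral_density)
    also have "\<dots> = (\<integral>\<^sup>+t. ennreal (a t) * (\<phi> (p t) * indicator I t) \<partial>lborel)"
      using \<phi>(2) by (intro nn_integral_cong) (auto split: split_indicator simp: not_less)
    finally show ?thesis .
  qed
  have "\<mu> a p = \<mu> b q"
  proof (rule measure_eqI_lessThan)
    show "sets (\<mu> a p) = sets borel" "sets (\<mu> b q) = sets borel" by (auto simp: \<mu>_def)
    fix s
    have "emeasure (\<mu> a p) {s<..} \<le> (\<integral>\<^sup>+t. ennreal (a t) * indicator {t \<in> I. 0 < p t} t \<partial>lborel)"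
      unfolding em[OF assms(3,1)] by (rule nn_integral_mono) (auto split: split_indicator)
    then show "emeasure (\<mu> a p) {s<..} < \<infinity>" using fin by (rule le_less_trans)
    show "emeasure (\<mu> a p) {s<..} = emeasure (\<mu> b q) {s<..}"
      unfolding em[OF assms(3,1)] em[OF assms(4,2)] by (rule eq) simp
  qed
  then show ?thesis using int[of a p] int[of b q] by simp
qed

text \<open>The continuous image of a Borel set need not be Borel, but an \<open>F\<^sub>\<sigma>\<close> set in the line is
  \<open>\<sigma>\<close>-compact.\<close>

lemma fsigma_continuous_image_borel:
  fixes q :: "real \<Rightarrow> real"
  assumes C: "fsigma C" and q: "continuous_on UNIV q"
  shows "q ` C \<in> sets borel"
proof -
  obtain F :: "nat \<Rightarrow> real set" where F0: "range F \<subseteq> Collect compact" "C = \<Union>(range F)"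
    using C unfolding fsigma_Union_compact by blast
  then have F: "compact (F i)" for i by auto
  have "q ` C = (\<Union>i. q ` F i)" unfolding F0(2) by auto
  moreover have "q ` F i \<in> sets borel" for i
    by (intro borel_compact compact_continuous_image continuous_on_subset[OF q] F) auto
  ultimately show ?thesis by auto
qed

text \<open>If the pair of averages did not lie in the closed convex epigraph of \<open>\<phi>\<close>, a hyperplane would separate it
  strictly from the epigraph; averaging the separating inequality over \<open>D\<close> is a contradiction.\<close>

lemma convex_jensen_set:
  fixes X :: "'m \<Rightarrow> 'b::euclidean_space" and \<phi> :: "'b \<Rightarrow> real"
  assumes cvx: "convex_on UNIV \<phi>" and con: "continuous_on UNIV \<phi>"
    and D: "D \<in> sets M" "emeasure M D < \<infinity>" "0 < measure M D"
    and X: "set_integrable M D X" and \<phi>X: "set_integrable M D (\<lambda>t. \<phi> (X t))"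
  shows "measure M D * \<phi> ((1 / measure M D) *\<^sub>R (LINT t:D|M. X t)) \<le> (LINT t:D|M. \<phi> (X t))"
proof -
  let ?d = "measure M D"
  define Y where "Y = (1 / ?d) *\<^sub>R (LINT t:D|M. X t)"
  define r where "r = (1 / ?d) * (LINT t:D|M. \<phi> (X t))"
  define Ep where "Ep = {(x, y). \<phi> x \<le> y}"
  have Ep: "Ep = epigraph UNIV \<phi>" by (auto simp: Ep_def epigraph_def)
  have "convex Ep" unfolding Ep by (rule convex_epigraphI[OF cvx])
  have "closed {z :: 'b \<times> real. \<phi> (fst z) \<le> snd z}"
    by (intro closed_Collect_le continuous_on_compose2[OF con] continuous_on_fst continuous_on_snd continuous_on_id) simp
  then have "closed Ep" by (simp add: Ep epigraph_def)
  have "(Y, r) \<in> Ep"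
  proof (rule ccontr)
    assume "(Y, r) \<notin> Ep"
    then obtain a b where ab: "a \<bullet> (Y, r) < b" "\<And>z. z \<in> Ep \<Longrightarrow> b < a \<bullet> z"
      using separating_hyperplane_closed_point[OF \<open>convex Ep\<close> \<open>closed Ep\<close>, of "(Y, r)"] by blast
    define a1 where "a1 = fst a" define a2 where "a2 = snd a"
    have ia: "a \<bullet> (x, y) = x \<bullet> a1 + a2 * y" for x y
      by (cases a) (simp add: a1_def a2_def inner_commute)
    have 1: "set_integrable M D (\<lambda>t. X t \<bullet> a1)"
    proof -
      have "integrable M (\<lambda>t. (indicator D t *\<^sub>R X t) \<bullet> a1)"
        using X by (intro integrable_inner_left) (simp add: set_integrable_def)
      then show ?thesis by (simp add: set_integrable_def)
    qed
    have 2: "set_integrable M D (\<lambda>t. a2 * \<phi> (X t))" using \<phi>X by (rule set_integrable_mult_right)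
    have "?d * b = (LINT t:D|M. b)" using D by (simp add: set_lebesgue_integral_def mult.commute)
    also have "\<dots> \<le> (LINT t:D|M. X t \<bullet> a1 + a2 * \<phi> (X t))"
    proof (rule set_integral_mono)
      show "set_integrable M D (\<lambda>t. b)" using D by (simp add: set_integrable_def)
      show "set_integrable M D (\<lambda>t. X t \<bullet> a1 + a2 * \<phi> (X t))" using 1 2 by (rule set_integral_add)
      fix t
      have "(X t, \<phi> (X t)) \<in> Ep" by (simp add: Ep_def)
      then show "b \<le> X t \<bullet> a1 + a2 * \<phi> (X t)" using ab(2)[of "(X t, \<phi> (X t))"] unfolding ia by simp
    qed
    also have "\<dots> = (LINT t:D|M. X t \<bullet> a1) + a2 * (LINT t:D|M. \<phi> (X t))"
      using set_integral_add(2)[OF 1 2] by simp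
    also have "(LINT t:D|M. X t \<bullet> a1) = (LINT t:D|M. X t) \<bullet> a1"
      using integral_inner_left[OF X[unfolded set_integrable_def], of a1] by (simp add: set_lebesgue_integral_def)
    also have "\<dots> + a2 * (LINT t:D|M. \<phi> (X t)) = ?d * (a \<bullet> (Y, r))"
      using D(3) unfolding ia by (simp add: Y_def r_def field_simps)
    finally show False using ab(1) D(3) by simp
  qed
  then show ?thesis using D(3) unfolding Ep_def r_def Y_def by (simp add: field_simps)
qed

lemma set_integrable_bounded:
  fixes Y :: "'m \<Rightarrow> 'b::{banach,second_countable_topology}"
  assumes "S \<in> sets M" "emeasure M S < \<infinity>" and Y: "Y \<in> borel_measurable M" and b: "\<And>t. t \<in> S \<Longrightarrow> norm (Y t) \<le> B"
  shows "set_integrable M S Y"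
  unfolding set_integrable_def
proof (rule Bochner_Integration.integrable_bound)
  show "integrable M (\<lambda>t. B * indicator S t :: real)"
    using assms(1,2) by (intro integrable_mult_right integrable_real_indicator) auto
  show "(\<lambda>t. indicator S t *\<^sub>R Y t) \<in> borel_measurable M" using assms(1) Y by (intro borel_measurable_scaleR borel_measurable_indicator)
  show "AE t in M. norm (indicator S t *\<^sub>R Y t) \<le> norm (B * indicator S t)"
  proof (intro always_eventually allI)
    fix t show "norm (indicator S t *\<^sub>R Y t) \<le> norm (B * indicator S t)"
      using b[of t] by (cases "t \<in> S") auto
  qed
qed

lemma set_average_in_cball:
  fixes Y :: "'m \<Rightarrow> 'b::{banach,second_countable_topology}"
  assumes S: "S \<in> sets M" "emeasure M S < \<infinity>" "0 < measure M S" and Y: "set_integrable M S Y"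
    and b: "AE t in M. t \<in> S \<longrightarrow> norm (Y t - c) \<le> r"
  shows "norm ((1 / measure M S) *\<^sub>R (LINT t:S|M. Y t) - c) \<le> r"
proof -
  let ?d = "measure M S"
  have ic: "set_integrable M S (\<lambda>_. c)" and ir: "set_integrable M S (\<lambda>_. r)"
    using S by (auto simp: set_integrable_def)
  have iYc: "set_integrable M S (\<lambda>t. Y t - c)" by (rule set_integral_diff(1)[OF Y ic])
  have "(LINT t:S|M. Y t - c) = (LINT t:S|M. Y t) - ?d *\<^sub>R c"
    using set_integral_diff(2)[OF Y ic] S by (simp add: set_lebesgue_integral_def)
  then have "(1 / ?d) *\<^sub>R (LINT t:S|M. Y t) - c = (1 / ?d) *\<^sub>R (LINT t:S|M. Y t - c)"
    using S(3) by (simp add: scaleR_diff_right)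
  also have "norm \<dots> = (1 / ?d) * norm (LINT t:S|M. Y t - c)" using S(3) by simp
  also have "norm (LINT t:S|M. Y t - c) \<le> (LINT t:S|M. norm (Y t - c))"
    by (rule set_integral_norm_bound[OF iYc])
  also have "(LINT t:S|M. norm (Y t - c)) \<le> (LINT t:S|M. r)"
    by (rule set_integral_mono_AE[OF set_integrable_norm[OF iYc] ir b])
  also have "(LINT t:S|M. r) = ?d * r" using S by (simp add: set_lebesgue_integral_def)
  finally show ?thesis using S(3) by (simp add: field_simps)
qed

text \<open>The comparison on a set of levels on which \<open>(Q, \<tau>, q)\<close> hardly varies and stays near \<open>(z0, s0, v0)\<close>. The
  left integral is then about \<open>g z0 s0 v0\<close> times the measure. The average \<open>w\<close> of \<open>(Q, \<tau>)\<close> is near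
  \<open>(z0, s0)\<close>; the average \<open>y\<close> of \<open>(P, \<sigma>)\<close> has the same first component and a second component that is no
  smaller. So \<open>g\<close> at \<open>w\<close> is at most \<open>g\<close> at \<open>y\<close> by monotonicity, and Jensen's inequality for \<open>(P, \<sigma>)\<close>
  concludes. The continuity of \<open>g\<close> is used three times, at a cost of \<open>\<epsilon>\<close> each: to replace
  \<open>(Q, \<tau>, q)\<close> by \<open>(z0, s0, v0)\<close>, to replace \<open>(z0, s0)\<close> by \<open>w\<close>, and to replace \<open>v0\<close> by \<open>p\<close>.\<close>

lemma fibrewise_jensen_piece:
  fixes P Q :: "real \<Rightarrow> 'b::euclidean_space" and \<sigma> \<tau> p q :: "real \<Rightarrow> real"
    and g :: "'b \<Rightarrow> real \<Rightarrow> real \<Rightarrow> real"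
  assumes [measurable]: "P \<in> borel_measurable borel" "Q \<in> borel_measurable borel"
      "\<sigma> \<in> borel_measurable borel" "\<tau> \<in> borel_measurable borel"
    and Sp: "Sp \<in> sets borel" "emeasure lborel Sp < \<infinity>" and Sq: "Sq \<in> sets borel"
    and eqm: "emeasure lborel Sp = emeasure lborel Sq"
    and bp: "\<And>t. t \<in> Sp \<Longrightarrow> norm (P t) \<le> C \<and> 0 \<le> \<sigma> t \<and> \<sigma> t \<le> C \<and> 0 \<le> p t"
    and bq: "\<And>t. t \<in> Sq \<Longrightarrow> norm (Q t) \<le> C \<and> 0 \<le> \<tau> t \<and> \<tau> t \<le> C \<and> 0 \<le> q t"
    and PQ: "(LINT t:Sp|lborel. P t) = (LINT t:Sq|lborel. Q t)"
    and st: "(LINT t:Sq|lborel. \<tau> t) \<le> (LINT t:Sp|lborel. \<sigma> t)"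
    and con: "continuous_on (UNIV \<times> {0..}) (\<lambda>(z, s). g z s v0)"
    and cvx: "convex_on (UNIV \<times> {0..}) (\<lambda>(z, s). g z s v0)"
    and mono: "\<And>z. mono_on {0..} (\<lambda>s. g z s v0)"
    and nonneg: "\<And>z s. 0 \<le> s \<Longrightarrow> 0 \<le> g z s v0"
    and near: "\<And>z s. norm ((z, s) - (z0, s0)) \<le> r \<Longrightarrow> norm z \<le> C \<Longrightarrow> 0 \<le> s \<Longrightarrow> s \<le> C \<Longrightarrow> g z0 s0 v0 \<le> g z s v0 + \<epsilon>"
    and cq: "AE t in lborel. t \<in> Sq \<longrightarrow> norm ((Q t, \<tau> t) - (z0, s0)) \<le> r \<and> g (Q t) (\<tau> t) (q t) \<le> g z0 s0 v0 + \<epsilon>"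
    and cp: "\<And>t. t \<in> Sp \<Longrightarrow> g (P t) (\<sigma> t) v0 \<le> g (P t) (\<sigma> t) (p t) + \<epsilon>"
    and gm: "(\<lambda>t. g (P t) (\<sigma> t) (p t) * indicator Sp t) \<in> borel_measurable borel"
    and g0: "\<And>t. t \<in> Sp \<Longrightarrow> 0 \<le> g (P t) (\<sigma> t) (p t)"
    and \<epsilon>: "0 \<le> \<epsilon>" and z0: "0 \<le> s0"
  shows "(\<integral>\<^sup>+t. ennreal (g (Q t) (\<tau> t) (q t)) * indicator Sq t \<partial>lborel)
    \<le> (\<integral>\<^sup>+t. ennreal (g (P t) (\<sigma> t) (p t)) * indicator Sp t \<partial>lborel) + ennreal (3 * \<epsilon> * measure lborel Sp)"
proof (cases "measure lborel Sp = 0")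
  case True
  then have "emeasure lborel Sp = 0" using Sp(2) by (simp add: measure_eq_emeasure_eq_ennreal emeasure_eq_ennreal_measure)
  then have "emeasure lborel Sq = 0" using eqm by simp
  then have "AE t in lborel. t \<notin> Sq" using Sq by (intro AE_not_in) (simp add: null_sets_def)
  then have "(\<integral>\<^sup>+t. ennreal (g (Q t) (\<tau> t) (q t)) * indicator Sq t \<partial>lborel) = (\<integral>\<^sup>+t. 0 \<partial>(lborel :: real measure))"
    by (intro nn_integral_cong_AE) (auto elim!: eventually_mono)
  then show ?thesis by simp
next
  case False
  note [measurable] = Sp(1) Sq
  define d where "d = measure lborel Sp"
  have d0: "0 < d" using False unfolding d_def by (simp add: zero_less_measure_iff)
  have dq: "measure lborel Sq = d" using eqm by (simp add: d_def measure_def)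
  have Sqf: "emeasure lborel Sq < \<infinity>" using eqm Sp(2) by simp
  define Y where "Y = (\<lambda>t. (P t, \<sigma> t))"
  define W where "W = (\<lambda>t. (Q t, \<tau> t))"
  have Ym[measurable]: "Y \<in> borel_measurable borel" and Wm[measurable]: "W \<in> borel_measurable borel"
    unfolding Y_def W_def by (auto intro!: borel_measurable_Pair)
  have Yb: "norm (Y t) \<le> C + C" if "t \<in> Sp" for t
    using norm_Pair_le[of "P t" "\<sigma> t"] bp[OF that] by (simp add: Y_def)
  have Wb: "norm (W t) \<le> C + C" if "t \<in> Sq" for t
    using norm_Pair_le[of "Q t" "\<tau> t"] bq[OF that] by (simp add: W_def)
  have Yi: "set_integrable lborel Sp Y" using Sp Yb by (intro set_integrable_bounded) auto
  have Wi: "set_integrable lborel Sq W" using Sq Sqf Wb by (intro set_integrable_bounded) auto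
  define y where "y = (1 / d) *\<^sub>R (LINT t:Sp|lborel. Y t)"
  define w where "w = (1 / d) *\<^sub>R (LINT t:Sq|lborel. W t)"
  have fstY: "fst (LINT t:Sp|lborel. Y t) = (LINT t:Sp|lborel. P t)"
    using integral_bounded_linear[OF bounded_linear_fst Yi[unfolded set_integrable_def]]
    by (simp add: set_lebesgue_integral_def Y_def)
  have sndY: "snd (LINT t:Sp|lborel. Y t) = (LINT t:Sp|lborel. \<sigma> t)"
    using integral_bounded_linear[OF bounded_linear_snd Yi[unfolded set_integrable_def]]
    by (simp add: set_lebesgue_integral_def Y_def)
  have fstW: "fst (LINT t:Sq|lborel. W t) = (LINT t:Sq|lborel. Q t)"
    using integral_bounded_linear[OF bounded_linear_fst Wi[unfolded set_integrable_def]]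
    by (simp add: set_lebesgue_integral_def W_def)
  have sndW: "snd (LINT t:Sq|lborel. W t) = (LINT t:Sq|lborel. \<tau> t)"
    using integral_bounded_linear[OF bounded_linear_snd Wi[unfolded set_integrable_def]]
    by (simp add: set_lebesgue_integral_def W_def)
  have fst_eq: "fst y = fst w" by (simp add: y_def w_def fstY fstW PQ)
  have snd_le: "snd w \<le> snd y" using st d0 by (simp add: y_def w_def sndY sndW divide_right_mono)
  have Qi: "set_integrable lborel Sq Q" using Sq Sqf bq by (intro set_integrable_bounded) auto
  have \<tau>i: "set_integrable lborel Sq \<tau>" using Sq Sqf bq by (intro set_integrable_bounded[where B=C]) auto
  have wC: "norm (fst w) \<le> C"
    using set_average_in_cball[OF Sq[folded sets_lborel] Sqf _ Qi, of 0 C] d0 bq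
    by (simp add: dq w_def fstW)
  have ws: "\<bar>snd w - C / 2\<bar> \<le> C / 2"
  proof -
    have "AE t in lborel. t \<in> Sq \<longrightarrow> norm (\<tau> t - C / 2) \<le> C / 2"
    proof (intro always_eventually allI impI)
      fix t assume "t \<in> Sq"
      then have "0 \<le> \<tau> t" "\<tau> t \<le> C" using bq by blast+
      then show "norm (\<tau> t - C / 2) \<le> C / 2" unfolding real_norm_def by linarith
    qed
    from set_average_in_cball[OF Sq[folded sets_lborel] Sqf _ \<tau>i this] d0
    show ?thesis by (simp add: dq w_def sndW)
  qed
  have w0: "0 \<le> snd w" "snd w \<le> C" using ws by linarith+
  have wr: "norm (w - (z0, s0)) \<le> r"
  proof -
    have "AE t in lborel. t \<in> Sq \<longrightarrow> norm (W t - (z0, s0)) \<le> r"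
      using cq by (rule eventually_mono) (simp add: W_def)
    from set_average_in_cball[OF Sq[folded sets_lborel] Sqf _ Wi this] d0
    show ?thesis by (simp add: dq w_def)
  qed
  \<comment> \<open>extended constantly to negative second components, which keeps it convex by monotonicity\<close>
  define \<phi> where "\<phi> = (\<lambda>x. g (fst x) (max 0 (snd x)) v0)"
  have \<phi>cvx: "convex_on UNIV \<phi>"
  proof (rule convex_onI)
    fix t :: real and x x' :: "'b \<times> real" assume t: "0 < t" "t < 1"
    let ?s = "(1 - t) * max 0 (snd x) + t * max 0 (snd x')"
    have "max 0 ((1 - t) * snd x + t * snd x') \<le> ?s"
      using t by (intro max.boundedI add_mono mult_left_mono add_nonneg_nonneg mult_nonneg_nonneg) auto
    then have "\<phi> ((1 - t) *\<^sub>R x + t *\<^sub>R x') \<le> g ((1 - t) *\<^sub>R fst x + t *\<^sub>R fst x') ?s v0"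
      unfolding \<phi>_def using mono_onD[OF mono] by simp
    also have "\<dots> \<le> (1 - t) * \<phi> x + t * \<phi> x'"
      using convex_onD[OF cvx, of t "(fst x, max 0 (snd x))" "(fst x', max 0 (snd x'))"] t
      by (simp add: \<phi>_def)
    finally show "\<phi> ((1 - t) *\<^sub>R x + t *\<^sub>R x') \<le> (1 - t) * \<phi> x + t * \<phi> x'" .
  qed simp
  have \<phi>con: "continuous_on UNIV \<phi>"
  proof -
    have "continuous_on UNIV ((\<lambda>(z, s). g z s v0) \<circ> (\<lambda>x. (fst x, max 0 (snd x))))"
      by (rule continuous_on_compose) (auto intro!: continuous_intros continuous_on_subset[OF con])
    then show ?thesis by (simp add: \<phi>_def o_def)
  qed
  have \<phi>Y: "\<phi> (Y t) = g (P t) (\<sigma> t) v0" if "t \<in> Sp" for t using bp[OF that] by (simp add: \<phi>_def Y_def)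
  have "compact (\<phi> ` cball 0 (C + C))" by (intro compact_continuous_image continuous_on_subset[OF \<phi>con]) auto
  then have "bounded (\<phi> ` cball 0 (C + C))" by (rule compact_imp_bounded)
  then obtain B where "\<forall>v\<in>\<phi> ` cball 0 (C + C). norm v \<le> B" unfolding bounded_iff by blast
  then have B: "\<bar>\<phi> x\<bar> \<le> B" if "norm x \<le> C + C" for x using that by simp
  have \<phi>m[measurable]: "\<phi> \<in> borel_measurable borel" by (rule borel_measurable_continuous_onI[OF \<phi>con])
  have \<phi>i: "set_integrable lborel Sp (\<lambda>t. \<phi> (Y t))"
    using Sp B[OF Yb] by (intro set_integrable_bounded) auto
  have jensen: "d * \<phi> y \<le> (LINT t:Sp|lborel. \<phi> (Y t))"
    using convex_jensen_set[OF \<phi>cvx \<phi>con _ Sp(2) _ Yi \<phi>i] Sp(1) d0 by (simp add: d_def y_def)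
  have "g z0 s0 v0 \<le> g (fst w) (snd w) v0 + \<epsilon>" using near[of "fst w" "snd w"] wr wC w0 by simp
  also have "g (fst w) (snd w) v0 \<le> \<phi> y"
    unfolding \<phi>_def fst_eq using snd_le w0 by (intro mono_onD[OF mono]) auto
  finally have center: "g z0 s0 v0 \<le> \<phi> y + \<epsilon>" by simp
  have "(\<integral>\<^sup>+t. ennreal (g (Q t) (\<tau> t) (q t)) * indicator Sq t \<partial>lborel)
      \<le> (\<integral>\<^sup>+t. ennreal (g z0 s0 v0 + \<epsilon>) * indicator Sq t \<partial>lborel)"
    using cq by (intro nn_integral_mono_AE) (auto elim!: eventually_mono intro: ennreal_leI split: split_indicator)
  also have "\<dots> = ennreal (g z0 s0 v0 + \<epsilon>) * emeasure lborel Sq" by (simp add: nn_integral_cmult_indicator)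
  also have "emeasure lborel Sq = ennreal d" using Sqf dq by (simp add: emeasure_eq_ennreal_measure)
  also have "ennreal (g z0 s0 v0 + \<epsilon>) * ennreal d = ennreal ((g z0 s0 v0 + \<epsilon>) * d)"
    using nonneg[OF z0] \<epsilon> d0 by (simp add: ennreal_mult)
  also have "\<dots> \<le> ennreal ((LINT t:Sp|lborel. \<phi> (Y t)) + 2 * \<epsilon> * d)"
  proof (rule ennreal_leI)
    have "(g z0 s0 v0 + \<epsilon>) * d \<le> (\<phi> y + 2 * \<epsilon>) * d" using center d0 by (intro mult_right_mono) auto
    also have "\<dots> = d * \<phi> y + 2 * \<epsilon> * d" by (simp add: algebra_simps)
    finally show "(g z0 s0 v0 + \<epsilon>) * d \<le> (LINT t:Sp|lborel. \<phi> (Y t)) + 2 * \<epsilon> * d" using jensen by linarith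
  qed
  also have "\<dots> = ennreal (LINT t:Sp|lborel. \<phi> (Y t)) + ennreal (2 * \<epsilon> * d)"
  proof (rule ennreal_plus)
    show "0 \<le> (LINT t:Sp|lborel. \<phi> (Y t))"
      unfolding set_lebesgue_integral_def using nonneg \<phi>Y bp
      by (intro integral_nonneg_AE always_eventually allI) (auto split: split_indicator)
  qed (use \<epsilon> d0 in simp)
  also have "ennreal (LINT t:Sp|lborel. \<phi> (Y t)) = (\<integral>\<^sup>+t. ennreal (indicator Sp t *\<^sub>R \<phi> (Y t)) \<partial>lborel)"
    unfolding set_lebesgue_integral_def
    by (rule nn_integral_eq_integral[symmetric, OF \<phi>i[unfolded set_integrable_def]])
       (use nonneg \<phi>Y bp in \<open>auto split: split_indicator\<close>)
  also have "\<dots> \<le> (\<integral>\<^sup>+t. ennreal (g (P t) (\<sigma> t) (p t) * indicator Sp t) + ennreal \<epsilon> * indicator Sp t \<partial>lborel)"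
  proof (rule nn_integral_mono)
    fix t
    show "ennreal (indicator Sp t *\<^sub>R \<phi> (Y t)) \<le> ennreal (g (P t) (\<sigma> t) (p t) * indicator Sp t) + ennreal \<epsilon> * indicator Sp t"
    proof (cases "t \<in> Sp")
      case True
      have "ennreal (\<phi> (Y t)) \<le> ennreal (g (P t) (\<sigma> t) (p t) + \<epsilon>)"
        using cp[OF True] \<phi>Y[OF True] by (intro ennreal_leI) simp
      also have "\<dots> = ennreal (g (P t) (\<sigma> t) (p t)) + ennreal \<epsilon>" using g0[OF True] \<epsilon> by (rule ennreal_plus)
      finally show ?thesis using True by simp
    qed simp
  qed
  also have "\<dots> = (\<integral>\<^sup>+t. ennreal (g (P t) (\<sigma> t) (p t) * indicator Sp t) \<partial>lborel) + ennreal \<epsilon> * emeasure lborel Sp"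
    using gm by (subst nn_integral_add) (auto simp: nn_integral_cmult_indicator)
  also have "emeasure lborel Sp = ennreal d" using Sp(2) by (simp add: d_def emeasure_eq_ennreal_measure)
  also have "(\<integral>\<^sup>+t. ennreal (g (P t) (\<sigma> t) (p t) * indicator Sp t) \<partial>lborel) = (\<integral>\<^sup>+t. ennreal (g (P t) (\<sigma> t) (p t)) * indicator Sp t \<partial>lborel)"
    by (intro nn_integral_cong) (auto split: split_indicator)
  also have "ennreal \<epsilon> * ennreal d = ennreal (\<epsilon> * d)" using \<epsilon> d0 by (simp add: ennreal_mult)
  finally have "(\<integral>\<^sup>+t. ennreal (g (Q t) (\<tau> t) (q t)) * indicator Sq t \<partial>lborel)
      \<le> (\<integral>\<^sup>+t. ennreal (g (P t) (\<sigma> t) (p t)) * indicator Sp t \<partial>lborel) + (ennreal (\<epsilon> * d) + ennreal (2 * \<epsilon> * d))"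
    by (simp add: add.assoc)
  also have "ennreal (\<epsilon> * d) + ennreal (2 * \<epsilon> * d) = ennreal (3 * \<epsilon> * d)"
    using \<epsilon> d0 by (subst ennreal_plus[symmetric]) (auto simp: algebra_simps)
  finally show ?thesis by (simp add: d_def)
qed

lemma borel_measurable_compose_continuous_on:
  fixes F :: "'c::topological_space \<Rightarrow> real"
  assumes F: "continuous_on S F" and S: "S \<in> sets borel" and X: "X \<in> borel_measurable M"
    and A: "A \<in> sets M" and sub: "\<And>t. t \<in> A \<Longrightarrow> X t \<in> S"
  shows "(\<lambda>t. F (X t) * indicator A t) \<in> borel_measurable M"
proof -
  have m: "(\<lambda>x. indicator S x *\<^sub>R F x) \<in> borel_measurable borel"
    by (rule borel_measurable_continuous_on_indicator[OF S F])
  have "(\<lambda>t. F (X t) * indicator A t) = (\<lambda>t. (indicator S (X t) *\<^sub>R F (X t)) * indicator A t)"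
    using sub by (auto simp: fun_eq_iff split: split_indicator)
  also have "\<dots> \<in> borel_measurable M"
    using A by (intro borel_measurable_times measurable_compose[OF X m] borel_measurable_indicator)
  finally show ?thesis .
qed

text \<open>Off the null set \<open>Z\<close> the triple \<open>(Q, \<tau>, q)\<close> is a function of \<open>q\<close> alone. Cut its compact range into finitely
  many small pieces: the preimage \<open>A k\<close> of a piece is then given by a set of levels, so that the
  averages of \<open>(P, \<sigma>)\<close> and \<open>(Q, \<tau>)\<close> over the corresponding parts of the line can be compared. To have a
  Borel set \<open>E k\<close> of levels, take the image under \<open>q\<close> of an \<open>F\<^sub>\<sigma>\<close> subset of full measure in \<open>A k\<close>.\<close>

lemma fibrewise_jensen:
  fixes P Q :: "real \<Rightarrow> 'b::euclidean_space" and \<sigma> \<tau> p q :: "real \<Rightarrow> real"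
    and g :: "'b \<Rightarrow> real \<Rightarrow> real \<Rightarrow> real"
  assumes Pm[measurable]: "P \<in> borel_measurable borel" and Qm[measurable]: "Q \<in> borel_measurable borel"
    and \<sigma>m[measurable]: "\<sigma> \<in> borel_measurable borel" and \<tau>m[measurable]: "\<tau> \<in> borel_measurable borel"
    and pm[measurable]: "p \<in> borel_measurable borel" and qc: "continuous_on UNIV q" and Im[measurable]: "I \<in> sets borel"
    and bp: "\<And>t. t \<in> I \<Longrightarrow> norm (P t) \<le> C \<and> 0 \<le> \<sigma> t \<and> \<sigma> t \<le> C \<and> 0 \<le> p t \<and> p t \<le> M"
    and bq: "\<And>t. t \<in> I \<Longrightarrow> norm (Q t) \<le> C \<and> 0 \<le> \<tau> t \<and> \<tau> t \<le> C \<and> 0 \<le> q t \<and> q t \<le> M"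
    and fin: "emeasure lborel {t \<in> I. 0 < p t} < \<infinity>"
    and eqm: "\<And>E. E \<in> sets borel \<Longrightarrow> E \<subseteq> {0<..} \<Longrightarrow> emeasure lborel {t \<in> I. p t \<in> E} = emeasure lborel {t \<in> I. q t \<in> E}"
    and PQ: "\<And>E. E \<in> sets borel \<Longrightarrow> E \<subseteq> {0<..} \<Longrightarrow> (LINT t:{t \<in> I. p t \<in> E}|lborel. P t) = (LINT t:{t \<in> I. q t \<in> E}|lborel. Q t)"
    and st: "\<And>E. E \<in> sets borel \<Longrightarrow> E \<subseteq> {0<..} \<Longrightarrow> (LINT t:{t \<in> I. q t \<in> E}|lborel. \<tau> t) \<le> (LINT t:{t \<in> I. p t \<in> E}|lborel. \<sigma> t)"
    and Z: "Z \<in> null_sets lborel"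
    and sat: "\<And>s t. s \<in> I - Z \<Longrightarrow> t \<in> I - Z \<Longrightarrow> q s = q t \<Longrightarrow> Q s = Q t \<and> \<tau> s = \<tau> t"
    and gc: "continuous_on (UNIV \<times> {0..} \<times> {0..}) (\<lambda>(z, s, v). g z s v)"
    and cvx: "\<And>v. 0 \<le> v \<Longrightarrow> convex_on (UNIV \<times> {0..}) (\<lambda>(z, s). g z s v)"
    and mono: "\<And>z v. 0 \<le> v \<Longrightarrow> mono_on {0..} (\<lambda>s. g z s v)"
    and nonneg: "\<And>z s v. 0 \<le> s \<Longrightarrow> 0 \<le> v \<Longrightarrow> 0 \<le> g z s v"
  shows "(\<integral>\<^sup>+t. ennreal (g (Q t) (\<tau> t) (q t)) * indicator {t \<in> I. 0 < q t} t \<partial>lborel)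
    \<le> (\<integral>\<^sup>+t. ennreal (g (P t) (\<sigma> t) (p t)) * indicator {t \<in> I. 0 < p t} t \<partial>lborel)"
proof (rule ennreal_le_epsilon)
  fix e :: real assume e: "0 < e"
  let ?GQ = "\<lambda>t. ennreal (g (Q t) (\<tau> t) (q t))" and ?GP = "\<lambda>t. ennreal (g (P t) (\<sigma> t) (p t))"
  have qm[measurable]: "q \<in> borel_measurable borel" by (rule borel_measurable_continuous_onI[OF qc])
  have Zm[measurable]: "Z \<in> sets borel" using Z by (simp add: null_sets_def)
  define m where "m = measure lborel {t \<in> I. 0 < p t}"
  define \<epsilon> where "\<epsilon> = e / (3 * (m + 1))"
  have m0: "0 \<le> m" by (simp add: m_def)
  have \<epsilon>: "0 < \<epsilon>" using e m0 by (simp add: \<epsilon>_def)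
  have "3 * \<epsilon> * m = e * (m / (m + 1))" using m0 by (simp add: \<epsilon>_def field_simps)
  also have "\<dots> \<le> e * 1" using e m0 by (intro mult_left_mono) auto
  also have "\<dots> = e" by simp
  finally have \<epsilon>m: "3 * \<epsilon> * m \<le> e" .
  define gx where "gx = (\<lambda>(z, s, v). g z s v)"
  define Bx where "Bx = cball (0::'b) C \<times> {0..C} \<times> {0..M}"
  have Bxc: "compact Bx" unfolding Bx_def by (intro compact_Times compact_cball compact_Icc)
  have Bsub: "Bx \<subseteq> UNIV \<times> {0..} \<times> {0..}" by (auto simp: Bx_def)
  have "uniformly_continuous_on Bx gx"
    using compact_uniformly_continuous[OF continuous_on_subset[OF gc Bsub] Bxc] by (simp add: gx_def)
  then obtain \<delta> where \<delta>: "\<delta> > 0" "\<And>x y. x \<in> Bx \<Longrightarrow> y \<in> Bx \<Longrightarrow> dist y x < \<delta> \<Longrightarrow> dist (gx y) (gx x) < \<epsilon>"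
    using \<epsilon> unfolding uniformly_continuous_on_def by meson
  obtain T where T: "T \<subseteq> Bx" "finite T" "Bx \<subseteq> (\<Union>c\<in>T. ball c (\<delta> / 2))"
  proof (rule compactE_image[OF Bxc, of Bx "\<lambda>c. ball c (\<delta> / 2)"])
    show "Bx \<subseteq> (\<Union>c\<in>Bx. ball c (\<delta> / 2))" using \<delta>(1) by (intro subsetI UN_I) auto
  qed (use that in auto)
  obtain c where c: "bij_betw c {..<card T} T" using ex_bij_betw_nat_finite[OF T(2)] by (auto simp: lessThan_atLeast0)
  let ?n = "card T"
  have cT: "c k \<in> Bx" if "k < ?n" for k using bij_betwE[OF c] that T(1) by auto
  define X where "X = (\<lambda>t. (Q t, \<tau> t, q t))"
  have Xm[measurable]: "X \<in> borel_measurable borel" unfolding X_def by (intro borel_measurable_Pair) auto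
  have XB: "X t \<in> Bx" if "t \<in> I" for t using bq[OF that] by (simp add: X_def Bx_def)
  \<comment> \<open>made disjoint by choosing the first ball that contains the value\<close>
  define A where "A = (\<lambda>k. {t \<in> I. t \<notin> Z \<and> 0 < q t \<and> X t \<in> ball (c k) (\<delta> / 2) \<and> (\<forall>j\<in>{..<k}. X t \<notin> ball (c j) (\<delta> / 2))})"
  have Am: "A k \<in> sets borel" for k unfolding A_def mem_ball by measurable
  have Acov: "\<exists>k<?n. t \<in> A k" if t: "t \<in> I" "t \<notin> Z" "0 < q t" for t
  proof -
    have "\<exists>k. k < ?n \<and> X t \<in> ball (c k) (\<delta> / 2)"
    proof -
      obtain x where x: "x \<in> T" "X t \<in> ball x (\<delta> / 2)" using XB[OF t(1)] T(3) by blast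
      then obtain k where "k < ?n" "c k = x" using bij_betw_imp_surj_on[OF c] by (metis imageE lessThan_iff)
      then show ?thesis using x(2) by blast
    qed
    then obtain k where k: "k < ?n \<and> X t \<in> ball (c k) (\<delta> / 2)"
      "\<And>j. j < k \<Longrightarrow> \<not> (j < ?n \<and> X t \<in> ball (c j) (\<delta> / 2))"
      using exists_least_iff[of "\<lambda>k. k < ?n \<and> X t \<in> ball (c k) (\<delta> / 2)"] by blast
    then have "t \<in> A k" using t unfolding A_def by simp
    then show ?thesis using k(1) by blast
  qed
  have Auniq: "j = k" if st: "s \<in> A j" "t \<in> A k" "X s = X t" for j k s t
  proof (rule linorder_cases[of j k])
    assume "j < k" then show ?thesis using st unfolding A_def by auto
  next
    assume "k < j" then show ?thesis using st unfolding A_def by auto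
  qed
  have Xsat: "X s = X t" if "s \<in> I - Z" "t \<in> I - Z" "q s = q t" for s t
    using sat[OF that] that(3) by (simp add: X_def)
  have "\<exists>F N. fsigma F \<and> N \<in> null_sets lebesgue \<and> F \<union> N = A k" for k
    using lebesgue_set_almost_fsigma[of "A k"] Am[of k] by (metis sets_completionI_sets sets_lborel)
  then obtain F N where F: "\<And>k. fsigma (F k)" "\<And>k. N k \<in> null_sets lebesgue" "\<And>k. F k \<union> N k = A k" by metis
  define E where "E = (\<lambda>k. q ` F k)"
  have FA: "F k \<subseteq> A k" for k using F(3)[of k] by blast
  have Em[measurable]: "E k \<in> sets borel" for k unfolding E_def by (rule fsigma_continuous_image_borel[OF F(1) qc])
  have E0: "E k \<subseteq> {0<..}" for k using FA[of k] by (auto simp: E_def A_def)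
  have EA: "t \<in> A k" if t: "t \<in> I" "t \<notin> Z" "q t \<in> E k" "k < ?n" for t k
  proof -
    obtain s where s: "s \<in> F k" "q t = q s" using t(3) by (auto simp: E_def)
    have sA: "s \<in> A k" using FA s(1) by blast
    then have sI: "s \<in> I - Z" by (simp add: A_def)
    have X: "X s = X t" using Xsat[of s t] sI t(1,2) s(2) by simp
    have "0 < q t" using sA s(2) by (simp add: A_def)
    then show ?thesis using sA t(1,2) X[symmetric] by (simp add: A_def)
  qed
  have Edis: "disjoint_family_on E {..<?n}"
    unfolding disjoint_family_on_def
  proof (intro ballI impI)
    fix j k assume jk: "j \<in> {..<?n}" "k \<in> {..<?n}" "j \<noteq> k"
    show "E j \<inter> E k = {}"
    proof (rule ccontr)
      assume "E j \<inter> E k \<noteq> {}"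
      then obtain s t where s: "s \<in> F j" "t \<in> F k" "q s = q t" by (auto simp: E_def)
      then have sA: "s \<in> A j" "t \<in> A k" using FA by blast+
      then have "X s = X t" using s(3) by (intro Xsat) (auto simp: A_def)
      then show False using Auniq[OF sA] jk(3) by blast
    qed
  qed
  define Sp where "Sp = (\<lambda>k. {t \<in> I. p t \<in> E k})"
  define Sq where "Sq = (\<lambda>k. {t \<in> I. q t \<in> E k})"
  have Spm[measurable]: "Sp k \<in> sets borel" and Sqm[measurable]: "Sq k \<in> sets borel" for k
    unfolding Sp_def Sq_def by measurable
  have Spsub: "Sp k \<subseteq> {t \<in> I. 0 < p t}" for k using E0[of k] by (auto simp: Sp_def)
  have Spf: "emeasure lborel (Sp k) < \<infinity>" for k
    using emeasure_mono[OF Spsub[of k], of lborel] fin by (auto intro: le_less_trans)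
  have Spdis: "disjoint_family_on Sp {..<?n}"
    using Edis unfolding disjoint_family_on_def Sp_def by blast
  have Gm: "(\<lambda>t. g (R t) (\<rho> t) (r t) * indicator S t) \<in> borel_measurable borel"
    if R[measurable]: "R \<in> borel_measurable borel" "\<rho> \<in> borel_measurable borel" "r \<in> borel_measurable borel" and S: "S \<in> sets borel"
      and b: "\<And>t. t \<in> S \<Longrightarrow> 0 \<le> \<rho> t \<and> 0 \<le> r t" for R :: "real \<Rightarrow> 'b" and \<rho> r S
  proof -
    have X: "(\<lambda>t. (R t, \<rho> t, r t)) \<in> borel_measurable borel" by (intro borel_measurable_Pair R)
    have "UNIV \<times> {0..} \<times> {0..} \<in> sets (borel :: ('b \<times> real \<times> real) measure)" by (intro borel_closed closed_Times) auto
    from borel_measurable_compose_continuous_on[OF gc this X S] b show ?thesis by simp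
  qed
  have gPm: "(\<lambda>t. g (P t) (\<sigma> t) (p t) * indicator S t) \<in> borel_measurable borel"
    and gQm: "(\<lambda>t. g (Q t) (\<tau> t) (q t) * indicator S t) \<in> borel_measurable borel"
    if S: "S \<in> sets borel" "S \<subseteq> I" for S
    using bp bq S(2) by (blast intro!: Gm Pm \<sigma>m pm Qm \<tau>m qm S(1))+
  have AEZ: "AE t in lborel. t \<notin> Z" using Z by (rule AE_not_in)
  have piece: "(\<integral>\<^sup>+t. ?GQ t * indicator (Sq k) t \<partial>lborel)
    \<le> (\<integral>\<^sup>+t. ?GP t * indicator (Sp k) t \<partial>lborel) + ennreal (3 * \<epsilon> * measure lborel (Sp k))"
    if k: "k < ?n" for k
  proof -
    obtain z0 s0 v0 where ck: "c k = (z0, s0, v0)" by (cases "c k") auto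
    have cB: "norm z0 \<le> C" "0 \<le> s0" "s0 \<le> C" "0 \<le> v0" "v0 \<le> M" using cT[OF k] by (auto simp: ck Bx_def)
    have slice: "continuous_on (UNIV \<times> {0..}) (\<lambda>(z, s). g z s v0)"
    proof -
      have eq: "(\<lambda>(z, s). g z s v0) = gx \<circ> (\<lambda>x. (fst x, snd x, v0))" by (auto simp: gx_def fun_eq_iff)
      have sub: "(\<lambda>x. (fst x, snd x, v0)) ` (UNIV \<times> {0..}) \<subseteq> UNIV \<times> {0..} \<times> {0..}" using cB(4) by auto
      show ?thesis unfolding eq
        by (rule continuous_on_compose[OF _ continuous_on_subset[OF gc[folded gx_def] sub]]) (intro continuous_intros)
    qed
    show ?thesis
    proof (rule fibrewise_jensen_piece[where g=g and p=p and q=q and ?v0.0=v0 and ?z0.0=z0 and ?s0.0=s0 and r="\<delta> / 2" and C=C])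
      show "emeasure lborel (Sp k) < \<infinity>" by (rule Spf)
      show "emeasure lborel (Sp k) = emeasure lborel (Sq k)" unfolding Sp_def Sq_def by (rule eqm[OF Em E0])
      show "(LINT t:Sp k|lborel. P t) = (LINT t:Sq k|lborel. Q t)" unfolding Sp_def Sq_def by (rule PQ[OF Em E0])
      show "(LINT t:Sq k|lborel. \<tau> t) \<le> (LINT t:Sp k|lborel. \<sigma> t)" unfolding Sp_def Sq_def by (rule st[OF Em E0])
      show "norm (P t) \<le> C \<and> 0 \<le> \<sigma> t \<and> \<sigma> t \<le> C \<and> 0 \<le> p t" if "t \<in> Sp k" for t using bp[of t] that by (simp add: Sp_def)
      show "norm (Q t) \<le> C \<and> 0 \<le> \<tau> t \<and> \<tau> t \<le> C \<and> 0 \<le> q t" if "t \<in> Sq k" for t using bq[of t] that by (simp add: Sq_def)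
      show "convex_on (UNIV \<times> {0..}) (\<lambda>(z, s). g z s v0)" by (rule cvx[OF cB(4)])
      show "mono_on {0..} (\<lambda>s. g z s v0)" for z by (rule mono[OF cB(4)])
      show "0 \<le> g z s v0" if "0 \<le> s" for z s by (rule nonneg[OF that cB(4)])
      show "g z0 s0 v0 \<le> g z s v0 + \<epsilon>"
        if zs: "norm ((z, s) - (z0, s0)) \<le> \<delta> / 2" "norm z \<le> C" "0 \<le> s" "s \<le> C" for z s
      proof -
        have "dist (z, s, v0) (z0, s0, v0) \<le> \<delta> / 2"
          using zs(1) by (simp add: dist_norm norm_Pair)
        then have "dist (gx (z, s, v0)) (gx (z0, s0, v0)) < \<epsilon>"
          using \<delta>(1) zs cB by (intro \<delta>(2)) (auto simp: Bx_def)
        then show ?thesis by (simp add: gx_def dist_real_def)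
      qed
      show "AE t in lborel. t \<in> Sq k \<longrightarrow> norm ((Q t, \<tau> t) - (z0, s0)) \<le> \<delta> / 2 \<and> g (Q t) (\<tau> t) (q t) \<le> g z0 s0 v0 + \<epsilon>"
        using AEZ
      proof (rule eventually_mono, intro impI)
        fix t assume t: "t \<notin> Z" "t \<in> Sq k"
        then have tI: "t \<in> I" by (simp add: Sq_def)
        have "t \<in> A k" using t tI k by (intro EA) (auto simp: Sq_def)
        then have d: "dist (X t) (c k) < \<delta> / 2" by (simp add: A_def dist_commute)
        have "dist (fst (X t), fst (snd (X t))) (z0, s0) \<le> dist (X t) (c k)"
          unfolding ck X_def dist_Pair_Pair by (simp add: real_sqrt_le_mono)
        then have 1: "norm ((Q t, \<tau> t) - (z0, s0)) \<le> \<delta> / 2" using d by (simp add: X_def dist_norm)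
        have "dist (gx (X t)) (gx (c k)) < \<epsilon>" using d \<delta>(1) by (intro \<delta>(2) cT[OF k] XB[OF tI]) auto
        then have "g (Q t) (\<tau> t) (q t) \<le> g z0 s0 v0 + \<epsilon>" by (simp add: gx_def X_def ck dist_real_def)
        with 1 show "norm ((Q t, \<tau> t) - (z0, s0)) \<le> \<delta> / 2 \<and> g (Q t) (\<tau> t) (q t) \<le> g z0 s0 v0 + \<epsilon>" by blast
      qed
      show "g (P t) (\<sigma> t) v0 \<le> g (P t) (\<sigma> t) (p t) + \<epsilon>" if t: "t \<in> Sp k" for t
      proof -
        have tI: "t \<in> I" using t by (simp add: Sp_def)
        obtain s where s: "s \<in> F k" "p t = q s" using t by (auto simp: Sp_def E_def)
        then have "s \<in> A k" using FA by blast
        then have d: "dist (X s) (c k) < \<delta> / 2" by (simp add: A_def dist_commute)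
        have "dist (snd (snd (X s))) (snd (snd (c k))) \<le> dist (X s) (c k)"
          using order_trans[OF dist_snd_le dist_snd_le] .
        then have "dist v0 (p t) < \<delta>" using d \<delta>(1) s(2) by (simp add: X_def ck dist_commute)
        then have "dist (P t, \<sigma> t, v0) (P t, \<sigma> t, p t) < \<delta>" by (simp add: dist_Pair_Pair)
        then have "dist (gx (P t, \<sigma> t, v0)) (gx (P t, \<sigma> t, p t)) < \<epsilon>"
          using bp[OF tI] cB by (intro \<delta>(2)) (auto simp: Bx_def)
        then show ?thesis by (simp add: gx_def dist_real_def)
      qed
      show "(\<lambda>t. g (P t) (\<sigma> t) (p t) * indicator (Sp k) t) \<in> borel_measurable borel"
        by (rule gPm[OF Spm]) (auto simp: Sp_def)
      show "0 \<le> g (P t) (\<sigma> t) (p t)" if "t \<in> Sp k" for t using bp[of t] that by (intro nonneg) (auto simp: Sp_def)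
    qed (use Pm Qm \<sigma>m \<tau>m Spm Sqm slice \<epsilon> cB in simp_all)
  qed
  have enn: "?GQ t * indicator S t = ennreal (g (Q t) (\<tau> t) (q t) * indicator S t)"
    "?GP t * indicator S t = ennreal (g (P t) (\<sigma> t) (p t) * indicator S t)" for S t
    by (auto split: split_indicator)
  have "(\<integral>\<^sup>+t. ?GQ t * indicator {t \<in> I. 0 < q t} t \<partial>lborel)
      \<le> (\<integral>\<^sup>+t. (\<Sum>k<?n. ?GQ t * indicator (Sq k) t) \<partial>lborel)"
  proof (rule nn_integral_mono_AE)
    define NN where "NN = (\<Union>k<?n. N k)"
    have "AE t in lebesgue. t \<notin> NN" unfolding NN_def using F(2) by (intro AE_not_in null_sets_UN') auto
    then have "AE t in lborel. t \<notin> NN" by (simp add: AE_completion_iff)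
    then show "AE t in lborel. ?GQ t * indicator {t \<in> I. 0 < q t} t
        \<le> (\<Sum>k<?n. ?GQ t * indicator (Sq k) t)"
      using AEZ
    proof eventually_elim
      fix t assume t: "t \<notin> NN" "t \<notin> Z"
      show "?GQ t * indicator {t \<in> I. 0 < q t} t
        \<le> (\<Sum>k<?n. ?GQ t * indicator (Sq k) t)"
      proof (cases "t \<in> {t \<in> I. 0 < q t}")
        case True
        then obtain k where k: "k < ?n" "t \<in> A k" using Acov[of t] t(2) by auto
        then have "t \<in> F k" using F(3)[of k] t(1) unfolding NN_def by blast
        then have "t \<in> Sq k" using True by (auto simp: Sq_def E_def)
        then have "?GQ t * indicator {t \<in> I. 0 < q t} t
            = ?GQ t * indicator (Sq k) t" using True by simp
        also have "\<dots> \<le> (\<Sum>k<?n. ?GQ t * indicator (Sq k) t)"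
          using k(1) by (intro member_le_sum) auto
        finally show ?thesis .
      qed simp
    qed
  qed
  also have "\<dots> = (\<Sum>k<?n. \<integral>\<^sup>+t. ?GQ t * indicator (Sq k) t \<partial>lborel)"
    unfolding enn by (intro nn_integral_sum measurable_compose[OF _ measurable_ennreal]) (auto intro!: gQm simp: Sq_def)
  also have "\<dots> \<le> (\<Sum>k<?n. (\<integral>\<^sup>+t. ?GP t * indicator (Sp k) t \<partial>lborel) + ennreal (3 * \<epsilon> * measure lborel (Sp k)))"
    by (intro sum_mono piece) simp
  also have "\<dots> = (\<Sum>k<?n. \<integral>\<^sup>+t. ?GP t * indicator (Sp k) t \<partial>lborel) + (\<Sum>k<?n. ennreal (3 * \<epsilon> * measure lborel (Sp k)))"
    by (rule sum.distrib)
  also have "(\<Sum>k<?n. \<integral>\<^sup>+t. ?GP t * indicator (Sp k) t \<partial>lborel)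
      = (\<integral>\<^sup>+t. (\<Sum>k<?n. ?GP t * indicator (Sp k) t) \<partial>lborel)"
    unfolding enn by (intro nn_integral_sum[symmetric] measurable_compose[OF _ measurable_ennreal]) (auto intro!: gPm simp: Sp_def)
  also have "\<dots> = (\<integral>\<^sup>+t. ?GP t * indicator (\<Union>k<?n. Sp k) t \<partial>lborel)"
    using Spdis by (simp only: sum_distrib_left[symmetric] indicator_UN_disjoint finite_lessThan)
  also have "\<dots> \<le> (\<integral>\<^sup>+t. ?GP t * indicator {t \<in> I. 0 < p t} t \<partial>lborel)"
    using Spsub by (intro nn_integral_mono mult_left_mono) (auto split: split_indicator)
  also have "(\<Sum>k<?n. ennreal (3 * \<epsilon> * measure lborel (Sp k))) = ennreal (3 * \<epsilon> * (\<Sum>k<?n. measure lborel (Sp k)))"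
    using \<epsilon> by (subst sum_ennreal) (auto simp: sum_distrib_left)
  also have "\<dots> \<le> ennreal e"
  proof (rule ennreal_leI)
    have "(\<Sum>k<?n. measure lborel (Sp k)) = measure lborel (\<Union>k<?n. Sp k)"
      using Spdis Spf by (intro measure_finite_Union[symmetric]) (auto simp: less_top)
    also have "\<dots> \<le> m" unfolding m_def
    proof (rule measure_mono_fmeasurable)
      show "(\<Union>k<?n. Sp k) \<subseteq> {t \<in> I. 0 < p t}" using Spsub by blast
      show "{t \<in> I. 0 < p t} \<in> fmeasurable lborel" using fin by (intro fmeasurableI) auto
    qed auto
    finally have "3 * \<epsilon> * (\<Sum>k<?n. measure lborel (Sp k)) \<le> 3 * \<epsilon> * m" using \<epsilon> by (intro mult_left_mono) auto
    then show "3 * \<epsilon> * (\<Sum>k<?n. measure lborel (Sp k)) \<le> e" using \<epsilon>m by linarith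
  qed
  finally show "(\<integral>\<^sup>+t. ?GQ t * indicator {t \<in> I. 0 < q t} t \<partial>lborel)
    \<le> (\<integral>\<^sup>+t. ?GP t * indicator {t \<in> I. 0 < p t} t \<partial>lborel) + ennreal e"
    by (simp add: add_mono)
qed

section \<open>Derivatives on plateaus and over superlevel sets\<close>

lemma sqpos_diff_le:
  assumes "a \<le> B" "b \<le> B" "0 \<le> B"
  shows "\<bar>sqpos a - sqpos b\<bar> \<le> 2 * B * \<bar>a - b\<bar>"
proof -
  have "sqpos a - sqpos b = (max 0 a + max 0 b) * (max 0 a - max 0 b)"
    by (simp add: sqpos_def power2_eq_square algebra_simps)
  then have "\<bar>sqpos a - sqpos b\<bar> = (max 0 a + max 0 b) * \<bar>max 0 a - max 0 b\<bar>"
    by (simp add: abs_mult)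
  also have "\<dots> \<le> (2 * B) * \<bar>a - b\<bar>"
    using assms by (intro mult_mono) auto
  finally show ?thesis .
qed

text \<open>Differentiation in direction \<open>e\<close> under the integral of \<open>sqpos (h - s)\<close> over a vertical line. The
  square makes the truncation differentiable also at points with \<open>h = s\<close>.\<close>

lemma truncation_difference_limit:
  fixes h :: "'a::euclidean_space \<times> real \<Rightarrow> real"
  assumes lip: "L-lipschitz_on UNIV h" and I[measurable]: "I \<in> sets borel" "I \<subseteq> {0<..}"
    and bnd: "\<And>x t. x \<in> D \<Longrightarrow> t \<in> I \<Longrightarrow> h (x, t) \<le> M" and M: "0 \<le> M"
    and supp: "\<And>x t. x \<in> D \<Longrightarrow> t \<in> I \<Longrightarrow> K < t \<Longrightarrow> h (x, t) \<le> 0"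
    and r: "\<And>n. r n \<noteq> 0" "r \<longlonglongrightarrow> 0" and x: "x \<in> D" "\<And>n. x + r n *\<^sub>R e \<in> D"
    and dd: "AE t in lborel. ddiff h (e, 0) (x, t)" and s: "0 \<le> s"
  shows "(\<lambda>n. LINT t:I|lborel. (sqpos (h (x + r n *\<^sub>R e, t) - s) - sqpos (h (x, t) - s)) / r n)
    \<longlonglongrightarrow> (LINT t:I|lborel. 2 * max 0 (h (x, t) - s) * pd h (e, 0) (x, t))"
  unfolding set_lebesgue_integral_def
proof (rule integral_dominated_convergence[where w="\<lambda>t. (2 * M * (L * norm e)) * indicator {0..K} t"])
  have hc: "continuous_on UNIV h" using lip lipschitz_on_continuous_on by blast
  have hm[measurable]: "h \<in> borel_measurable borel" by (rule borel_measurable_continuous_onI[OF hc])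
  have sm[measurable]: "sqpos \<in> borel_measurable borel" unfolding sqpos_def[abs_def] by measurable
  have hs: "(\<lambda>t. h (y, t)) \<in> borel_measurable borel" for y
    by (rule borel_measurable_continuous_onI, rule continuous_on_compose2[OF hc]) (auto intro!: continuous_intros)
  note [measurable] = hs
  have "(\<lambda>t. pd h (e, 0) (x, t)) \<in> borel_measurable borel"
    by (rule measurable_compose[OF _ measurable_pd[OF hc]]) (auto intro!: borel_measurable_continuous_onI continuous_intros)
  note [measurable] = this
  show "(\<lambda>t. indicator I t *\<^sub>R (2 * max 0 (h (x, t) - s) * pd h (e, 0) (x, t))) \<in> borel_measurable lborel"
    by simp
  show "(\<lambda>t. indicator I t *\<^sub>R ((sqpos (h (x + r n *\<^sub>R e, t) - s) - sqpos (h (x, t) - s)) / r n)) \<in> borel_measurable lborel" for n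
    by simp
  show "integrable lborel (\<lambda>t. (2 * M * (L * norm e)) * indicator {0..K} t)"
    by (intro integrable_mult_right integrable_real_indicator) (auto simp: emeasure_lborel_Icc_eq)
  have L0: "0 \<le> L" by (rule lipschitz_on_nonneg[OF lip])
  let ?D = "\<lambda>n t. (sqpos (h (x + r n *\<^sub>R e, t) - s) - sqpos (h (x, t) - s)) / r n"
  have rlim: "filterlim r (at 0) sequentially" using r by (auto simp: filterlim_at)
  show "AE t in lborel. (\<lambda>n. indicator I t *\<^sub>R ?D n t)
      \<longlonglongrightarrow> indicator I t *\<^sub>R (2 * max 0 (h (x, t) - s) * pd h (e, 0) (x, t))"
    using dd
  proof (rule eventually_mono)
    fix t assume d: "ddiff h (e, 0) (x, t)"
    have "((\<lambda>a. h ((x, t) + a *\<^sub>R (e, 0))) has_real_derivative pd h (e, 0) (x, t)) (at 0)"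
      by (rule pd_has_derivative[OF d])
    then have "((\<lambda>a. h (x + a *\<^sub>R e, t) - s) has_real_derivative pd h (e, 0) (x, t)) (at 0)"
      by (auto intro!: derivative_eq_intros)
    from DERIV_chain2[OF sqpos_deriv this]
    have "((\<lambda>a. sqpos (h (x + a *\<^sub>R e, t) - s)) has_real_derivative 2 * max 0 (h (x, t) - s) * pd h (e, 0) (x, t)) (at 0)"
      by simp
    then have "((\<lambda>a. (sqpos (h (x + a *\<^sub>R e, t) - s) - sqpos (h (x, t) - s)) / a) \<longlongrightarrow> 2 * max 0 (h (x, t) - s) * pd h (e, 0) (x, t)) (at 0)"
      by (simp add: has_field_derivative_iff)
    from filterlim_compose[OF this rlim]
    show "(\<lambda>n. indicator I t *\<^sub>R ?D n t)
      \<longlonglongrightarrow> indicator I t *\<^sub>R (2 * max 0 (h (x, t) - s) * pd h (e, 0) (x, t))"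
      by (rule tendsto_scaleR[OF tendsto_const])
  qed
  show "AE t in lborel. norm (indicator I t *\<^sub>R ?D n t)
      \<le> (2 * M * (L * norm e)) * indicator {0..K} t" for n
  proof (intro always_eventually allI)
    fix t
    show "norm (indicator I t *\<^sub>R ?D n t)
      \<le> (2 * M * (L * norm e)) * indicator {0..K} t"
    proof (cases "t \<in> I")
      case tI: True
      show ?thesis
      proof (cases "K < t")
        case True
        have "h (x + r n *\<^sub>R e, t) - s \<le> 0" "h (x, t) - s \<le> 0"
          using supp[OF x(2) tI True, of n] supp[OF x(1) tI True] s by auto
        then have "sqpos (h (x + r n *\<^sub>R e, t) - s) = 0" "sqpos (h (x, t) - s) = 0" by (auto simp: sqpos_eq_0)
        then show ?thesis using M L0 by simp
      next
        case False
        then have tK: "t \<in> {0..K}" using tI I(2) by auto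
        have "\<bar>sqpos (h (x + r n *\<^sub>R e, t) - s) - sqpos (h (x, t) - s)\<bar> \<le> 2 * M * \<bar>h (x + r n *\<^sub>R e, t) - h (x, t)\<bar>"
          using sqpos_diff_le[of "h (x + r n *\<^sub>R e, t) - s" M "h (x, t) - s"] bnd[OF x(2) tI, of n] bnd[OF x(1) tI] s M by simp
        also have "\<bar>h (x + r n *\<^sub>R e, t) - h (x, t)\<bar> \<le> L * (\<bar>r n\<bar> * norm e)"
          using lipschitz_onD[OF lip, of "(x + r n *\<^sub>R e, t)" "(x, t)"] by (simp add: dist_Pair_Pair dist_norm)
        finally have "\<bar>sqpos (h (x + r n *\<^sub>R e, t) - s) - sqpos (h (x, t) - s)\<bar> \<le> 2 * M * (L * (\<bar>r n\<bar> * norm e))"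
          using M by (simp add: mult_left_mono)
        then have "\<bar>sqpos (h (x + r n *\<^sub>R e, t) - s) - sqpos (h (x, t) - s)\<bar> / \<bar>r n\<bar> \<le> 2 * M * (L * norm e)"
          using r(1)[of n] by (simp add: divide_le_eq mult_ac)
        then show ?thesis using tI tK by simp
      qed
    next
      case False
      then show ?thesis using M L0 by simp
    qed
  qed
qed

text \<open>Differentiation in the level: \<open>(n + 1) * (max 0 (p - s) - max 0 (p - s - 1 / (n + 1)))\<close> is bounded by \<open>1\<close> and
  tends to the indicator of \<open>{s < p}\<close>. This removes the weight left over from \<open>sqpos\<close>.\<close>

lemma truncation_level_limit:
  fixes p P :: "real \<Rightarrow> real"
  assumes [measurable]: "p \<in> borel_measurable borel" "P \<in> borel_measurable borel" "I \<in> sets borel"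
    and b: "\<And>t. \<bar>P t\<bar> \<le> C" and I: "I \<subseteq> {0<..}" and M: "\<And>t. t \<in> I \<Longrightarrow> p t \<le> M" "0 \<le> M"
    and supp: "\<And>t. t \<in> I \<Longrightarrow> K < t \<Longrightarrow> p t \<le> 0" and s: "0 \<le> s"
  shows "(\<lambda>n. real (Suc n) * ((LINT t:I|lborel. 2 * max 0 (p t - s) * P t) - (LINT t:I|lborel. 2 * max 0 (p t - (s + 1 / Suc n)) * P t)))
    \<longlonglongrightarrow> 2 * (LINT t:{t \<in> I. s < p t}|lborel. P t)"
proof -
  let ?A = "\<lambda>t. 2 * max 0 (p t - s) * P t" and ?B = "\<lambda>n t. 2 * max 0 (p t - (s + 1 / Suc n)) * P t"
  have C0: "0 \<le> C" using b[of 0] by linarith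
  have int: "set_integrable lborel I (\<lambda>t. 2 * max 0 (p t - s') * P t)" if s': "0 \<le> s'" for s'
    unfolding set_integrable_def
  proof (rule integrable_bounded_compact_support[where K="{0..K}" and C="2 * M * C"])
    fix t
    show "indicator I t *\<^sub>R (2 * max 0 (p t - s') * P t) = 0" if t: "t \<notin> {0..K}"
    proof (cases "t \<in> I")
      case True
      then have "p t \<le> 0" using t I supp[of t] by force
      then show ?thesis using s' by simp
    qed simp
    show "norm (indicator I t *\<^sub>R (2 * max 0 (p t - s') * P t)) \<le> 2 * M * C"
    proof (cases "t \<in> I")
      case True
      have "max 0 (p t - s') \<le> M" using M(1)[OF True] M(2) s' by simp
      then show ?thesis using True b[of t] M(2) by (simp add: abs_mult mult_mono)
    qed (use M(2) C0 in simp)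
  next
    show "(\<lambda>t. indicator I t *\<^sub>R (2 * max 0 (p t - s') * P t)) \<in> borel_measurable borel" by simp
    show "compact {0..K}" by simp
  qed
  have eq: "real (Suc n) * ((LINT t:I|lborel. ?A t) - (LINT t:I|lborel. ?B n t))
      = (LINT t|lborel. indicator I t *\<^sub>R (real (Suc n) * (?A t - ?B n t)))" for n
  proof -
    have s1: "0 \<le> s + 1 / real (Suc n)" using s by (simp add: add_nonneg_nonneg)
    have "(LINT t:I|lborel. ?A t) - (LINT t:I|lborel. ?B n t)
        = (LINT t:I|lborel. ?A t - ?B n t)"
      by (rule set_integral_diff(2)[symmetric, OF int[OF s] int[OF s1]])
    moreover have "(LINT t:I|lborel. real (Suc n) * (?A t - ?B n t))
        = real (Suc n) * (LINT t:I|lborel. ?A t - ?B n t)"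
      by (rule set_integral_mult_right)
    ultimately show ?thesis by (simp only: set_lebesgue_integral_def)
  qed
  have "(\<lambda>n. LINT t|lborel. indicator I t *\<^sub>R (real (Suc n) * (?A t - ?B n t)))
      \<longlonglongrightarrow> (LINT t|lborel. indicator {t \<in> I. s < p t} t *\<^sub>R (2 * P t))"
  proof (rule integral_dominated_convergence[where w="\<lambda>t. (2 * C) * indicator {0..K} t"])
    show "integrable lborel (\<lambda>t. (2 * C) * indicator {0..K} t)"
      by (intro integrable_mult_right integrable_real_indicator) (auto simp: emeasure_lborel_Icc_eq)
    show "AE t in lborel. (\<lambda>n. indicator I t *\<^sub>R (real (Suc n) * (?A t - ?B n t)))
        \<longlonglongrightarrow> indicator {t \<in> I. s < p t} t *\<^sub>R (2 * P t)"
    proof (rule AE_I2, rule tendsto_eventually)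
      fix t
      show "\<forall>\<^sub>F n in sequentially. indicator I t *\<^sub>R (real (Suc n) * (?A t - ?B n t))
        = indicator {t \<in> I. s < p t} t *\<^sub>R (2 * P t)"
      proof (cases "s < p t")
        case True
        then obtain N :: nat where N: "1 / Suc N < p t - s" using nat_approx_posE[of "p t - s"] by auto
        show ?thesis unfolding eventually_sequentially
        proof (intro exI[of _ N] allI impI)
          fix n assume n: "N \<le> n"
          have "1 / real (Suc n) \<le> 1 / real (Suc N)" using n by (intro divide_left_mono) auto
          then have m: "max 0 (p t - (s + 1 / Suc n)) = p t - s - 1 / Suc n" "max 0 (p t - s) = p t - s" using N True by auto
          have "real (Suc n) * (2 * (p t - s) * P t - 2 * (p t - s - 1 / Suc n) * P t) = (real (Suc n) * (1 / Suc n)) * (2 * P t)"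
            by (simp only: left_diff_distrib right_diff_distrib mult_ac)
          also have "\<dots> = 2 * P t" by simp
          finally show "indicator I t *\<^sub>R (real (Suc n) * (?A t - ?B n t))
            = indicator {t \<in> I. s < p t} t *\<^sub>R (2 * P t)" using True unfolding m by (simp only: indicator_def) simp
        qed
      next
        case False
        have "p t - (s + 1 / real (Suc n)) \<le> 0" for n
        proof -
          have "0 < 1 / real (Suc n)" by simp
          then show ?thesis using False by linarith
        qed
        then show ?thesis using False by (intro always_eventually allI) (simp add: max_absorb1 del: of_nat_Suc)
      qed
    qed
    show "AE t in lborel. norm (indicator I t *\<^sub>R (real (Suc n) * (?A t - ?B n t)))
        \<le> (2 * C) * indicator {0..K} t" for n
    proof (intro always_eventually allI)
      fix t
      let ?d = "max 0 (p t - s) - max 0 (p t - (s + 1 / Suc n))"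
      have "0 < 1 / real (Suc n)" by simp
      then have d: "0 \<le> ?d" "?d \<le> 1 / Suc n" by linarith+
      have e: "real (Suc n) * (?A t - ?B n t) = (real (Suc n) * ?d) * (2 * P t)"
        by (simp only: left_diff_distrib right_diff_distrib mult_ac)
      show "norm (indicator I t *\<^sub>R (real (Suc n) * (?A t - ?B n t)))
        \<le> (2 * C) * indicator {0..K} t"
      proof (cases "t \<in> I \<and> t \<le> K")
        case True
        then have tK: "t \<in> {0..K}" using I by auto
        have "real (Suc n) * ?d \<le> real (Suc n) * (1 / Suc n)" using d(2) by (intro mult_left_mono) auto
        then have "real (Suc n) * ?d \<le> 1" by simp
        then have "(real (Suc n) * ?d) * \<bar>2 * P t\<bar> \<le> 1 * (2 * C)" using d(1) b[of t] by (intro mult_mono) auto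
        moreover have "\<bar>(real (Suc n) * ?d) * (2 * P t)\<bar> = (real (Suc n) * ?d) * \<bar>2 * P t\<bar>"
          using d(1) by (simp only: abs_mult abs_of_nonneg mult_nonneg_nonneg of_nat_0_le_iff)
        ultimately show ?thesis unfolding e using True tK by simp
      next
        case False
        have z: "max 0 (p t - s) = 0 \<and> max 0 (p t - (s + 1 / Suc n)) = 0" if tI: "t \<in> I"
        proof -
          have "p t \<le> 0" using False tI supp[of t] by auto
          moreover have "0 < 1 / real (Suc n)" by simp
          ultimately have "p t - s \<le> 0" "p t - (s + 1 / Suc n) \<le> 0" using s by linarith+
          then show ?thesis by (simp add: max_absorb1 del: of_nat_Suc)
        qed
        have z0: "indicator I t *\<^sub>R (real (Suc n) * (?A t - ?B n t)) = 0"
          using z by (cases "t \<in> I") (simp_all del: of_nat_Suc)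
        show ?thesis unfolding z0 using C0 by simp
      qed
    qed
  qed measurable
  also have "(LINT t|lborel. indicator {t \<in> I. s < p t} t *\<^sub>R (2 * P t)) = 2 * (LINT t:{t \<in> I. s < p t}|lborel. P t)"
    by (simp add: set_lebesgue_integral_def mult.left_commute)
  finally show ?thesis unfolding eq .
qed

text \<open>Adding the constant \<open>C\<close> makes \<open>a\<close> and \<open>b\<close> nonnegative densities, to which the uniqueness of distributions
  applies; the contribution of \<open>C\<close> is the same on both sides by the case of density \<open>1\<close>.\<close>

lemma signed_distribution_eq:
  fixes p q a b :: "real \<Rightarrow> real"
  assumes [measurable]: "p \<in> borel_measurable borel" "q \<in> borel_measurable borel"
      "a \<in> borel_measurable borel" "b \<in> borel_measurable borel" "I \<in> sets borel"
    and bnd: "\<And>t. \<bar>a t\<bar> \<le> C" "\<And>t. \<bar>b t\<bar> \<le> C"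
    and lev: "\<And>s. 0 \<le> s \<Longrightarrow> emeasure lborel {t \<in> I. s < p t} = emeasure lborel {t \<in> I. s < q t}"
    and fin: "emeasure lborel {t \<in> I. 0 < p t} < \<infinity>"
    and eq: "\<And>s. 0 \<le> s \<Longrightarrow> (LINT t:{t \<in> I. s < p t}|lborel. a t) = (LINT t:{t \<in> I. s < q t}|lborel. b t)"
    and E[measurable]: "E \<in> sets borel" "E \<subseteq> {0<..}"
  shows "emeasure lborel {t \<in> I. p t \<in> E} = emeasure lborel {t \<in> I. q t \<in> E}"
    and "(LINT t:{t \<in> I. p t \<in> E}|lborel. a t) = (LINT t:{t \<in> I. q t \<in> E}|lborel. b t)"
proof -
  have finS: "emeasure lborel {t \<in> I. p' t \<in> S} < \<infinity>"
    if "emeasure lborel {t \<in> I. 0 < p' t} < \<infinity>" "S \<subseteq> {0<..}" and [measurable]: "p' \<in> borel_measurable borel" for p' :: "real \<Rightarrow> real" and S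
  proof -
    have "emeasure lborel {t \<in> I. p' t \<in> S} \<le> emeasure lborel {t \<in> I. 0 < p' t}"
      using that(2) by (intro emeasure_mono) auto
    then show ?thesis using that(1) by (rule le_less_trans)
  qed
  have finq: "emeasure lborel {t \<in> I. 0 < q t} < \<infinity>" using lev[of 0] fin by simp
  let ?\<phi> = "\<lambda>v. indicator E v :: ennreal"
  have \<phi>0: "?\<phi> v = 0" if "v \<le> 0" for v using that E(2) by (auto simp: indicator_def)
  have ind: "(\<integral>\<^sup>+t. ennreal (w t) * (?\<phi> (p' t) * indicator I t) \<partial>lborel) = (\<integral>\<^sup>+t. ennreal (w t) * indicator {t \<in> I. p' t \<in> E} t \<partial>lborel)"
    for w p' :: "real \<Rightarrow> real" by (intro nn_integral_cong) (auto split: split_indicator)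
  have "(\<integral>\<^sup>+t. ennreal 1 * (?\<phi> (p t) * indicator I t) \<partial>lborel) = (\<integral>\<^sup>+t. ennreal 1 * (?\<phi> (q t) * indicator I t) \<partial>lborel)"
    by (rule weighted_distribution_eq) (use lev fin \<phi>0 in simp_all)
  then show em: "emeasure lborel {t \<in> I. p t \<in> E} = emeasure lborel {t \<in> I. q t \<in> E}"
    unfolding ind by simp
  have conv: "(\<integral>\<^sup>+t. ennreal (w t + C) * indicator {t \<in> I. p' t \<in> S} t \<partial>lborel)
      = ennreal ((LINT t:{t \<in> I. p' t \<in> S}|lborel. w t) + C * measure lborel {t \<in> I. p' t \<in> S})
      \<and> 0 \<le> (LINT t:{t \<in> I. p' t \<in> S}|lborel. w t) + C * measure lborel {t \<in> I. p' t \<in> S}"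
    if [measurable]: "p' \<in> borel_measurable borel" "w \<in> borel_measurable borel" "S \<in> sets borel"
      and S: "S \<subseteq> {0<..}" and f: "emeasure lborel {t \<in> I. 0 < p' t} < \<infinity>" and wb: "\<And>t. \<bar>w t\<bar> \<le> C"
    for p' w :: "real \<Rightarrow> real" and S
  proof -
    let ?S = "{t \<in> I. p' t \<in> S}"
    have Sf: "emeasure lborel ?S < \<infinity>" by (rule finS[OF f S]) simp
    have Sm: "?S \<in> sets lborel" by simp
    have i1: "set_integrable lborel ?S w" using Sm Sf wb by (intro set_integrable_bounded[where B=C]) auto
    have i2: "set_integrable lborel ?S (\<lambda>_. C)" using Sm Sf by (simp add: set_integrable_def)
    have i3: "set_integrable lborel ?S (\<lambda>t. w t + C)" by (rule set_integral_add(1)[OF i1 i2])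
    have pos: "0 \<le> w t + C" for t using wb[of t] by linarith
    have val: "(LINT t:?S|lborel. w t + C) = (LINT t:?S|lborel. w t) + C * measure lborel ?S"
      using set_integral_add(2)[OF i1 i2] Sm Sf by (simp add: set_lebesgue_integral_def mult.commute)
    have "(\<integral>\<^sup>+t. ennreal (w t + C) * indicator ?S t \<partial>lborel) = (\<integral>\<^sup>+t. ennreal (indicator ?S t *\<^sub>R (w t + C)) \<partial>lborel)"
      by (intro nn_integral_cong) (auto split: split_indicator)
    also have "\<dots> = ennreal (LINT t:?S|lborel. w t + C)"
      unfolding set_lebesgue_integral_def
      by (rule nn_integral_eq_integral[OF i3[unfolded set_integrable_def]]) (use pos in auto)
    moreover have "0 \<le> (LINT t:?S|lborel. w t + C)"
      unfolding set_lebesgue_integral_def using pos by (intro integral_nonneg_AE always_eventually allI) auto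
    ultimately show ?thesis using val by simp
  qed
  have lev2: "{t \<in> I. s < p' t} = {t \<in> I. p' t \<in> {s<..}}" for s and p' :: "real \<Rightarrow> real" by auto
  have "(\<integral>\<^sup>+t. ennreal (a t + C) * (?\<phi> (p t) * indicator I t) \<partial>lborel) = (\<integral>\<^sup>+t. ennreal (b t + C) * (?\<phi> (q t) * indicator I t) \<partial>lborel)"
  proof (rule weighted_distribution_eq)
    fix s :: real assume s: "0 \<le> s"
    have S: "{s<..} \<subseteq> {0<..}" using s by auto
    show "(\<integral>\<^sup>+t. ennreal (a t + C) * indicator {t \<in> I. s < p t} t \<partial>lborel) = (\<integral>\<^sup>+t. ennreal (b t + C) * indicator {t \<in> I. s < q t} t \<partial>lborel)"
      using conv[of p a "{s<..}"] conv[of q b "{s<..}"] S fin finq bnd eq[OF s] lev[OF s] unfolding lev2 measure_def by simp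
  next
    have "(\<integral>\<^sup>+t. ennreal (a t + C) * indicator {t \<in> I. p t \<in> {0<..}} t \<partial>lborel) < \<infinity>"
      using conv[of p a "{0<..}"] fin bnd by simp
    then show "(\<integral>\<^sup>+t. ennreal (a t + C) * indicator {t \<in> I. 0 < p t} t \<partial>lborel) < \<infinity>" by simp
  qed (use \<phi>0 in simp_all)
  then have "ennreal ((LINT t:{t \<in> I. p t \<in> E}|lborel. a t) + C * measure lborel {t \<in> I. p t \<in> E})
      = ennreal ((LINT t:{t \<in> I. q t \<in> E}|lborel. b t) + C * measure lborel {t \<in> I. q t \<in> E})"
    unfolding ind using conv[of p a E] conv[of q b E] E fin finq bnd by simp
  then have "(LINT t:{t \<in> I. p t \<in> E}|lborel. a t) + C * measure lborel {t \<in> I. p t \<in> E}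
      = (LINT t:{t \<in> I. q t \<in> E}|lborel. b t) + C * measure lborel {t \<in> I. q t \<in> E}"
    using conv[of p a E] conv[of q b E] E fin finq bnd by (simp add: ennreal_inj)
  then show "(LINT t:{t \<in> I. p t \<in> E}|lborel. a t) = (LINT t:{t \<in> I. q t \<in> E}|lborel. b t)"
    using em by (simp add: measure_def)
qed

lemma DERIV_const_right:
  assumes "(q has_real_derivative D) (at s)" "s < t" "\<And>r. s \<le> r \<Longrightarrow> r \<le> t \<Longrightarrow> q r = q s"
  shows "D = 0"
proof -
  have "((\<lambda>y. (q y - q s) / (y - s)) \<longlongrightarrow> D) (at s)" using assms(1) by (simp add: has_field_derivative_iff)
  then have "((\<lambda>y. (q y - q s) / (y - s)) \<longlongrightarrow> D) (at_right s)" by (rule tendsto_within_subset) simp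
  moreover have "((\<lambda>y. (q y - q s) / (y - s)) \<longlongrightarrow> 0) (at_right s)"
  proof (rule tendsto_eventually)
    show "\<forall>\<^sub>F y in at_right s. (q y - q s) / (y - s) = 0"
      unfolding eventually_at_right_field
    proof (intro exI[of _ t] conjI allI impI)
      fix y assume "s < y" "y < t"
      then have "q y = q s" by (intro assms(3)) simp_all
      then show "(q y - q s) / (y - s) = 0" by simp
    qed (rule assms(2))
  qed
  ultimately show ?thesis using tendsto_unique[OF trivial_limit_at_right_real] by blast
qed

text \<open>Applied at the points where the function vanishes: there both gradients are zero, including the
  horizontal components.\<close>

lemma pd_zero_at_minimum:
  fixes h :: "'b::euclidean_space \<Rightarrow> real"
  assumes D: "open D" "z \<in> D" and h: "\<And>y. y \<in> D \<Longrightarrow> 0 \<le> h y" "h z = 0"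
  shows "pd h e z = 0"
proof (cases "ddiff h e z")
  case True
  obtain \<delta> where d: "\<delta> > 0" and inD: "\<And>a. \<bar>a\<bar> < \<delta> \<Longrightarrow> z + a *\<^sub>R e \<in> D"
    using open_contains_short_segments[OF D] by blast
  show ?thesis
  proof (rule DERIV_local_min[OF pd_has_derivative[OF True] d], intro allI impI)
    fix y :: real assume "\<bar>0 - y\<bar> < \<delta>"
    then have "0 \<le> h (z + y *\<^sub>R e)" by (intro h(1) inD) simp
    then show "h (z + 0 *\<^sub>R e) \<le> h (z + y *\<^sub>R e)" using h(2) by simp
  qed
qed (simp add: pd_def)

lemma vertical_derivative:
  fixes h :: "'a::euclidean_space \<times> real \<Rightarrow> real"
  assumes "ddiff h (0, 1) (x, t)"
  shows "((\<lambda>s. h (x, s)) has_real_derivative pd h (0, 1) (x, t)) (at t)"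
proof -
  have "((\<lambda>a. h ((x, t) + a *\<^sub>R (0, 1))) has_real_derivative pd h (0, 1) (x, t)) (at 0)"
    by (rule pd_has_derivative[OF assms])
  then have "((\<lambda>a. h (x, a + t)) has_real_derivative pd h (0, 1) (x, t)) (at 0)" by (simp add: add.commute)
  then show ?thesis using DERIV_shift[of "\<lambda>s. h (x, s)" _ 0 t] by simp
qed

text \<open>Between \<open>s\<close> and \<open>t\<close> the section at \<open>x\<close> is constant, so its vertical derivatives vanish. The function
  \<open>k(\<cdot>, s) - k(\<cdot>, t)\<close> is nonnegative on \<open>D\<close> and zero at \<open>x\<close>; at this minimum its horizontal derivatives
  vanish.\<close>

lemma monotone_plateau_derivatives:
  fixes k :: "'a::euclidean_space \<times> real \<Rightarrow> real"
  assumes D: "open D" "x \<in> D" and I: "is_interval I" "s \<in> I" "t \<in> I" "s < t"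
    and anti: "\<And>x s t. x \<in> D \<Longrightarrow> s \<in> I \<Longrightarrow> t \<in> I \<Longrightarrow> s \<le> t \<Longrightarrow> k (x, t) \<le> k (x, s)"
    and eq: "k (x, s) = k (x, t)"
  shows "ddiff k (e, 0) (x, s) \<Longrightarrow> ddiff k (e, 0) (x, t) \<Longrightarrow> pd k (e, 0) (x, s) = pd k (e, 0) (x, t)"
    and "ddiff k (0, 1) (x, s) \<Longrightarrow> pd k (0, 1) (x, s) = 0"
    and "ddiff k (0, 1) (x, t) \<Longrightarrow> pd k (0, 1) (x, t) = 0"
proof -
  have flat: "k (x, r) = k (x, s)" if r: "s \<le> r" "r \<le> t" for r
  proof -
    have rI: "r \<in> I" using mem_is_interval_1_I[OF I(1,2,3) r] .
    have "k (x, r) \<le> k (x, s)" by (rule anti[OF D(2) I(2) rI r(1)])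
    moreover have "k (x, t) \<le> k (x, r)" by (rule anti[OF D(2) rI I(3) r(2)])
    ultimately show ?thesis using eq by linarith
  qed
  show "pd k (0, 1) (x, s) = 0" if "ddiff k (0, 1) (x, s)"
    by (rule DERIV_const_right[OF vertical_derivative[OF that] I(4)]) (rule flat)
  have flat': "k (x, r) = k (x, t)" if r: "s \<le> r" "r \<le> t" for r using flat[OF r] eq by (rule trans)
  show "pd k (0, 1) (x, t) = 0" if "ddiff k (0, 1) (x, t)"
    by (rule DERIV_const_left[OF vertical_derivative[OF that] I(4)]) (rule flat')
  show "pd k (e, 0) (x, s) = pd k (e, 0) (x, t)" if d: "ddiff k (e, 0) (x, s)" "ddiff k (e, 0) (x, t)"
  proof -
    obtain d where d0: "d > 0" and inD: "\<And>a. \<bar>a\<bar> < d \<Longrightarrow> x + a *\<^sub>R e \<in> D"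
      using open_contains_short_segments[OF D] by blast
    have "((\<lambda>a. k ((x, s) + a *\<^sub>R (e, 0)) - k ((x, t) + a *\<^sub>R (e, 0))) has_real_derivative
        pd k (e, 0) (x, s) - pd k (e, 0) (x, t)) (at 0)"
      by (intro DERIV_diff pd_has_derivative d)
    then have der: "((\<lambda>a. k (x + a *\<^sub>R e, s) - k (x + a *\<^sub>R e, t)) has_real_derivative
        pd k (e, 0) (x, s) - pd k (e, 0) (x, t)) (at 0)" by simp
    have "pd k (e, 0) (x, s) - pd k (e, 0) (x, t) = 0"
    proof (rule DERIV_local_min[OF der d0], intro allI impI)
      fix a :: real assume "\<bar>0 - a\<bar> < d"
      then have "x + a *\<^sub>R e \<in> D" by (intro inD) simp
      then have "k (x + a *\<^sub>R e, t) \<le> k (x + a *\<^sub>R e, s)" using I by (intro anti) auto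
      then show "k (x + 0 *\<^sub>R e, s) - k (x + 0 *\<^sub>R e, t) \<le> k (x + a *\<^sub>R e, s) - k (x + a *\<^sub>R e, t)"
        using eq by simp
    qed
    then show ?thesis by simp
  qed
qed

lemma emeasure_level_rearr1:
  assumes \<alpha>: "0 < \<alpha>" and p: "profile \<alpha> M p" and s: "0 \<le> s" and m: "{t \<in> ivl \<alpha>. s < p t} \<in> sets borel"
    and q: "\<And>t. t \<in> ivl \<alpha> \<Longrightarrow> q t = rearr1 \<alpha> p t"
  shows "emeasure lborel {t \<in> ivl \<alpha>. s < p t} = emeasure lborel {t \<in> ivl \<alpha>. s < q t}"
    and "emeasure lborel {t \<in> ivl \<alpha>. s < p t} < \<infinity>"
proof -
  have fm: "{t \<in> ivl \<alpha>. s < p t} \<in> lmeasurable" using p s by (simp add: profile_def)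
  have "emeasure lborel {t \<in> ivl \<alpha>. s < p t} = emeasure lebesgue {t \<in> ivl \<alpha>. s < p t}" using m by simp
  also have "\<dots> = ennreal (level_meas \<alpha> p s)" unfolding level_meas_def using fm by (rule emeasure_eq_measure2)
  finally have e: "emeasure lborel {t \<in> ivl \<alpha>. s < p t} = ennreal (level_meas \<alpha> p s)" .
  have "{t \<in> ivl \<alpha>. s < q t} = {t \<in> ivl \<alpha>. s < rearr1 \<alpha> p t}" using q by auto
  also have "\<dots> = {0<..<level_meas \<alpha> p s}" by (rule rearr1_level_set[OF \<alpha> p s])
  finally have "emeasure lborel {t \<in> ivl \<alpha>. s < q t} = ennreal (level_meas \<alpha> p s)"
    by (simp add: level_meas_def)
  then show "emeasure lborel {t \<in> ivl \<alpha>. s < p t} = emeasure lborel {t \<in> ivl \<alpha>. s < q t}" using e by simp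
  show "emeasure lborel {t \<in> ivl \<alpha>. s < p t} < \<infinity>" using e by simp
qed

lemma truncated_moment_eq:
  fixes p q :: "real \<Rightarrow> real"
  assumes pm[measurable]: "p \<in> borel_measurable borel" and qm[measurable]: "q \<in> borel_measurable borel" and Im[measurable]: "I \<in> sets borel"
    and I: "I \<subseteq> {0<..}" and b: "\<And>t. t \<in> I \<Longrightarrow> p t \<le> M \<and> q t \<le> M" and M: "0 \<le> M"
    and supp: "\<And>t. t \<in> I \<Longrightarrow> K < t \<Longrightarrow> p t \<le> 0 \<and> q t \<le> 0"
    and lev: "\<And>s. 0 \<le> s \<Longrightarrow> emeasure lborel {t \<in> I. s < p t} = emeasure lborel {t \<in> I. s < q t}"
    and fin: "emeasure lborel {t \<in> I. 0 < p t} < \<infinity>" and s: "0 \<le> s"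
  shows "set_integrable lborel I (\<lambda>t. sqpos (p t - s))" "set_integrable lborel I (\<lambda>t. sqpos (q t - s))"
    "(LINT t:I|lborel. sqpos (p t - s)) = (LINT t:I|lborel. sqpos (q t - s))"
proof -
  have sm[measurable]: "sqpos \<in> borel_measurable borel" unfolding sqpos_def[abs_def] by measurable
  have int: "set_integrable lborel I (\<lambda>t. sqpos (w t - s))"
    if wm[measurable]: "w \<in> borel_measurable borel" and wb: "\<And>t. t \<in> I \<Longrightarrow> w t \<le> M" and ws: "\<And>t. t \<in> I \<Longrightarrow> K < t \<Longrightarrow> w t \<le> 0" for w
    unfolding set_integrable_def
  proof (rule integrable_bounded_compact_support[where K="{0..K}" and C="M\<^sup>2"])
    show "(\<lambda>t. indicator I t *\<^sub>R sqpos (w t - s)) \<in> borel_measurable borel" by simp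
    show "compact {0..K}" by simp
    fix t
    show "indicator I t *\<^sub>R sqpos (w t - s) = 0" if t: "t \<notin> {0..K}"
    proof (cases "t \<in> I")
      case True
      then have "K < t" using t I by auto
      then have "w t - s \<le> 0" using ws[OF True] s by simp
      then show ?thesis by (simp add: sqpos_eq_0)
    qed simp
    show "norm (indicator I t *\<^sub>R sqpos (w t - s)) \<le> M\<^sup>2"
    proof (cases "t \<in> I")
      case True
      have "(max 0 (w t - s))\<^sup>2 \<le> M\<^sup>2" using wb[OF True] s M by (intro power_mono) auto
      then show ?thesis using True sqpos_nonneg[of "w t - s"] by (simp add: sqpos_def)
    qed simp
  qed
  show ip: "set_integrable lborel I (\<lambda>t. sqpos (p t - s))" by (rule int[OF pm]) (use b supp in blast)+
  show iq: "set_integrable lborel I (\<lambda>t. sqpos (q t - s))" by (rule int[OF qm]) (use b supp in blast)+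
  have nn: "(\<integral>\<^sup>+t. ennreal 1 * (ennreal (sqpos (w t - s)) * indicator I t) \<partial>lborel) = ennreal (LINT t:I|lborel. sqpos (w t - s))
      \<and> 0 \<le> (LINT t:I|lborel. sqpos (w t - s))"
    if w: "set_integrable lborel I (\<lambda>t. sqpos (w t - s))" for w
  proof
    have "(\<integral>\<^sup>+t. ennreal 1 * (ennreal (sqpos (w t - s)) * indicator I t) \<partial>lborel) = (\<integral>\<^sup>+t. ennreal (indicator I t *\<^sub>R sqpos (w t - s)) \<partial>lborel)"
      by (intro nn_integral_cong) (auto split: split_indicator)
    also have "\<dots> = ennreal (LINT t:I|lborel. sqpos (w t - s))"
      unfolding set_lebesgue_integral_def
      by (rule nn_integral_eq_integral[OF w[unfolded set_integrable_def]]) (simp add: sqpos_nonneg)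
    finally show "(\<integral>\<^sup>+t. ennreal 1 * (ennreal (sqpos (w t - s)) * indicator I t) \<partial>lborel) = ennreal (LINT t:I|lborel. sqpos (w t - s))" .
    show "0 \<le> (LINT t:I|lborel. sqpos (w t - s))"
      unfolding set_lebesgue_integral_def by (rule integral_nonneg_AE) (simp add: sqpos_nonneg)
  qed
  have "(\<integral>\<^sup>+t. ennreal 1 * (ennreal (sqpos (p t - s)) * indicator I t) \<partial>lborel) = (\<integral>\<^sup>+t. ennreal 1 * (ennreal (sqpos (q t - s)) * indicator I t) \<partial>lborel)"
  proof (rule weighted_distribution_eq[where \<phi>="\<lambda>v. ennreal (sqpos (v - s))"])
    fix v :: real assume "v \<le> 0"
    then have "v - s \<le> 0" using s by simp
    then show "ennreal (sqpos (v - s)) = 0" by (simp add: sqpos_eq_0[THEN iffD2])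
  qed (use lev fin in simp_all)
  then have "ennreal (LINT t:I|lborel. sqpos (p t - s)) = ennreal (LINT t:I|lborel. sqpos (q t - s))"
    using nn[OF ip] nn[OF iq] by simp
  then show "(LINT t:I|lborel. sqpos (p t - s)) = (LINT t:I|lborel. sqpos (q t - s))"
    using nn[OF ip] nn[OF iq] by (simp add: ennreal_inj)
qed

text \<open>For every \<open>y\<close> near \<open>x\<close> the sections of \<open>h\<close> and \<open>k\<close> at \<open>y\<close> are equimeasurable, so the integrals of
  \<open>sqpos (h(y, \<cdot>) - s)\<close> and \<open>sqpos (k(y, \<cdot>) - s)\<close> agree. Differentiate this identity first in \<open>y\<close> in
  direction \<open>e\<close>, then in the level \<open>s\<close>.\<close>

lemma horizontal_derivative_transport:
  fixes h k :: "'a::euclidean_space \<times> real \<Rightarrow> real"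
  assumes liph: "L-lipschitz_on UNIV h" and lipk: "L'-lipschitz_on UNIV k" and D: "open D" "x \<in> D"
    and I[measurable]: "I \<in> sets borel" "I \<subseteq> {0<..}"
    and b: "\<And>x t. x \<in> D \<Longrightarrow> t \<in> I \<Longrightarrow> h (x, t) \<le> M \<and> k (x, t) \<le> M" and M: "0 \<le> M"
    and supp: "\<And>x t. x \<in> D \<Longrightarrow> t \<in> I \<Longrightarrow> K < t \<Longrightarrow> h (x, t) \<le> 0 \<and> k (x, t) \<le> 0"
    and lev: "\<And>x s. x \<in> D \<Longrightarrow> 0 \<le> s \<Longrightarrow> emeasure lborel {t \<in> I. s < h (x, t)} = emeasure lborel {t \<in> I. s < k (x, t)}"
    and fin: "\<And>x. x \<in> D \<Longrightarrow> emeasure lborel {t \<in> I. 0 < h (x, t)} < \<infinity>"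
    and ddh: "AE t in lborel. ddiff h (e, 0) (x, t)" and ddk: "AE t in lborel. ddiff k (e, 0) (x, t)" and s: "0 \<le> s"
  shows "(LINT t:{t \<in> I. s < h (x, t)}|lborel. pd h (e, 0) (x, t)) = (LINT t:{t \<in> I. s < k (x, t)}|lborel. pd k (e, 0) (x, t))"
proof -
  have hc: "continuous_on UNIV h" and kc: "continuous_on UNIV k" using liph lipk lipschitz_on_continuous_on by blast+
  have sec: "(\<lambda>t. w (y, t)) \<in> borel_measurable borel" if "continuous_on UNIV w" for w :: "'a \<times> real \<Rightarrow> real" and y
    by (rule borel_measurable_continuous_onI, rule continuous_on_compose2[OF that]) (auto intro!: continuous_intros)
  have psec: "(\<lambda>t. pd w (e, 0) (y, t)) \<in> borel_measurable borel" if "continuous_on UNIV w" for w :: "'a \<times> real \<Rightarrow> real" and y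
    by (rule measurable_compose[OF _ measurable_pd[OF that]]) (auto intro!: borel_measurable_continuous_onI continuous_intros)
  obtain \<delta> where \<delta>: "\<delta> > 0" and seg: "\<And>a. \<bar>a\<bar> < \<delta> \<Longrightarrow> x + a *\<^sub>R e \<in> D"
    using open_contains_short_segments[OF D] by blast
  define r where "r = (\<lambda>n. \<delta> * (1 / real (Suc (Suc n))))"
  have r0: "r n \<noteq> 0" for n using \<delta> by (simp add: r_def)
  have rlim: "r \<longlonglongrightarrow> 0"
  proof -
    have "(\<lambda>n. 1 / real (Suc (Suc n))) \<longlonglongrightarrow> 0" using LIMSEQ_Suc[OF LIMSEQ_Suc[OF lim_1_over_n]] by simp
    then have "(\<lambda>n. \<delta> * (1 / real (Suc (Suc n)))) \<longlonglongrightarrow> \<delta> * 0" by (intro tendsto_mult tendsto_const)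
    then show ?thesis by (simp add: r_def)
  qed
  have inD: "x + r n *\<^sub>R e \<in> D" for n
  proof -
    have "\<bar>r n\<bar> = \<delta> * (1 / real (Suc (Suc n)))" using \<delta> by (simp add: r_def)
    also have "\<dots> < \<delta> * 1" using \<delta> by (intro mult_strict_left_mono) auto
    finally have "\<bar>r n\<bar> < \<delta>" by simp
    then show ?thesis by (rule seg)
  qed
  have weighted: "(LINT t:I|lborel. 2 * max 0 (h (x, t) - s) * pd h (e, 0) (x, t)) = (LINT t:I|lborel. 2 * max 0 (k (x, t) - s) * pd k (e, 0) (x, t))"
    if s: "0 \<le> s" for s
  proof -
    let ?D = "\<lambda>w n t. (sqpos (w (x + r n *\<^sub>R e, t) - s) - sqpos (w (x, t) - s)) / r n :: real"
    have mom: "set_integrable lborel I (\<lambda>t. sqpos (h (y, t) - s))" "set_integrable lborel I (\<lambda>t. sqpos (k (y, t) - s))"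
      "(LINT t:I|lborel. sqpos (h (y, t) - s)) = (LINT t:I|lborel. sqpos (k (y, t) - s))" if y: "y \<in> D" for y
    proof -
      have bb: "\<And>t. t \<in> I \<Longrightarrow> h (y, t) \<le> M \<and> k (y, t) \<le> M" by (rule b[OF y])
      have ss: "\<And>t. t \<in> I \<Longrightarrow> K < t \<Longrightarrow> h (y, t) \<le> 0 \<and> k (y, t) \<le> 0" by (rule supp[OF y])
      have ll: "\<And>s. 0 \<le> s \<Longrightarrow> emeasure lborel {t \<in> I. s < h (y, t)} = emeasure lborel {t \<in> I. s < k (y, t)}" by (rule lev[OF y])
      note tm = truncated_moment_eq[where p="\<lambda>t. h (y, t)" and q="\<lambda>t. k (y, t)" and I=I and M=M and K=K and s=s, OF sec[OF hc] sec[OF kc] I]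
      show "set_integrable lborel I (\<lambda>t. sqpos (h (y, t) - s))" by (rule tm(1)) (fact bb M ss ll fin[OF y] s)+
      show "set_integrable lborel I (\<lambda>t. sqpos (k (y, t) - s))" by (rule tm(2)) (fact bb M ss ll fin[OF y] s)+
      show "(LINT t:I|lborel. sqpos (h (y, t) - s)) = (LINT t:I|lborel. sqpos (k (y, t) - s))" by (rule tm(3)) (fact bb M ss ll fin[OF y] s)+
    qed
    have quot: "(LINT t:I|lborel. ?D w n t)
        = ((LINT t:I|lborel. sqpos (w (x + r n *\<^sub>R e, t) - s)) - (LINT t:I|lborel. sqpos (w (x, t) - s))) / r n"
      if "set_integrable lborel I (\<lambda>t. sqpos (w (x + r n *\<^sub>R e, t) - s))" "set_integrable lborel I (\<lambda>t. sqpos (w (x, t) - s))"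
      for w :: "'a \<times> real \<Rightarrow> real" and n
      using set_integral_diff(2)[OF that] by simp
    have seq: "(LINT t:I|lborel. ?D h n t)
        = (LINT t:I|lborel. ?D k n t)" for n
      unfolding quot[OF mom(1)[OF inD] mom(1)[OF D(2)]] quot[OF mom(2)[OF inD] mom(2)[OF D(2)]]
      by (simp only: mom(3)[OF inD] mom(3)[OF D(2)])
    have lim1: "(\<lambda>n. LINT t:I|lborel. ?D h n t)
        \<longlonglongrightarrow> (LINT t:I|lborel. 2 * max 0 (h (x, t) - s) * pd h (e, 0) (x, t))"
      by (rule truncation_difference_limit[where D=D and K=K and M=M, OF liph I _ M _ r0 rlim D(2) inD ddh s]) (use b supp in blast)+
    have lim2: "(\<lambda>n. LINT t:I|lborel. ?D k n t)
        \<longlonglongrightarrow> (LINT t:I|lborel. 2 * max 0 (k (x, t) - s) * pd k (e, 0) (x, t))"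
      by (rule truncation_difference_limit[where D=D and K=K and M=M, OF lipk I _ M _ r0 rlim D(2) inD ddk s]) (use b supp in blast)+
    show ?thesis by (rule LIMSEQ_unique[OF lim1[unfolded seq] lim2])
  qed
  have s1: "0 \<le> s + 1 / real (Suc n)" for n using s by (simp add: add_nonneg_nonneg)
  have ne: "norm (e, 0::real) = norm e" by (simp add: norm_Pair)
  have lim1: "(\<lambda>n. real (Suc n) * ((LINT t:I|lborel. 2 * max 0 (h (x, t) - s) * pd h (e, 0) (x, t)) - (LINT t:I|lborel. 2 * max 0 (h (x, t) - (s + 1 / Suc n)) * pd h (e, 0) (x, t))))
    \<longlonglongrightarrow> 2 * (LINT t:{t \<in> I. s < h (x, t)}|lborel. pd h (e, 0) (x, t))"
    by (rule truncation_level_limit[where C="L * norm e" and K=K and M=M, OF sec[OF hc] psec[OF hc] I(1) _ I(2) _ M _ s])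
       (use b[OF D(2)] supp[OF D(2)] pd_bound[OF liph, of "(e, 0)"] ne in \<open>simp_all\<close>)
  have lim2: "(\<lambda>n. real (Suc n) * ((LINT t:I|lborel. 2 * max 0 (k (x, t) - s) * pd k (e, 0) (x, t)) - (LINT t:I|lborel. 2 * max 0 (k (x, t) - (s + 1 / Suc n)) * pd k (e, 0) (x, t))))
    \<longlonglongrightarrow> 2 * (LINT t:{t \<in> I. s < k (x, t)}|lborel. pd k (e, 0) (x, t))"
    by (rule truncation_level_limit[where C="L' * norm e" and K=K and M=M, OF sec[OF kc] psec[OF kc] I(1) _ I(2) _ M _ s])
       (use b[OF D(2)] supp[OF D(2)] pd_bound[OF lipk, of "(e, 0)"] ne in \<open>simp_all\<close>)
  have "2 * (LINT t:{t \<in> I. s < h (x, t)}|lborel. pd h (e, 0) (x, t)) = 2 * (LINT t:{t \<in> I. s < k (x, t)}|lborel. pd k (e, 0) (x, t))"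
    by (rule LIMSEQ_unique[OF lim1[unfolded weighted[OF s] weighted[OF s1]] lim2])
  then show ?thesis by simp
qed

section \<open>The inequality on vertical lines\<close>

definition hgrad :: "('a::euclidean_space \<times> real \<Rightarrow> real) \<Rightarrow> 'a \<times> real \<Rightarrow> 'a" where
  "hgrad h z = (\<Sum>e\<in>Basis. pd h (e, 0) z *\<^sub>R e)"

lemma hgrad_inner: "e \<in> Basis \<Longrightarrow> hgrad h z \<bullet> e = pd h (e, 0) z"
  by (simp add: hgrad_def)

lemma hgrad_bound:
  fixes h :: "'a::euclidean_space \<times> real \<Rightarrow> real" and L :: real
  assumes "L-lipschitz_on UNIV h" shows "norm (hgrad h z) \<le> DIM('a) * L"
proof -
  have "norm (hgrad h z) \<le> (\<Sum>e\<in>(Basis :: 'a set). L)"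
    unfolding hgrad_def
  proof (rule sum_norm_le)
    fix e :: 'a assume "e \<in> Basis"
    then show "norm (pd h (e, 0) z *\<^sub>R e) \<le> L" using pd_bound[OF assms, of "(e, 0)" z] by (simp add: norm_Pair)
  qed
  then show ?thesis by simp
qed

lemma measurable_hgrad:
  fixes h :: "'a::euclidean_space \<times> real \<Rightarrow> real"
  assumes "continuous_on UNIV h" shows "hgrad h \<in> borel_measurable borel"
  unfolding hgrad_def[abs_def] by (intro borel_measurable_sum borel_measurable_scaleR measurable_pd[OF assms]) auto

text \<open>The level \<open>0\<close> is separated because its part of the line may have infinite measure.\<close>

lemma split_zero_level:
  fixes g0 :: real and F p :: "real \<Rightarrow> real"
  assumes F: "(\<lambda>t. F t * indicator {t \<in> I. 0 < p t} t) \<in> borel_measurable lborel"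
    and m: "I \<in> sets borel" "p \<in> borel_measurable borel" and p: "\<And>t. t \<in> I \<Longrightarrow> 0 \<le> p t"
    and zero: "\<And>t. t \<in> I \<Longrightarrow> p t = 0 \<Longrightarrow> F t = g0"
  shows "(\<integral>\<^sup>+t. ennreal (F t) * indicator I t \<partial>lborel)
    = (\<integral>\<^sup>+t. ennreal (F t) * indicator {t \<in> I. 0 < p t} t \<partial>lborel) + ennreal g0 * emeasure lborel {t \<in> I. p t = 0}"
proof -
  have "p -` {0} \<in> sets borel" using measurable_sets[OF m(2), of "{0}"] by simp
  moreover have "{t \<in> I. p t = 0} = I \<inter> p -` {0}" by auto
  ultimately have S0: "{t \<in> I. p t = 0} \<in> sets lborel" using m(1) by simp
  have "(\<integral>\<^sup>+t. ennreal (F t) * indicator I t \<partial>lborel)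
      = (\<integral>\<^sup>+t. ennreal (F t * indicator {t \<in> I. 0 < p t} t) + ennreal g0 * indicator {t \<in> I. p t = 0} t \<partial>lborel)"
  proof (rule nn_integral_cong)
    fix t
    consider "t \<notin> I" | "t \<in> I" "p t = 0" | "t \<in> I" "0 < p t" using p[of t] by (metis less_eq_real_def)
    then show "ennreal (F t) * indicator I t = ennreal (F t * indicator {t \<in> I. 0 < p t} t) + ennreal g0 * indicator {t \<in> I. p t = 0} t"
      by cases (simp_all add: zero indicator_def)
  qed
  also have "\<dots> = (\<integral>\<^sup>+t. ennreal (F t * indicator {t \<in> I. 0 < p t} t) \<partial>lborel) + (\<integral>\<^sup>+t. ennreal g0 * indicator {t \<in> I. p t = 0} t \<partial>lborel)"
    by (rule nn_integral_add[OF measurable_compose[OF F measurable_ennreal]])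
       (intro borel_measurable_times_ennreal borel_measurable_const borel_measurable_indicator S0)
  also have "(\<integral>\<^sup>+t. ennreal g0 * indicator {t \<in> I. p t = 0} t \<partial>lborel) = ennreal g0 * emeasure lborel {t \<in> I. p t = 0}"
    by (rule nn_integral_cmult_indicator[OF S0])
  also have "(\<integral>\<^sup>+t. ennreal (F t * indicator {t \<in> I. 0 < p t} t) \<partial>lborel) = (\<integral>\<^sup>+t. ennreal (F t) * indicator {t \<in> I. 0 < p t} t \<partial>lborel)"
    by (intro nn_integral_cong) (auto split: split_indicator)
  finally show ?thesis .
qed

text \<open>The inequality on one vertical line on which all partial derivatives exist almost everywhere. With \<open>P\<close>, \<open>Q\<close>
  the horizontal gradients and \<open>\<sigma>\<close>, \<open>\<tau>\<close> the weighted vertical derivatives of the function and of its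
  rearrangement, the hypotheses of \<open>fibrewise_jensen\<close> are the transport of the horizontal
  derivatives, the weighted coarea inequality, and the behaviour on plateaus.\<close>

lemma slice_inequality:
  fixes h k :: "'a::euclidean_space \<times> real \<Rightarrow> real" and f :: "real \<Rightarrow> real" and g :: "'a \<Rightarrow> real \<Rightarrow> real \<Rightarrow> real"
  assumes \<alpha>: "0 < \<alpha>" and D: "open D" "x \<in> D"
    and liph: "L-lipschitz_on UNIV h" and lipk: "L'-lipschitz_on UNIV k"
    and prof: "\<And>x. x \<in> D \<Longrightarrow> profile \<alpha> M (\<lambda>t. h (x, t))" and M: "0 \<le> M"
    and supp: "\<And>x t. x \<in> D \<Longrightarrow> t \<in> ivl \<alpha> \<Longrightarrow> real K < t \<Longrightarrow> h (x, t) = 0"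
    and kh: "\<And>x t. x \<in> D \<Longrightarrow> t \<in> ivl \<alpha> \<Longrightarrow> k (x, t) = rearr1 \<alpha> (\<lambda>t. h (x, t)) t"
    and ddh: "\<And>e. e \<in> Basis \<Longrightarrow> AE t in lborel. ddiff h e (x, t)"
    and ddk: "\<And>e. e \<in> Basis \<Longrightarrow> AE t in lborel. ddiff k e (x, t)"
    and f: "continuous_on (ivl \<alpha>) f" "\<And>t. t \<in> ivl \<alpha> \<Longrightarrow> 0 \<le> f t" "\<And>t. t \<in> ivl \<alpha> \<Longrightarrow> t \<le> real K \<Longrightarrow> f t \<le> B" "0 \<le> B"
    and tri: "\<And>s t. s \<in> ivl \<alpha> \<Longrightarrow> t \<in> ivl \<alpha> \<Longrightarrow> s < t \<Longrightarrow> f (t - s) \<le> f s + f t"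
    and sym: "\<And>t. \<alpha> < \<infinity> \<Longrightarrow> t \<in> ivl \<alpha> \<Longrightarrow> f t = f (real_of_ereal \<alpha> - t)"
    and gc: "continuous_on (UNIV \<times> {0..} \<times> {0..}) (\<lambda>(z, s, v). g z s v)"
    and cvx: "\<And>v. 0 \<le> v \<Longrightarrow> convex_on (UNIV \<times> {0..}) (\<lambda>(z, s). g z s v)"
    and mono: "\<And>z v. 0 \<le> v \<Longrightarrow> mono_on {0..} (\<lambda>s. g z s v)"
    and nonneg: "\<And>z s v. 0 \<le> s \<Longrightarrow> 0 \<le> v \<Longrightarrow> 0 \<le> g z s v"
  shows "(\<integral>\<^sup>+t. ennreal (g (hgrad k (x, t)) (f t * \<bar>pd k (0, 1) (x, t)\<bar>) (k (x, t))) * indicator (ivl \<alpha>) t \<partial>lborel)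
    \<le> (\<integral>\<^sup>+t. ennreal (g (hgrad h (x, t)) (f t * \<bar>pd h (0, 1) (x, t)\<bar>) (h (x, t))) * indicator (ivl \<alpha>) t \<partial>lborel)"
proof -
  let ?I = "ivl \<alpha>"
  define p where "p = (\<lambda>t. h (x, t))"
  define q where "q = (\<lambda>t. k (x, t))"
  define P where "P = (\<lambda>t. hgrad h (x, t))"
  define Q where "Q = (\<lambda>t. hgrad k (x, t))"
  define dp where "dp = (\<lambda>t. pd h (0, 1) (x, t))"
  define dq where "dq = (\<lambda>t. pd k (0, 1) (x, t))"
  define \<sigma> where "\<sigma> = (\<lambda>t. indicator ?I t * f t * \<bar>dp t\<bar>)"
  define \<tau> where "\<tau> = (\<lambda>t. indicator ?I t * f t * \<bar>dq t\<bar>)"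
  let ?GQ = "\<lambda>t. ennreal (g (Q t) (\<tau> t) (q t))" and ?GP = "\<lambda>t. ennreal (g (P t) (\<sigma> t) (p t))"
  have L0: "0 \<le> L" "0 \<le> L'" using liph lipk lipschitz_on_nonneg by blast+
  have hc: "continuous_on UNIV h" and kc: "continuous_on UNIV k" using liph lipk lipschitz_on_continuous_on by blast+
  have secc: "continuous_on UNIV (\<lambda>t. w (y, t))" if "continuous_on UNIV w" for w :: "'a \<times> real \<Rightarrow> real" and y
    by (rule continuous_on_compose2[OF that]) (auto intro!: continuous_intros)
  have sec: "(\<lambda>t. w (y, t)) \<in> borel_measurable borel" if "continuous_on UNIV w" for w :: "'a \<times> real \<Rightarrow> real" and y
    by (rule borel_measurable_continuous_onI[OF secc[OF that]])
  have pairm: "(\<lambda>t. (y :: 'a, t :: real)) \<in> borel_measurable borel" for y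
    by (auto intro!: borel_measurable_continuous_onI continuous_intros)
  have Im[measurable]: "?I \<in> sets borel" using open_ivl by (rule borel_open)
  have I0: "?I \<subseteq> {0<..}" by (auto simp: ivl_def)
  have pc: "continuous_on UNIV p" and qc: "continuous_on UNIV q" unfolding p_def q_def by (intro secc hc kc)+
  have pm[measurable]: "p \<in> borel_measurable borel" and qm[measurable]: "q \<in> borel_measurable borel"
    unfolding p_def q_def by (intro sec hc kc)+
  have Pm[measurable]: "P \<in> borel_measurable borel" and Qm[measurable]: "Q \<in> borel_measurable borel"
    unfolding P_def Q_def by (intro measurable_compose[OF pairm] measurable_hgrad hc kc)+
  have dpm[measurable]: "dp \<in> borel_measurable borel" and dqm[measurable]: "dq \<in> borel_measurable borel"
    unfolding dp_def dq_def by (intro measurable_compose[OF pairm] measurable_pd hc kc)+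
  have fm[measurable]: "(\<lambda>t. indicator ?I t * f t) \<in> borel_measurable borel"
    using borel_measurable_continuous_on_indicator[OF Im f(1)] by simp
  have \<sigma>m[measurable]: "\<sigma> \<in> borel_measurable borel" and \<tau>m[measurable]: "\<tau> \<in> borel_measurable borel"
    unfolding \<sigma>_def \<tau>_def by (intro borel_measurable_times[OF fm] borel_measurable_abs dpm dqm)+
  have Bas: "(0::'a, 1::real) \<in> Basis" "\<And>e::'a. e \<in> Basis \<Longrightarrow> (e, 0::real) \<in> Basis" by (auto simp: Basis_prod_def)
  have n01: "norm (0::'a, 1::real) = 1" by (simp add: norm_Pair)
  have dpb: "\<bar>dp t\<bar> \<le> L" and dqb: "\<bar>dq t\<bar> \<le> L'" for t
    using pd_bound[OF liph, of "(0, 1)" "(x, t)"] pd_bound[OF lipk, of "(0, 1)" "(x, t)"] n01 by (simp_all add: dp_def dq_def)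
  have pder: "AE t in lborel. (p has_real_derivative dp t) (at t)"
    using ddh[OF Bas(1)] unfolding p_def dp_def by (rule eventually_mono) (rule vertical_derivative)
  have qder: "AE t in lborel. (q has_real_derivative dq t) (at t)"
    using ddk[OF Bas(1)] unfolding q_def dq_def by (rule eventually_mono) (rule vertical_derivative)
  have plip: "L-lipschitz_on UNIV p"
  proof (rule lipschitz_onI[OF _ L0(1)])
    fix s t show "dist (p s) (p t) \<le> L * dist s t"
      using lipschitz_onD[OF liph, of "(x, s)" "(x, t)"] by (simp add: p_def dist_Pair_Pair)
  qed
  have qlip: "L'-lipschitz_on UNIV q"
  proof (rule lipschitz_onI[OF _ L0(2)])
    fix s t show "dist (q s) (q t) \<le> L' * dist s t"
      using lipschitz_onD[OF lipk, of "(x, s)" "(x, t)"] by (simp add: q_def dist_Pair_Pair)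
  qed
  have profp: "profile \<alpha> M p" using prof[OF D(2)] by (simp add: p_def)
  have hb: "0 \<le> h (y, t) \<and> h (y, t) \<le> M" if "y \<in> D" "t \<in> ?I" for y t
    using prof[OF that(1)] that(2) by (simp add: profile_def)
  have kb: "0 \<le> k (y, t) \<and> k (y, t) \<le> M" if y: "y \<in> D" "t \<in> ?I" for y t
    using rearr1_nonneg[OF prof[OF y(1)], of t] rearr1_le[OF prof[OF y(1)] _ M, of t] kh[OF y] y(2) by (simp add: ivl_def)
  have ksupp: "k (y, t) = 0" if y: "y \<in> D" "t \<in> ?I" and t: "real K < t" for y t
  proof -
    have "level_meas \<alpha> (\<lambda>t. h (y, t)) 0 \<le> measure lebesgue {0..real K}"
      unfolding level_meas_def
    proof (rule measure_mono_fmeasurable)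
      show "{s \<in> ?I. 0 < h (y, s)} \<subseteq> {0..real K}"
      proof
        fix s assume s: "s \<in> {s \<in> ?I. 0 < h (y, s)}"
        then have "\<not> real K < s" using supp[OF y(1), of s] by auto
        then show "s \<in> {0..real K}" using s I0 by auto
      qed
      show "{s \<in> ?I. 0 < h (y, s)} \<in> sets lebesgue" using prof[OF y(1)] by (simp add: profile_def fmeasurableD)
    qed simp
    then have "\<not> t < level_meas \<alpha> (\<lambda>t. h (y, t)) 0" using t by simp
    then have "\<not> 0 < rearr1 \<alpha> (\<lambda>t. h (y, t)) t"
      using rearr1_gt_iff[OF prof[OF y(1)], of t 0] y(2) by (simp add: ivl_def)
    then show ?thesis using kb[OF y] kh[OF y] by simp
  qed
  have opn: "open (D \<times> ?I)" using D(1) open_ivl by (rule open_Times)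
  have hzero: "pd h e (x, t) = 0" if "t \<in> ?I" "h (x, t) = 0" for e t
  proof (rule pd_zero_at_minimum[OF opn])
    show "0 \<le> h y" if "y \<in> D \<times> ?I" for y using that hb by (cases y) auto
  qed (use that D(2) in simp_all)
  have kzero: "pd k e (x, t) = 0" if "t \<in> ?I" "k (x, t) = 0" for e t
  proof (rule pd_zero_at_minimum[OF opn])
    show "0 \<le> k y" if "y \<in> D \<times> ?I" for y using that kb by (cases y) auto
  qed (use that D(2) in simp_all)
  have Pzero: "P t = 0 \<and> \<sigma> t = 0" if "t \<in> ?I" "p t = 0" for t
    using hzero that by (simp add: P_def \<sigma>_def dp_def p_def hgrad_def)
  have Qzero: "Q t = 0 \<and> \<tau> t = 0" if "t \<in> ?I" "q t = 0" for t
    using kzero that by (simp add: Q_def \<tau>_def dq_def q_def hgrad_def)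
  \<comment> \<open>a common bound for all four functions\<close>
  define C where "C = DIM('a) * L + DIM('a) * L' + B * L + B * L'"
  have pos: "0 \<le> DIM('a) * L" "0 \<le> DIM('a) * L'" "0 \<le> B * L" "0 \<le> B * L'" using L0 f(4) by auto
  have PC: "norm (P t) \<le> C" and QC: "norm (Q t) \<le> C" for t
    using hgrad_bound[OF liph, of "(x, t)"] hgrad_bound[OF lipk, of "(x, t)"] pos unfolding C_def P_def Q_def by linarith+
  have C0: "0 \<le> C" using pos unfolding C_def by linarith
  have \<sigma>0: "0 \<le> \<sigma> t" and \<tau>0: "0 \<le> \<tau> t" for t unfolding \<sigma>_def \<tau>_def using f(2) by (auto simp: indicator_def)
  have \<sigma>C: "\<sigma> t \<le> C" for t
  proof (cases "t \<in> ?I \<and> t \<le> real K")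
    case True
    then have "f t * \<bar>dp t\<bar> \<le> B * L" using f(2,3,4) dpb by (intro mult_mono) auto
    then show ?thesis using True pos by (simp add: \<sigma>_def C_def)
  next
    case False
    then have "\<sigma> t = 0"
      using Pzero[of t] supp[OF D(2), of t] by (cases "t \<in> ?I") (simp_all add: \<sigma>_def p_def)
    then show ?thesis using C0 by simp
  qed
  have \<tau>C: "\<tau> t \<le> C" for t
  proof (cases "t \<in> ?I \<and> t \<le> real K")
    case True
    then have "f t * \<bar>dq t\<bar> \<le> B * L'" using f(2,3,4) dqb by (intro mult_mono) auto
    then show ?thesis using True pos by (simp add: \<tau>_def C_def)
  next
    case False
    then have "\<tau> t = 0"
      using Qzero[of t] ksupp[OF D(2), of t] by (cases "t \<in> ?I") (simp_all add: \<tau>_def q_def)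
    then show ?thesis using C0 by simp
  qed
  have levset: "{t \<in> ?I. s < w (y, t)} \<in> sets borel" if "continuous_on UNIV w" for w :: "'a \<times> real \<Rightarrow> real" and y s
    using sec[OF that, of y] by measurable
  have lev: "emeasure lborel {t \<in> ?I. s < h (y, t)} = emeasure lborel {t \<in> ?I. s < k (y, t)}"
    and fin: "emeasure lborel {t \<in> ?I. s < h (y, t)} < \<infinity>" if y: "y \<in> D" and s: "0 \<le> s" for y s
    using emeasure_level_rearr1[OF \<alpha> prof[OF y] s levset[OF hc], of "\<lambda>t. k (y, t)"] kh[OF y] by blast+
  have levp: "emeasure lborel {t \<in> ?I. s < p t} = emeasure lborel {t \<in> ?I. s < q t}" if "0 \<le> s" for s
    unfolding p_def q_def by (rule lev[OF D(2) that])
  have finp: "emeasure lborel {t \<in> ?I. 0 < p t} < \<infinity>" unfolding p_def by (rule fin[OF D(2)]) simp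
  have finE: "emeasure lborel {t \<in> ?I. w t \<in> E} < \<infinity>"
    if "emeasure lborel {t \<in> ?I. 0 < w t} < \<infinity>" "E \<subseteq> {0<..}" and [measurable]: "w \<in> borel_measurable borel" for w :: "real \<Rightarrow> real" and E
  proof -
    have "emeasure lborel {t \<in> ?I. w t \<in> E} \<le> emeasure lborel {t \<in> ?I. 0 < w t}" using that(2) by (intro emeasure_mono) auto
    then show ?thesis using that(1) by (rule le_less_trans)
  qed
  have finq: "emeasure lborel {t \<in> ?I. 0 < q t} < \<infinity>" using levp[of 0] finp by simp
  have dir: "(LINT t:{t \<in> ?I. s < p t}|lborel. pd h (e, 0) (x, t)) = (LINT t:{t \<in> ?I. s < q t}|lborel. pd k (e, 0) (x, t))"
    if e: "e \<in> Basis" and s: "0 \<le> s" for e s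
    unfolding p_def q_def
  proof (rule horizontal_derivative_transport[where D=D and M=M and K="real K", OF liph lipk D Im I0 _ M])
    show "h (y, t) \<le> M \<and> k (y, t) \<le> M" if "y \<in> D" "t \<in> ?I" for y t using hb[OF that] kb[OF that] by blast
    show "h (y, t) \<le> 0 \<and> k (y, t) \<le> 0" if "y \<in> D" "t \<in> ?I" "real K < t" for y t using supp[OF that] ksupp[OF that] by simp
    show "emeasure lborel {t \<in> ?I. 0 < h (y, t)} < \<infinity>" if "y \<in> D" for y by (rule fin[OF that]) simp
  qed (fact lev ddh[OF Bas(2)[OF e]] ddk[OF Bas(2)[OF e]] s)+
  have pdm: "(\<lambda>t. pd w (e, 0) (x, t)) \<in> borel_measurable borel" if "continuous_on UNIV w" for w :: "'a \<times> real \<Rightarrow> real" and e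
    by (rule measurable_compose[OF pairm measurable_pd[OF that]])
  have Em: "{t \<in> ?I. w t \<in> E} \<in> sets borel" if [measurable]: "E \<in> sets borel" "w \<in> borel_measurable borel" for E and w :: "real \<Rightarrow> real"
    by measurable
  have sgn: "emeasure lborel {t \<in> ?I. p t \<in> E} = emeasure lborel {t \<in> ?I. q t \<in> E}"
      "(LINT t:{t \<in> ?I. p t \<in> E}|lborel. pd h (e, 0) (x, t)) = (LINT t:{t \<in> ?I. q t \<in> E}|lborel. pd k (e, 0) (x, t))"
    if E: "E \<in> sets borel" "E \<subseteq> {0<..}" and e: "e \<in> Basis" for E e
  proof -
    have bb: "\<bar>pd h (e, 0) (x, t)\<bar> \<le> L + L'" "\<bar>pd k (e, 0) (x, t)\<bar> \<le> L + L'" for t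
      using pd_bound[OF liph, of "(e, 0)" "(x, t)"] pd_bound[OF lipk, of "(e, 0)" "(x, t)"] e L0 by (simp_all add: norm_Pair)
    note sd = signed_distribution_eq[OF pm qm pdm[OF hc] pdm[OF kc] Im bb levp finp dir[OF e] E]
    show "emeasure lborel {t \<in> ?I. p t \<in> E} = emeasure lborel {t \<in> ?I. q t \<in> E}" by (rule sd(1))
    show "(LINT t:{t \<in> ?I. p t \<in> E}|lborel. pd h (e, 0) (x, t)) = (LINT t:{t \<in> ?I. q t \<in> E}|lborel. pd k (e, 0) (x, t))" by (rule sd(2))
  qed
  have PQ: "(LINT t:{t \<in> ?I. p t \<in> E}|lborel. P t) = (LINT t:{t \<in> ?I. q t \<in> E}|lborel. Q t)"
    if E: "E \<in> sets borel" "E \<subseteq> {0<..}" for E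
  proof (rule euclidean_eqI)
    fix e :: 'a assume e: "e \<in> Basis"
    have iP: "set_integrable lborel {t \<in> ?I. p t \<in> E} P"
      using Em[OF E(1) pm] finE[OF finp E(2) pm] PC by (intro set_integrable_bounded[where B=C]) auto
    have iQ: "set_integrable lborel {t \<in> ?I. q t \<in> E} Q"
      using Em[OF E(1) qm] finE[OF finq E(2) qm] QC by (intro set_integrable_bounded[where B=C]) auto
    have "(LINT t:{t \<in> ?I. p t \<in> E}|lborel. P t) \<bullet> e = (LINT t:{t \<in> ?I. p t \<in> E}|lborel. pd h (e, 0) (x, t))"
      using integral_inner_left[OF iP[unfolded set_integrable_def], of e] e
      by (simp add: set_lebesgue_integral_def P_def hgrad_inner)
    moreover have "(LINT t:{t \<in> ?I. q t \<in> E}|lborel. Q t) \<bullet> e = (LINT t:{t \<in> ?I. q t \<in> E}|lborel. pd k (e, 0) (x, t))"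
      using integral_inner_left[OF iQ[unfolded set_integrable_def], of e] e
      by (simp add: set_lebesgue_integral_def Q_def hgrad_inner)
    ultimately show "(LINT t:{t \<in> ?I. p t \<in> E}|lborel. P t) \<bullet> e = (LINT t:{t \<in> ?I. q t \<in> E}|lborel. Q t) \<bullet> e"
      using sgn(2)[OF E e] by simp
  qed
  have st: "(LINT t:{t \<in> ?I. q t \<in> E}|lborel. \<tau> t) \<le> (LINT t:{t \<in> ?I. p t \<in> E}|lborel. \<sigma> t)"
    if E: "E \<in> sets borel" "E \<subseteq> {0<..}" for E
  proof -
    have i\<sigma>: "set_integrable lborel {t \<in> ?I. p t \<in> E} \<sigma>"
      using Em[OF E(1) pm] finE[OF finp E(2) pm] \<sigma>C \<sigma>0 by (intro set_integrable_bounded[where B=C]) auto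
    have i\<tau>: "set_integrable lborel {t \<in> ?I. q t \<in> E} \<tau>"
      using Em[OF E(1) qm] finE[OF finq E(2) qm] \<tau>C \<tau>0 by (intro set_integrable_bounded[where B=C]) auto
    have nn\<tau>: "ennreal (LINT t:{t \<in> ?I. q t \<in> E}|lborel. \<tau> t) = (\<integral>\<^sup>+t. ennreal (f t) * ennreal \<bar>dq t\<bar> * indicator {t \<in> ?I. q t \<in> E} t \<partial>lborel)"
      unfolding set_lebesgue_integral_def
      by (subst nn_integral_eq_integral[OF i\<tau>[unfolded set_integrable_def], symmetric])
         (auto intro!: nn_integral_cong simp: \<tau>0 \<tau>_def f(2) ennreal_mult split: split_indicator)
    have nn\<sigma>: "ennreal (LINT t:{t \<in> ?I. p t \<in> E}|lborel. \<sigma> t) = (\<integral>\<^sup>+t. ennreal (f t) * ennreal \<bar>dp t\<bar> * indicator {t \<in> ?I. p t \<in> E} t \<partial>lborel)"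
      unfolding set_lebesgue_integral_def
      by (subst nn_integral_eq_integral[OF i\<sigma>[unfolded set_integrable_def], symmetric])
         (auto intro!: nn_integral_cong simp: \<sigma>0 \<sigma>_def f(2) ennreal_mult split: split_indicator)
    have qr: "\<And>t. t \<in> ?I \<Longrightarrow> q t = rearr1 \<alpha> p t" unfolding q_def p_def by (rule kh[OF D(2)])
    have sp: "\<And>t. t \<in> ?I \<Longrightarrow> 0 < p t \<Longrightarrow> t \<le> real K" using supp[OF D(2)] unfolding p_def by (metis less_irrefl not_le)
    have "ennreal (LINT t:{t \<in> ?I. q t \<in> E}|lborel. \<tau> t) \<le> ennreal (LINT t:{t \<in> ?I. p t \<in> E}|lborel. \<sigma> t)"
      unfolding nn\<tau> nn\<sigma>
      by (rule weighted_coarea_rearrangement[OF \<alpha> profp _ plip dpm dpb pder qlip dqm dqb qder])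
         (fact qr sp f(1) f(2) f(3) tri sym E)+
    moreover have "0 \<le> (LINT t:{t \<in> ?I. p t \<in> E}|lborel. \<sigma> t)"
      unfolding set_lebesgue_integral_def by (rule integral_nonneg_AE) (simp add: \<sigma>0)
    ultimately show ?thesis by (simp add: ennreal_le_iff)
  qed
  have "AE t in lborel. ddiff k (0, 1) (x, t) \<and> (\<forall>e\<in>Basis. ddiff k (e, 0) (x, t))"
    using ddk[OF Bas(1)] AE_finite_allI[OF finite_Basis ddk[OF Bas(2)]] by (rule eventually_conj)
  then obtain Z where Z: "Z \<in> null_sets lborel" "{t. \<not> (ddiff k (0, 1) (x, t) \<and> (\<forall>e\<in>Basis. ddiff k (e, 0) (x, t)))} \<subseteq> Z"
    unfolding eventually_ae_filter by auto
  have anti: "k (y, t) \<le> k (y, s)" if "y \<in> D" "s \<in> ?I" "t \<in> ?I" "s \<le> t" for y s t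
    using rearr1_antimono[OF prof[OF that(1)], of s t] that by (simp add: kh ivl_def)
  have sat': "Q s = Q t \<and> \<tau> s = \<tau> t" if s: "s \<in> ?I - Z" and t: "t \<in> ?I - Z" and eq: "q s = q t" and lt: "s < t" for s t
  proof -
    have sd: "ddiff k (0, 1) (x, s)" "\<And>e. e \<in> Basis \<Longrightarrow> ddiff k (e, 0) (x, s)" using s Z(2) by auto
    have td: "ddiff k (0, 1) (x, t)" "\<And>e. e \<in> Basis \<Longrightarrow> ddiff k (e, 0) (x, t)" using t Z(2) by auto
    have sI: "s \<in> ?I" and tI: "t \<in> ?I" using s t by auto
    have eq': "k (x, s) = k (x, t)" using eq by (simp add: q_def)
    note plat = monotone_plateau_derivatives[where k=k and I="?I", OF D is_interval_ivl sI tI lt anti eq']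
    have "pd k (e, 0) (x, s) = pd k (e, 0) (x, t)" if "e \<in> Basis" for e
      by (rule plat(1)) (use sd(2)[OF that] td(2)[OF that] in simp_all)
    then have "Q s = Q t" unfolding Q_def hgrad_def by (intro sum.cong) auto
    moreover have "dq s = 0" unfolding dq_def by (rule plat(2)) (use sd(1) in simp_all)
    moreover have "dq t = 0" unfolding dq_def by (rule plat(3)) (use td(1) in simp_all)
    ultimately show ?thesis by (simp add: \<tau>_def)
  qed
  have sat: "Q s = Q t \<and> \<tau> s = \<tau> t" if s: "s \<in> ?I - Z" and t: "t \<in> ?I - Z" and eq: "q s = q t" for s t
  proof (rule linorder_cases[of s t])
    assume "s < t" then show ?thesis by (rule sat'[OF s t eq])
  next
    assume "t < s" then show ?thesis using sat'[OF t s eq[symmetric]] by simp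
  qed simp
  have main: "(\<integral>\<^sup>+t. ?GQ t * indicator {t \<in> ?I. 0 < q t} t \<partial>lborel)
    \<le> (\<integral>\<^sup>+t. ?GP t * indicator {t \<in> ?I. 0 < p t} t \<partial>lborel)"
  proof (rule fibrewise_jensen[where C=C and M=M, OF Pm Qm \<sigma>m \<tau>m pm qc Im _ _ finp _ _ _ Z(1)])
    show "norm (P t) \<le> C \<and> 0 \<le> \<sigma> t \<and> \<sigma> t \<le> C \<and> 0 \<le> p t \<and> p t \<le> M" if "t \<in> ?I" for t
      using PC \<sigma>0 \<sigma>C hb[OF D(2) that] by (simp add: p_def)
    show "norm (Q t) \<le> C \<and> 0 \<le> \<tau> t \<and> \<tau> t \<le> C \<and> 0 \<le> q t \<and> q t \<le> M" if "t \<in> ?I" for t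
      using QC \<tau>0 \<tau>C kb[OF D(2) that] by (simp add: q_def)
    show "emeasure lborel {t \<in> ?I. p t \<in> E} = emeasure lborel {t \<in> ?I. q t \<in> E}" if "E \<in> sets borel" "E \<subseteq> {0<..}" for E
      using sgn(1)[OF that SOME_Basis] .
  qed (fact PQ st sat gc cvx mono nonneg)+
  have pIpos: "0 \<le> p t" and qIpos: "0 \<le> q t" if "t \<in> ?I" for t
    using hb[OF D(2) that] kb[OF D(2) that] by (simp_all add: p_def q_def)
  have zeroeq: "emeasure lborel {t \<in> ?I. p t = 0} = emeasure lborel {t \<in> ?I. q t = 0}"
  proof -
    have "{t \<in> ?I. p t = 0} = ?I - {t \<in> ?I. 0 < p t}" "{t \<in> ?I. q t = 0} = ?I - {t \<in> ?I. 0 < q t}"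
      using pIpos qIpos by (auto simp: order.order_iff_strict)
    moreover have "emeasure lborel (?I - {t \<in> ?I. 0 < p t}) = emeasure lborel ?I - emeasure lborel {t \<in> ?I. 0 < p t}"
      using finp by (intro emeasure_Diff) auto
    moreover have "emeasure lborel (?I - {t \<in> ?I. 0 < q t}) = emeasure lborel ?I - emeasure lborel {t \<in> ?I. 0 < q t}"
      using finq by (intro emeasure_Diff) auto
    ultimately show ?thesis using levp[of 0] by simp
  qed
  have Sc: "UNIV \<times> {0..} \<times> {0..} \<in> sets (borel :: ('a \<times> real \<times> real) measure)"
    by (intro borel_closed closed_Times) auto
  have gPm: "(\<lambda>t. g (P t) (\<sigma> t) (p t) * indicator {t \<in> ?I. 0 < p t} t) \<in> borel_measurable lborel"
    using borel_measurable_compose_continuous_on[OF gc Sc, of "\<lambda>t. (P t, \<sigma> t, p t)" lborel "{t \<in> ?I. 0 < p t}"] \<sigma>0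
    by (simp add: borel_measurable_Pair)
  have gQm: "(\<lambda>t. g (Q t) (\<tau> t) (q t) * indicator {t \<in> ?I. 0 < q t} t) \<in> borel_measurable lborel"
    using borel_measurable_compose_continuous_on[OF gc Sc, of "\<lambda>t. (Q t, \<tau> t, q t)" lborel "{t \<in> ?I. 0 < q t}"] \<tau>0
    by (simp add: borel_measurable_Pair)
  have eP: "(\<integral>\<^sup>+t. ?GP t * indicator ?I t \<partial>lborel)
      = (\<integral>\<^sup>+t. ?GP t * indicator {t \<in> ?I. 0 < p t} t \<partial>lborel) + ennreal (g 0 0 0) * emeasure lborel {t \<in> ?I. p t = 0}"
    by (rule split_zero_level[OF gPm Im pm pIpos]) (simp_all add: Pzero)
  have eQ: "(\<integral>\<^sup>+t. ?GQ t * indicator ?I t \<partial>lborel)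
      = (\<integral>\<^sup>+t. ?GQ t * indicator {t \<in> ?I. 0 < q t} t \<partial>lborel) + ennreal (g 0 0 0) * emeasure lborel {t \<in> ?I. q t = 0}"
    by (rule split_zero_level[OF gQm Im qm qIpos]) (simp_all add: Qzero)
  have "(\<integral>\<^sup>+t. ?GQ t * indicator ?I t \<partial>lborel) \<le> (\<integral>\<^sup>+t. ?GP t * indicator ?I t \<partial>lborel)"
    unfolding eP eQ zeroeq by (rule add_right_mono[OF main])
  moreover have "(\<integral>\<^sup>+t. ?GQ t * indicator ?I t \<partial>lborel)
      = (\<integral>\<^sup>+t. ennreal (g (hgrad k (x, t)) (f t * \<bar>pd k (0, 1) (x, t)\<bar>) (k (x, t))) * indicator ?I t \<partial>lborel)"
    by (intro nn_integral_cong) (auto simp: Q_def \<tau>_def dq_def q_def split: split_indicator)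
  moreover have "(\<integral>\<^sup>+t. ?GP t * indicator ?I t \<partial>lborel)
      = (\<integral>\<^sup>+t. ennreal (g (hgrad h (x, t)) (f t * \<bar>pd h (0, 1) (x, t)\<bar>) (h (x, t))) * indicator ?I t \<partial>lborel)"
    by (intro nn_integral_cong) (auto simp: P_def \<sigma>_def dp_def p_def split: split_indicator)
  ultimately show ?thesis by simp
qed

section \<open>Integration over the lines\<close>

lemma level_meas_cong:
  assumes "\<And>t. t \<in> ivl \<alpha> \<Longrightarrow> p t = q t"
  shows "level_meas \<alpha> p = level_meas \<alpha> q"
proof
  fix c
  have "{t \<in> ivl \<alpha>. c < p t} = {t \<in> ivl \<alpha>. c < q t}" using assms by auto
  then show "level_meas \<alpha> p c = level_meas \<alpha> q c" by (simp only: level_meas_def)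
qed

lemma rearr1_cong:
  assumes "\<And>t. t \<in> ivl \<alpha> \<Longrightarrow> p t = q t"
  shows "rearr1 \<alpha> p y = rearr1 \<alpha> q y"
proof -
  have "level_meas \<alpha> p = level_meas \<alpha> q" by (rule level_meas_cong) (fact assms)
  then show ?thesis by (simp only: rearr1_def)
qed

lemma profile_cong:
  assumes eq: "\<And>t. t \<in> ivl \<alpha> \<Longrightarrow> p t = q t" and "profile \<alpha> M p"
  shows "profile \<alpha> M q"
proof -
  have "{t \<in> ivl \<alpha>. c < p t} = {t \<in> ivl \<alpha>. c < q t}" for c using eq by auto
  then show ?thesis using assms unfolding profile_def by simp
qed

text \<open>On the open cylinder the weak gradient can be replaced by the partial derivatives of a Lipschitz
  extension, which are Borel functions, so that Tonelli's theorem applies.\<close>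

lemma energy_eq_iterated:
  fixes \<Omega>' :: "'a::euclidean_space set" and h w :: "'a \<times> real \<Rightarrow> real" and G :: "'a \<Rightarrow> real \<Rightarrow> real \<Rightarrow> 'a \<Rightarrow> real"
  assumes \<Omega>: "open \<Omega>'" and lip: "L-lipschitz_on UNIV h" and wh: "\<And>z. z \<in> cyl \<alpha> \<Omega>' \<Longrightarrow> w z = h z"
    and pos: "\<And>z. z \<in> cyl \<alpha> \<Omega>' \<Longrightarrow> 0 \<le> h z"
    and f: "continuous_on (closure (cyl \<alpha> \<Omega>')) f" "\<And>z. z \<in> cyl \<alpha> \<Omega>' \<Longrightarrow> 0 \<le> f z"
    and Gc: "continuous_on (UNIV \<times> {0..} \<times> {0..} \<times> \<Omega>') (\<lambda>(z', t, v, x'). G z' t v x')"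
  shows "energy \<alpha> \<Omega>' f G w
    = (\<integral>\<^sup>+x. (\<integral>\<^sup>+t. ennreal (G (hgrad h (x, t)) (f (x, t) * \<bar>pd h (0, 1) (x, t)\<bar>) (h (x, t)) x) * indicator (ivl \<alpha>) t \<partial>lborel) * indicator \<Omega>' x \<partial>lborel)"
proof -
  let ?C = "cyl \<alpha> \<Omega>'"
  have hc: "continuous_on UNIV h" using lip lipschitz_on_continuous_on by blast
  have oC: "open ?C" by (rule open_cyl[OF \<Omega>])
  have Cm[measurable]: "?C \<in> sets borel" using oC by (rule borel_open)
  let ?W = "weak_grad ?C w"
  define F where "F = (\<lambda>z. G (hgrad h z) ((indicator ?C z * f z) * \<bar>pd h (0, 1) z\<bar>) (h z) (fst z) * indicator ?C z)"
  have Bas: "(0::'a, 1::real) \<in> Basis" "\<And>e::'a. e \<in> Basis \<Longrightarrow> (e, 0::real) \<in> Basis" by (auto simp: Basis_prod_def)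
  have Fm: "F \<in> borel_measurable borel"
  proof -
    have hm: "h \<in> borel_measurable borel" by (rule borel_measurable_continuous_onI[OF hc])
    have fm: "(\<lambda>z. indicator ?C z * f z) \<in> borel_measurable borel"
      using borel_measurable_continuous_on_indicator[OF Cm continuous_on_subset[OF f(1) closure_subset]] by simp
    have m1: "(\<lambda>z. (indicator ?C z * f z) * \<bar>pd h (0, 1) z\<bar>) \<in> borel_measurable borel"
      by (intro borel_measurable_times[OF fm] borel_measurable_abs measurable_pd[OF hc])
    have m2: "(fst :: 'a \<times> real \<Rightarrow> 'a) \<in> borel_measurable borel"
      by (auto intro!: borel_measurable_continuous_onI continuous_intros)
    have X: "(\<lambda>z. (hgrad h z, (indicator ?C z * f z) * \<bar>pd h (0, 1) z\<bar>, h z, fst z)) \<in> borel_measurable borel"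
      by (intro borel_measurable_Pair measurable_hgrad[OF hc] m1 hm m2)
    have eq: "(UNIV \<times> {0..} \<times> {0..} \<times> \<Omega>' :: ('a \<times> real \<times> real \<times> 'a) set)
      = (UNIV \<times> {0..} \<times> {0..} \<times> UNIV) \<inter> (UNIV \<times> UNIV \<times> UNIV \<times> \<Omega>')" by auto
    have c: "(UNIV \<times> {0..} \<times> {0..} \<times> UNIV :: ('a \<times> real \<times> real \<times> 'a) set) \<in> sets borel"
      by (intro borel_closed closed_Times) auto
    have o: "(UNIV \<times> UNIV \<times> UNIV \<times> \<Omega>' :: ('a \<times> real \<times> real \<times> 'a) set) \<in> sets borel"
      by (intro borel_open open_Times \<Omega>) auto
    have S: "(UNIV \<times> {0..} \<times> {0..} \<times> \<Omega>' :: ('a \<times> real \<times> real \<times> 'a) set) \<in> sets borel"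
      unfolding eq by (rule sets.Int[OF c o])
    show ?thesis
      using borel_measurable_compose_continuous_on[OF Gc S X Cm] pos f(2)
      by (simp add: F_def cyl_def case_prod_beta mem_Times_iff)
  qed
  have FE: "F z = G (hgrad h z) (f z * \<bar>pd h (0, 1) z\<bar>) (h z) (fst z) * indicator ?C z" for z
    by (simp add: F_def split: split_indicator)
  have "energy \<alpha> \<Omega>' f G w = (\<integral>\<^sup>+z. ennreal (G (fst (?W z)) (f z * \<bar>snd (?W z)\<bar>) (w z) (fst z)) * indicator ?C z \<partial>lebesgue)"
    unfolding energy_def by (rule nn_integral_restrict_space) (use Cm in simp)
  also have "\<dots> = (\<integral>\<^sup>+z. ennreal (G (fst (?W z)) (f z * \<bar>snd (?W z)\<bar>) (w z) (fst z)) * indicator ?C z \<partial>lborel)"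
    by (rule nn_integral_completion)
  also have "\<dots> = (\<integral>\<^sup>+z. ennreal (F z) \<partial>lborel)"
  proof (rule nn_integral_cong_AE)
    show "AE z in lborel. ennreal (G (fst (?W z)) (f z * \<bar>snd (?W z)\<bar>) (w z) (fst z)) * indicator ?C z = ennreal (F z)"
      using weak_grad_lipschitz_AE[OF oC lip wh]
    proof (rule eventually_mono)
      fix z assume *: "z \<in> ?C \<longrightarrow> (\<forall>e\<in>Basis. ?W z \<bullet> e = pd h e z)"
      show "ennreal (G (fst (?W z)) (f z * \<bar>snd (?W z)\<bar>) (w z) (fst z)) * indicator ?C z = ennreal (F z)"
      proof (cases "z \<in> ?C")
        case True
        have e: "?W z \<bullet> e = pd h e z" if "e \<in> Basis" for e using * True that by blast
        have "fst (?W z) = hgrad h z"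
        proof (rule euclidean_eqI)
          fix e :: 'a assume b: "e \<in> Basis"
          show "fst (?W z) \<bullet> e = hgrad h z \<bullet> e"
            using e[OF Bas(2)[OF b]] by (simp add: hgrad_inner[OF b] inner_prod_def)
        qed
        moreover have "snd (?W z) = pd h (0, 1) z" using e[OF Bas(1)] by (simp add: inner_prod_def)
        ultimately show ?thesis using True wh[OF True] by (simp add: F_def)
      qed (simp add: F_def)
    qed
  qed
  also have "\<dots> = (\<integral>\<^sup>+z. ennreal (F z) \<partial>(lborel \<Otimes>\<^sub>M lborel))" by (simp only: lborel_prod)
  also have "\<dots> = (\<integral>\<^sup>+x. (\<integral>\<^sup>+t. ennreal (F (x, t)) \<partial>lborel) \<partial>lborel)"
  proof (rule lborel.nn_integral_fst[symmetric])
    show "(\<lambda>z. ennreal (F z)) \<in> borel_measurable (lborel \<Otimes>\<^sub>M lborel)"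
      using Fm by (simp add: lborel_prod)
  qed
  also have "\<dots> = (\<integral>\<^sup>+x. (\<integral>\<^sup>+t. ennreal (G (hgrad h (x, t)) (f (x, t) * \<bar>pd h (0, 1) (x, t)\<bar>) (h (x, t)) x) * indicator (ivl \<alpha>) t \<partial>lborel) * indicator \<Omega>' x \<partial>lborel)"
  proof (rule nn_integral_cong)
    fix x
    show "(\<integral>\<^sup>+t. ennreal (F (x, t)) \<partial>lborel)
      = (\<integral>\<^sup>+t. ennreal (G (hgrad h (x, t)) (f (x, t) * \<bar>pd h (0, 1) (x, t)\<bar>) (h (x, t)) x) * indicator (ivl \<alpha>) t \<partial>lborel) * indicator \<Omega>' x"
    proof (cases "x \<in> \<Omega>'")
      case True
      then show ?thesis by (simp, intro nn_integral_cong) (simp add: FE cyl_def indicator_def)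
    next
      case False
      then show ?thesis by (simp add: FE cyl_def)
    qed
  qed
  finally show ?thesis .
qed

theorem theorem3p7:
  fixes \<alpha> :: ereal
    and \<Omega>' :: "(real ^ 'n) set"
    and f :: "(real ^ 'n) \<times> real \<Rightarrow> real"
    and G :: "(real ^ 'n) \<Rightarrow> real \<Rightarrow> real \<Rightarrow> (real ^ 'n) \<Rightarrow> real"
    and u :: "(real ^ 'n) \<times> real \<Rightarrow> real"
  assumes "0 < \<alpha>"
    and "open \<Omega>'" and "connected \<Omega>'" and "\<Omega>' \<noteq> {}" and "bounded \<Omega>'"
    and "lipschitz_boundary \<Omega>'"
    and "continuous_on (closure (cyl \<alpha> \<Omega>')) f"
    and "\<And>x. x \<in> cyl \<alpha> \<Omega>' \<Longrightarrow> 0 < f x"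
    and "\<And>x' y1 y2. x' \<in> closure \<Omega>' \<Longrightarrow> y1 \<in> closure (ivl \<alpha>) \<Longrightarrow> y2 \<in> closure (ivl \<alpha>) \<Longrightarrow>
           y1 \<le> y2 \<Longrightarrow> f (x', y2 - y1) \<le> f (x', y1) + f (x', y2)"
    and "\<And>x' y. \<alpha> < \<infinity> \<Longrightarrow> (x', y) \<in> closure (cyl \<alpha> \<Omega>') \<Longrightarrow>
           f (x', y) = f (x', real_of_ereal \<alpha> - y)"
    and "\<And>z' t v x'. 0 \<le> t \<Longrightarrow> 0 \<le> v \<Longrightarrow> x' \<in> \<Omega>' \<Longrightarrow> 0 \<le> G z' t v x'"
    and "continuous_on (UNIV \<times> {0..} \<times> {0..} \<times> \<Omega>') (\<lambda>(z', t, v, x'). G z' t v x')"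
    and "\<And>v x'. 0 \<le> v \<Longrightarrow> x' \<in> \<Omega>' \<Longrightarrow> convex_on (UNIV \<times> {0..}) (\<lambda>(z', t). G z' t v x')"
    and "\<And>z' v x'. 0 \<le> v \<Longrightarrow> x' \<in> \<Omega>' \<Longrightarrow> mono_on {0..} (\<lambda>t. G z' t v x')"
    and "u \<in> L_class \<alpha> \<Omega>'"
  shows "rearr \<alpha> \<Omega>' u \<in> L_class \<alpha> \<Omega>' \<and>
         energy \<alpha> \<Omega>' f G (rearr \<alpha> \<Omega>' u) \<le> energy \<alpha> \<Omega>' f G u"
proof
  note \<alpha> = assms(1) and \<Omega> = assms(2) and u = assms(15)
  show Lu: "rearr \<alpha> \<Omega>' u \<in> L_class \<alpha> \<Omega>'" by (rule rearr_L_class[OF \<alpha> \<Omega> assms(5) u])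
  let ?C = "cyl \<alpha> \<Omega>'"
  let ?J = "\<lambda>w x. \<integral>\<^sup>+t. ennreal (G (hgrad w (x, t)) (f (x, t) * \<bar>pd w (0, 1) (x, t)\<bar>) (w (x, t)) x) * indicator (ivl \<alpha>) t \<partial>lborel"
  have CC: "?C \<subseteq> closure ?C" by (rule closure_subset)
  obtain L R M where L: "L-lipschitz_on (closure ?C) u" and R: "0 < R" and M: "0 \<le> M"
    and zero: "\<And>x t. (x, t) \<in> ?C \<Longrightarrow> R < t \<Longrightarrow> u (x, t) = 0"
    and ub: "\<And>x. x \<in> ?C \<Longrightarrow> 0 \<le> u x \<and> u x \<le> M"
    and profu: "\<And>x. x \<in> \<Omega>' \<Longrightarrow> profile \<alpha> M (\<lambda>t. u (x, t))"
    by (rule L_class_facts[OF u]) blast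
  obtain L' where L': "L'-lipschitz_on (closure ?C) (rearr \<alpha> \<Omega>' u)" using Lu by (auto simp: L_class_def)
  obtain h where h: "L-lipschitz_on UNIV h" "\<And>z. z \<in> closure ?C \<Longrightarrow> h z = u z"
    using lipschitz_extension_real[OF L] by blast
  obtain k where k: "L'-lipschitz_on UNIV k" "\<And>z. z \<in> closure ?C \<Longrightarrow> k z = rearr \<alpha> \<Omega>' u z"
    using lipschitz_extension_real[OF L'] by blast
  obtain K :: nat where K: "R \<le> real K" using real_arch_simple by blast
  have inC: "(x, t) \<in> ?C" if "x \<in> \<Omega>'" "t \<in> ivl \<alpha>" for x t using that by (simp add: cyl_def)
  have hu: "h (x, t) = u (x, t)" if "x \<in> \<Omega>'" "t \<in> ivl \<alpha>" for x t using h(2) inC[OF that] CC by blast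
  have prof: "profile \<alpha> M (\<lambda>t. h (x, t))" if x: "x \<in> \<Omega>'" for x
    by (rule profile_cong[OF _ profu[OF x]]) (simp add: hu[OF x])
  have kh: "k (x, t) = rearr1 \<alpha> (\<lambda>t. h (x, t)) t" if x: "x \<in> \<Omega>'" and t: "t \<in> ivl \<alpha>" for x t
  proof -
    have "k (x, t) = rearr1 \<alpha> (\<lambda>t. u (x, t)) t"
      using k(2)[of "(x, t)"] inC[OF x t] CC by (auto simp: rearr_def rearr_pt_eq)
    also have "\<dots> = rearr1 \<alpha> (\<lambda>t. h (x, t)) t" by (rule rearr1_cong) (simp add: hu[OF x])
    finally show ?thesis .
  qed
  have supp: "h (x, t) = 0" if "x \<in> \<Omega>'" "t \<in> ivl \<alpha>" "real K < t" for x t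
    using zero[OF inC[OF that(1,2)]] hu[OF that(1,2)] that(3) K by simp
  have hpos: "0 \<le> h z" if "z \<in> ?C" for z using ub[OF that] h(2)[OF subsetD[OF CC that]] by simp
  have kpos: "0 \<le> k z" if "z \<in> ?C" for z
  proof -
    have z: "z = (fst z, snd z)" "fst z \<in> \<Omega>'" "snd z \<in> ivl \<alpha>"
      using \<open>z \<in> ?C\<close> by (auto simp: cyl_def)
    show ?thesis using kh[OF z(2,3)] rearr1_nonneg[OF prof[OF z(2)]] by simp
  qed
  have fpos: "0 \<le> f z" if "z \<in> ?C" for z using assms(8)[OF that] by simp
  have "AE z in lborel. \<forall>e\<in>Basis. ddiff h e z \<and> ddiff k e z"
  proof (rule AE_finite_allI[OF finite_Basis])
    fix e :: "(real ^ 'n) \<times> real"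
    show "AE z in lborel. ddiff h e z \<and> ddiff k e z"
      using lipschitz_AE_ddiff[OF h(1), of e] lipschitz_AE_ddiff[OF k(1), of e] by (rule eventually_conj)
  qed
  then have "AE z in lborel \<Otimes>\<^sub>M lborel. \<forall>e\<in>Basis. ddiff h e z \<and> ddiff k e z" by (simp only: lborel_prod)
  then have good: "AE x in lborel. AE t in lborel. \<forall>e\<in>Basis. ddiff h e (x, t) \<and> ddiff k e (x, t)"
    by (rule lborel_pair.AE_pair)
  have eh: "energy \<alpha> \<Omega>' f G u
    = (\<integral>\<^sup>+x. ?J h x * indicator \<Omega>' x \<partial>lborel)"
    by (rule energy_eq_iterated[OF \<Omega> h(1) _ hpos assms(7) fpos assms(12)]) (use h(2) CC in auto)
  have ek: "energy \<alpha> \<Omega>' f G (rearr \<alpha> \<Omega>' u)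
    = (\<integral>\<^sup>+x. ?J k x * indicator \<Omega>' x \<partial>lborel)"
    by (rule energy_eq_iterated[OF \<Omega> k(1) _ kpos assms(7) fpos assms(12)]) (use k(2) CC in auto)
  show "energy \<alpha> \<Omega>' f G (rearr \<alpha> \<Omega>' u) \<le> energy \<alpha> \<Omega>' f G u"
    unfolding eh ek
  proof (rule nn_integral_mono_AE)
    show "AE x in lborel. ?J k x * indicator \<Omega>' x
      \<le> ?J h x * indicator \<Omega>' x"
      using good
    proof (rule eventually_mono)
      fix x assume dd: "AE t in lborel. \<forall>e\<in>Basis. ddiff h e (x, t) \<and> ddiff k e (x, t)"
      show "?J k x * indicator \<Omega>' x
      \<le> ?J h x * indicator \<Omega>' x"
      proof (cases "x \<in> \<Omega>'")
        case x: True
        have fc: "continuous_on (closure (ivl \<alpha>)) (\<lambda>t. f (x, t))"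
        proof (rule continuous_on_compose2[OF assms(7)])
          show "(\<lambda>t. (x, t)) ` closure (ivl \<alpha>) \<subseteq> closure ?C"
            using x closure_subset[of \<Omega>'] by (auto simp: closure_cyl)
        qed (intro continuous_intros)
        have "compact ((\<lambda>t. f (x, t)) ` (closure (ivl \<alpha>) \<inter> {0..real K}))"
          by (intro compact_continuous_image continuous_on_subset[OF fc] closed_Int_compact) auto
        then have "bounded ((\<lambda>t. f (x, t)) ` (closure (ivl \<alpha>) \<inter> {0..real K}))" by (rule compact_imp_bounded)
        then obtain B where B: "B > 0" "\<forall>v\<in>(\<lambda>t. f (x, t)) ` (closure (ivl \<alpha>) \<inter> {0..real K}). norm v \<le> B"
          unfolding bounded_pos by blast
        have fB: "f (x, t) \<le> B" if "t \<in> ivl \<alpha>" "t \<le> real K" for t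
        proof -
          have "t \<in> closure (ivl \<alpha>) \<inter> {0..real K}" using that closure_subset[of "ivl \<alpha>"] by (auto simp: ivl_def)
          then have "norm (f (x, t)) \<le> B" using B(2) by blast
          then show ?thesis by simp
        qed
        have Gx: "continuous_on (UNIV \<times> {0..} \<times> {0..}) (\<lambda>(z, s, v). G z s v x)"
        proof -
          have eq: "(\<lambda>(z, s, v). G z s v x) = (\<lambda>(z', t, v, x'). G z' t v x') \<circ> (\<lambda>y. (fst y, fst (snd y), snd (snd y), x))"
            by (auto simp: fun_eq_iff)
          show ?thesis unfolding eq
            by (rule continuous_on_compose[OF _ continuous_on_subset[OF assms(12)]]) (use x in \<open>auto intro!: continuous_intros\<close>)
        qed
        have ddh: "AE t in lborel. ddiff h e (x, t)" and ddk: "AE t in lborel. ddiff k e (x, t)" if "e \<in> Basis" for e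
          using dd that by (auto elim!: eventually_mono)
        have "?J k x
          \<le> ?J h x"
        proof (rule slice_inequality[where g="\<lambda>z s v. G z s v x" and f="\<lambda>t. f (x, t)" and D=\<Omega>' and M=M and K=K and B=B, OF \<alpha> \<Omega> x h(1) k(1)])
          show "continuous_on (ivl \<alpha>) (\<lambda>t. f (x, t))" by (rule continuous_on_subset[OF fc closure_subset])
          show "0 \<le> f (x, t)" if "t \<in> ivl \<alpha>" for t by (rule fpos[OF inC[OF x that]])
          show "0 \<le> B" using B(1) by simp
          show "f (x, t - s) \<le> f (x, s) + f (x, t)" if "s \<in> ivl \<alpha>" "t \<in> ivl \<alpha>" "s < t" for s t
            using assms(9)[of x s t] that x closure_subset[of \<Omega>'] closure_subset[of "ivl \<alpha>"] by auto
          show "f (x, t) = f (x, real_of_ereal \<alpha> - t)" if "\<alpha> < \<infinity>" "t \<in> ivl \<alpha>" for t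
            by (rule assms(10)[OF that(1) subsetD[OF CC inC[OF x that(2)]]])
          show "convex_on (UNIV \<times> {0..}) (\<lambda>(z, s). G z s v x)" if "0 \<le> v" for v by (rule assms(13)[OF that x])
          show "mono_on {0..} (\<lambda>s. G z s v x)" if "0 \<le> v" for z v by (rule assms(14)[OF that x])
          show "0 \<le> G z s v x" if "0 \<le> s" "0 \<le> v" for z s v by (rule assms(11)[OF that x])
        qed (fact prof M supp kh ddh ddk fB Gx)+
        then show ?thesis using x by simp
      qed simp
    qed
  qed
qed

end
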